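(* Let $\mathcal{M}$ be a von Neumann algebra equipped with a semifinite faithful normal trace $\tau$. If $\mathcal{M}$ is not $\sigma$-finite, then every non-trivial symmetric space $E(\mathcal{M},\tau)\subset S(\mathcal{M},\tau)$ whose carrier projection satisfies $c_{E(\mathcal{M},\tau)}=\mathbf{1}$ fails the ball-covering property (BCP).
   Context: BCP: a normed space $X$ has the ball-covering property if its unit sphere is contained in the union of countably many (open or closed) balls, none of which contains the origin. $S(\mathcal{M},\tau)$ is the $*$-algebra of $\tau$-measurable operators (closed densely defined operators $x$ affiliated with $\mathcal{M}$ with $\tau(e^{|x|}(\lambda,\infty))<\infty$ for some $\lambda>0$, $e^{|x|}$ being the spectral measure of $|x|$). For $x\in S(\mathcal{M},\tau)$ and $t>0$, $\mu(t;x)=\inf\{\|xp\|_\infty: p\in\mathcal{M}\text{ a projection},\ \tau(\mathbf{1}-p)\le t\}$. A symmetric space is a linear subspace $E(\mathcal{M},\tau)$ of $S(\mathcal{M},\tau)$ with a complete norm $\|\cdot\|_E$ such that $x\in E(\mathcal{M},\tau)$, $y\in S(\mathcal{M},\tau)$, $\mu(y)\le\mu(x)$ imply $y\in E(\mathcal{M},\tau)$ and $\|y\|_E\le\|x\|_E$. Its carrier projection $c_{E(\mathcal{M},\tau)}$ is the supremum of all projections of $\mathcal{M}$ that belong to $E(\mathcal{M},\tau)$. $\sigma$-finite means that every family of pairwise orthogonal nonzero projections in $\mathcal{M}$ is at most countable. *)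

theory Defs
  imports "HOL-Analysis.Analysis"
begin

section \<open>Complex Hilbert spaces\<close>

text \<open>The inner product is linear in its first argument; the real inner product
  (hence the norm and the topology) is its real part.\<close>

class complex_hilbert_space = real_inner + complete_space +
  fixes scaleC :: "complex \<Rightarrow> 'a \<Rightarrow> 'a"  (infixr "*\<^sub>C" 75)
    and cinner :: "'a \<Rightarrow> 'a \<Rightarrow> complex"
  assumes scaleC_add_right: "c *\<^sub>C (x + y) = c *\<^sub>C x + c *\<^sub>C y"
    and scaleC_add_left: "(c + d) *\<^sub>C x = c *\<^sub>C x + d *\<^sub>C x"
    and scaleC_scaleC: "c *\<^sub>C d *\<^sub>C x = (c * d) *\<^sub>C x"
    and scaleR_scaleC: "r *\<^sub>R x = complex_of_real r *\<^sub>C x"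
    and cinner_commute: "cinner x y = cnj (cinner y x)"
    and cinner_add_left: "cinner (x + y) z = cinner x z + cinner y z"
    and cinner_scaleC_left: "cinner (c *\<^sub>C x) y = c * cinner x y"
    and inner_Re_cinner: "inner x y = Re (cinner x y)"


section \<open>Bounded operators and von Neumann algebras\<close>

text \<open>A bounded operator is an element of the library type \<open>'h \<Rightarrow>\<^sub>L 'h\<close> of bounded
  real-linear maps that is moreover complex linear.\<close>

definition bounded_ops :: "('h::complex_hilbert_space \<Rightarrow>\<^sub>L 'h) set" where
  "bounded_ops = {T :: 'h \<Rightarrow>\<^sub>L 'h. \<forall>c \<xi>. T (c *\<^sub>C \<xi>) = c *\<^sub>C T \<xi>}"

definition is_adjoint ::
    "('h::complex_hilbert_space \<Rightarrow>\<^sub>L 'h) \<Rightarrow> ('h \<Rightarrow>\<^sub>L 'h) \<Rightarrow> bool" where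
  "is_adjoint T S \<longleftrightarrow> (\<forall>\<xi> \<eta>. cinner (T \<xi>) \<eta> = cinner \<xi> (S \<eta>))"

definition unitary_op :: "('h::complex_hilbert_space \<Rightarrow>\<^sub>L 'h) \<Rightarrow> bool" where
  "unitary_op u \<longleftrightarrow> u \<in> bounded_ops \<and>
     (\<exists>v. is_adjoint u v \<and> v o\<^sub>L u = id_blinfun \<and> u o\<^sub>L v = id_blinfun)"

definition projection_op :: "('h::complex_hilbert_space \<Rightarrow>\<^sub>L 'h) \<Rightarrow> bool" where
  "projection_op p \<longleftrightarrow> p \<in> bounded_ops \<and> p o\<^sub>L p = p \<and> is_adjoint p p"

definition positive_op :: "('h::complex_hilbert_space \<Rightarrow>\<^sub>L 'h) \<Rightarrow> bool" where
  "positive_op a \<longleftrightarrow> a \<in> bounded_ops \<and> (\<forall>\<xi>. cinner (a \<xi>) \<xi> \<in> \<real>\<^sub>\<ge>\<^sub>0)"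

definition op_le :: "('h::complex_hilbert_space \<Rightarrow>\<^sub>L 'h) \<Rightarrow> ('h \<Rightarrow>\<^sub>L 'h) \<Rightarrow> bool" where
  "op_le a b \<longleftrightarrow> positive_op (b - a)"

definition commutant ::
    "('h::complex_hilbert_space \<Rightarrow>\<^sub>L 'h) set \<Rightarrow> ('h \<Rightarrow>\<^sub>L 'h) set" where
  "commutant M = {T \<in> bounded_ops. \<forall>S\<in>M. T o\<^sub>L S = S o\<^sub>L T}"

definition von_neumann_algebra :: "('h::complex_hilbert_space \<Rightarrow>\<^sub>L 'h) set \<Rightarrow> bool" where
  "von_neumann_algebra M \<longleftrightarrow>
     M \<subseteq> bounded_ops \<and> (\<forall>T\<in>M. \<exists>S\<in>M. is_adjoint T S) \<and> commutant (commutant M) = M"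

definition projections ::
    "('h::complex_hilbert_space \<Rightarrow>\<^sub>L 'h) set \<Rightarrow> ('h \<Rightarrow>\<^sub>L 'h) set" where
  "projections M = {p \<in> M. projection_op p}"

definition positive_part ::
    "('h::complex_hilbert_space \<Rightarrow>\<^sub>L 'h) set \<Rightarrow> ('h \<Rightarrow>\<^sub>L 'h) set" where
  "positive_part M = {a \<in> M. positive_op a}"

text \<open>Pairwise orthogonal nonzero projections are distinct, so families may be taken to be sets.\<close>

definition sigma_finite_algebra :: "('h::complex_hilbert_space \<Rightarrow>\<^sub>L 'h) set \<Rightarrow> bool" where
  "sigma_finite_algebra M \<longleftrightarrow>
     (\<forall>F. F \<subseteq> projections M - {0} \<and> pairwise (\<lambda>p q. p o\<^sub>L q = 0) F \<longrightarrow> countable F)"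


section \<open>Traces\<close>

text \<open>A trace is a map from the positive part of \<open>M\<close> to \<open>[0,\<infinity>]\<close>; its values elsewhere are
  irrelevant.  Homogeneity uses the convention \<open>0 * \<infinity> = 0\<close>.\<close>

definition trace_on ::
    "('h::complex_hilbert_space \<Rightarrow>\<^sub>L 'h) set \<Rightarrow> (('h \<Rightarrow>\<^sub>L 'h) \<Rightarrow> ennreal) \<Rightarrow> bool" where
  "trace_on M \<tau> \<longleftrightarrow>
     (\<forall>a\<in>positive_part M. \<forall>b\<in>positive_part M. \<tau> (a + b) = \<tau> a + \<tau> b) \<and>
     (\<forall>a\<in>positive_part M. \<forall>c\<ge>0. \<tau> (c *\<^sub>R a) = ennreal c * \<tau> a) \<and>
     (\<forall>a\<in>M. \<forall>b\<in>M. is_adjoint a b \<longrightarrow> \<tau> (b o\<^sub>L a) = \<tau> (a o\<^sub>L b))"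

definition faithful_trace ::
    "('h::complex_hilbert_space \<Rightarrow>\<^sub>L 'h) set \<Rightarrow> (('h \<Rightarrow>\<^sub>L 'h) \<Rightarrow> ennreal) \<Rightarrow> bool" where
  "faithful_trace M \<tau> \<longleftrightarrow> (\<forall>a\<in>positive_part M. \<tau> a = 0 \<longrightarrow> a = 0)"

text \<open>Increasing nets are rendered as nonempty upward directed sets.\<close>

definition normal_trace ::
    "('h::complex_hilbert_space \<Rightarrow>\<^sub>L 'h) set \<Rightarrow> (('h \<Rightarrow>\<^sub>L 'h) \<Rightarrow> ennreal) \<Rightarrow> bool" where
  "normal_trace M \<tau> \<longleftrightarrow>
     (\<forall>D s. D \<subseteq> positive_part M \<and> D \<noteq> {} \<and>
        (\<forall>a\<in>D. \<forall>b\<in>D. \<exists>c\<in>D. op_le a c \<and> op_le b c) \<and>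
        s \<in> positive_part M \<and> (\<forall>a\<in>D. op_le a s) \<and>
        (\<forall>b\<in>positive_part M. (\<forall>a\<in>D. op_le a b) \<longrightarrow> op_le s b)
        \<longrightarrow> \<tau> s = (SUP a\<in>D. \<tau> a))"

definition semifinite_trace ::
    "('h::complex_hilbert_space \<Rightarrow>\<^sub>L 'h) set \<Rightarrow> (('h \<Rightarrow>\<^sub>L 'h) \<Rightarrow> ennreal) \<Rightarrow> bool" where
  "semifinite_trace M \<tau> \<longleftrightarrow>
     (\<forall>a\<in>positive_part M. a \<noteq> 0 \<longrightarrow>
        (\<exists>b\<in>positive_part M. b \<noteq> 0 \<and> op_le b a \<and> \<tau> b < \<infinity>))"


section \<open>Closed operators and their spectral measures\<close>

text \<open>Possibly unbounded operators are represented by their graphs.  In particular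
  \<open>x O y\<close> is the graph of the product \<open>yx\<close> on its natural domain.\<close>

type_synonym 'h graph = "('h \<times> 'h) set"

definition op_graph :: "('h::complex_hilbert_space \<Rightarrow>\<^sub>L 'h) \<Rightarrow> 'h graph" where
  "op_graph T = {(\<xi>, T \<xi>) |\<xi>. True}"

definition closed_dd_operator :: "'h::complex_hilbert_space graph \<Rightarrow> bool" where
  "closed_dd_operator x \<longleftrightarrow>
     (0, 0) \<in> x \<and>
     (\<forall>\<xi> \<eta> \<xi>' \<eta>'. (\<xi>, \<eta>) \<in> x \<and> (\<xi>', \<eta>') \<in> x \<longrightarrow> (\<xi> + \<xi>', \<eta> + \<eta>') \<in> x) \<and>
     (\<forall>c \<xi> \<eta>. (\<xi>, \<eta>) \<in> x \<longrightarrow> (c *\<^sub>C \<xi>, c *\<^sub>C \<eta>) \<in> x) \<and>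
     single_valued x \<and> closed x \<and> closure (Domain x) = UNIV"

definition adjoint_graph :: "'h::complex_hilbert_space graph \<Rightarrow> 'h graph" where
  "adjoint_graph x = {(\<eta>, \<zeta>). \<forall>(\<xi>, \<theta>)\<in>x. cinner \<theta> \<eta> = cinner \<xi> \<zeta>}"

text \<open>\<open>a\<close> is the positive self-adjoint operator with \<open>a\<^sup>2 = x\<^sup>*x\<close>, i.e. \<open>a = |x|\<close>.\<close>

definition is_absolute_value ::
    "'h::complex_hilbert_space graph \<Rightarrow> 'h graph \<Rightarrow> bool" where
  "is_absolute_value x a \<longleftrightarrow>
     closed_dd_operator a \<and> adjoint_graph a = a \<and>
     (\<forall>(\<xi>, \<eta>)\<in>a. cinner \<eta> \<xi> \<in> \<real>\<^sub>\<ge>\<^sub>0) \<and>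
     a O a = x O adjoint_graph x"

definition projection_valued_measure ::
    "(real set \<Rightarrow> 'h::complex_hilbert_space \<Rightarrow>\<^sub>L 'h) \<Rightarrow> bool" where
  "projection_valued_measure P \<longleftrightarrow>
     (\<forall>B\<in>sets borel. projection_op (P B)) \<and> P UNIV = id_blinfun \<and>
     (\<forall>B :: nat \<Rightarrow> real set. range B \<subseteq> sets borel \<and> disjoint_family B \<longrightarrow>
        (\<forall>\<xi>. (\<lambda>n. P (B n) \<xi>) sums P (\<Union>n. B n) \<xi>))"

text \<open>The measure \<open>B \<mapsto> \<langle>P(B)\<xi>, \<xi>\<rangle> = \<parallel>P(B)\<xi>\<parallel>\<^sup>2\<close>.\<close>

definition scalar_measure ::
    "(real set \<Rightarrow> 'h::complex_hilbert_space \<Rightarrow>\<^sub>L 'h) \<Rightarrow> 'h \<Rightarrow> real measure" where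
  "scalar_measure P \<xi> = measure_of UNIV (sets borel) (\<lambda>B. ennreal ((norm (P B \<xi>))\<^sup>2))"

text \<open>\<open>a = \<integral> t dP(t)\<close>: the domain is the set of \<open>\<xi>\<close> with \<open>\<integral> t\<^sup>2 d\<langle>P\<xi>,\<xi>\<rangle> < \<infinity>\<close>, and there
  \<open>\<langle>a\<xi>,\<xi>\<rangle> = \<integral> t d\<langle>P\<xi>,\<xi>\<rangle>\<close>, which determines \<open>a\<close> by polarization.\<close>

definition is_spectral_measure ::
    "'h::complex_hilbert_space graph \<Rightarrow> (real set \<Rightarrow> 'h \<Rightarrow>\<^sub>L 'h) \<Rightarrow> bool" where
  "is_spectral_measure a P \<longleftrightarrow>
     projection_valued_measure P \<and>
     Domain a = {\<xi>. (\<integral>\<^sup>+t. ennreal (t\<^sup>2) \<partial>scalar_measure P \<xi>) < \<infinity>} \<and>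
     (\<forall>(\<xi>, \<eta>)\<in>a. cinner \<eta> \<xi> = complex_of_real (\<integral>t. t \<partial>scalar_measure P \<xi>))"


section \<open>Measurable operators and generalized singular values\<close>

definition affiliated ::
    "('h::complex_hilbert_space \<Rightarrow>\<^sub>L 'h) set \<Rightarrow> 'h graph \<Rightarrow> bool" where
  "affiliated M x \<longleftrightarrow>
     (\<forall>u\<in>commutant M. unitary_op u \<longrightarrow> (\<lambda>(\<xi>, \<eta>). (u \<xi>, u \<eta>)) ` x = x)"

text \<open>\<open>|x|\<close> and its spectral measure exist and are unique, so they are introduced by existential
  quantifiers.  The spectral projections of \<open>|x|\<close> are in \<open>M\<close> because \<open>x\<close> is affiliated with \<open>M\<close>;
  this is recorded because \<open>\<tau>\<close> is meaningful only on \<open>M\<close>.\<close>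

definition measurable_ops ::
    "('h::complex_hilbert_space \<Rightarrow>\<^sub>L 'h) set \<Rightarrow> (('h \<Rightarrow>\<^sub>L 'h) \<Rightarrow> ennreal) \<Rightarrow> 'h graph set" where
  "measurable_ops M \<tau> =
     {x. closed_dd_operator x \<and> affiliated M x \<and>
         (\<exists>a P. is_absolute_value x a \<and> is_spectral_measure a P \<and>
            (\<forall>s>0. P {s<..} \<in> M) \<and> (\<exists>s>0. \<tau> (P {s<..}) < \<infinity>))}"

text \<open>The uniform norm of a closed operator, infinite unless the operator is everywhere defined
  (and hence bounded).\<close>

definition uniform_norm :: "'h::complex_hilbert_space graph \<Rightarrow> ennreal" where
  "uniform_norm x =
     (if Domain x = UNIV then SUP (\<xi>, \<eta>)\<in>{(\<xi>, \<eta>)\<in>x. norm \<xi> \<le> 1}. ennreal (norm \<eta>) else \<infinity>)"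

definition singular_value ::
    "('h::complex_hilbert_space \<Rightarrow>\<^sub>L 'h) set \<Rightarrow> (('h \<Rightarrow>\<^sub>L 'h) \<Rightarrow> ennreal) \<Rightarrow>
     real \<Rightarrow> 'h graph \<Rightarrow> ennreal" where
  "singular_value M \<tau> t x =
     (INF p\<in>{p \<in> projections M. \<tau> (id_blinfun - p) \<le> ennreal t}. uniform_norm (op_graph p O x))"


section \<open>Symmetric spaces\<close>

text \<open>The vector space operations of the algebra of measurable operators are the strong ones:
  the closures of the algebraic sum and of the algebraic scalar multiple.\<close>

definition strong_add ::
    "'h::complex_hilbert_space graph \<Rightarrow> 'h graph \<Rightarrow> 'h graph" where
  "strong_add x y = closure {(\<xi>, \<eta> + \<zeta>) |\<xi> \<eta> \<zeta>. (\<xi>, \<eta>) \<in> x \<and> (\<xi>, \<zeta>) \<in> y}"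

definition strong_scale ::
    "complex \<Rightarrow> 'h::complex_hilbert_space graph \<Rightarrow> 'h graph" where
  "strong_scale c x = closure {(\<xi>, c *\<^sub>C \<eta>) |\<xi> \<eta>. (\<xi>, \<eta>) \<in> x}"

definition strong_minus ::
    "'h::complex_hilbert_space graph \<Rightarrow> 'h graph \<Rightarrow> 'h graph" where
  "strong_minus x y = strong_add x (strong_scale (- 1) y)"

definition linear_subspace_ops :: "'h::complex_hilbert_space graph set \<Rightarrow> bool" where
  "linear_subspace_ops E \<longleftrightarrow>
     op_graph 0 \<in> E \<and> (\<forall>x\<in>E. \<forall>y\<in>E. strong_add x y \<in> E) \<and> (\<forall>c. \<forall>x\<in>E. strong_scale c x \<in> E)"

definition norm_on_ops ::
    "'h::complex_hilbert_space graph set \<Rightarrow> ('h graph \<Rightarrow> real) \<Rightarrow> bool" where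
  "norm_on_ops E N \<longleftrightarrow>
     (\<forall>x\<in>E. 0 \<le> N x \<and> (N x = 0 \<longleftrightarrow> x = op_graph 0)) \<and>
     (\<forall>x\<in>E. \<forall>y\<in>E. N (strong_add x y) \<le> N x + N y) \<and>
     (\<forall>c. \<forall>x\<in>E. N (strong_scale c x) = cmod c * N x)"

definition complete_norm_on_ops ::
    "'h::complex_hilbert_space graph set \<Rightarrow> ('h graph \<Rightarrow> real) \<Rightarrow> bool" where
  "complete_norm_on_ops E N \<longleftrightarrow>
     (\<forall>X :: nat \<Rightarrow> 'h graph. range X \<subseteq> E \<and>
        (\<forall>e>0. \<exists>K. \<forall>m\<ge>K. \<forall>n\<ge>K. N (strong_minus (X m) (X n)) < e)
        \<longrightarrow> (\<exists>x\<in>E. (\<lambda>n. N (strong_minus (X n) x)) \<longlonglongrightarrow> 0))"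

definition symmetric_space ::
    "('h::complex_hilbert_space \<Rightarrow>\<^sub>L 'h) set \<Rightarrow> (('h \<Rightarrow>\<^sub>L 'h) \<Rightarrow> ennreal) \<Rightarrow>
     'h graph set \<Rightarrow> ('h graph \<Rightarrow> real) \<Rightarrow> bool" where
  "symmetric_space M \<tau> E N \<longleftrightarrow>
     E \<subseteq> measurable_ops M \<tau> \<and> linear_subspace_ops E \<and>
     norm_on_ops E N \<and> complete_norm_on_ops E N \<and>
     (\<forall>x\<in>E. \<forall>y\<in>measurable_ops M \<tau>.
        (\<forall>t>0. singular_value M \<tau> t y \<le> singular_value M \<tau> t x) \<longrightarrow> y \<in> E \<and> N y \<le> N x)"

text \<open>\<open>c\<close> is the supremum, in the projection lattice of \<open>M\<close>, of the projections belonging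
  to \<open>E\<close>.\<close>

definition is_carrier_projection ::
    "('h::complex_hilbert_space \<Rightarrow>\<^sub>L 'h) set \<Rightarrow> 'h graph set \<Rightarrow> ('h \<Rightarrow>\<^sub>L 'h) \<Rightarrow> bool" where
  "is_carrier_projection M E c \<longleftrightarrow>
     c \<in> projections M \<and>
     (\<forall>p\<in>projections M. op_graph p \<in> E \<longrightarrow> op_le p c) \<and>
     (\<forall>q\<in>projections M. (\<forall>p\<in>projections M. op_graph p \<in> E \<longrightarrow> op_le p q) \<longrightarrow> op_le c q)"


section \<open>The ball-covering property\<close>

text \<open>For a normed space given by its carrier \<open>V\<close>, subtraction, zero vector and norm.\<close>

definition ball_covering_property ::
    "'v set \<Rightarrow> ('v \<Rightarrow> 'v \<Rightarrow> 'v) \<Rightarrow> 'v \<Rightarrow> ('v \<Rightarrow> real) \<Rightarrow> bool" where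
  "ball_covering_property V sub zero N \<longleftrightarrow>
     (\<exists>\<B>. countable \<B> \<and>
        (\<forall>B\<in>\<B>. zero \<notin> B \<and>
           (\<exists>c\<in>V. \<exists>r>0. B = {v \<in> V. N (sub v c) < r} \<or> B = {v \<in> V. N (sub v c) \<le> r})) \<and>
        {v \<in> V. N v = 1} \<subseteq> \<Union>\<B>)"

end

theory Submission
  imports Defs
begin

text \<open>
  A ball that omits the origin and has centre \<open>c\<close> is contained in the set of \<open>v\<close> with
  \<open>\<parallel>v - c\<parallel> < \<parallel>c\<parallel>\<close>. So it is enough to find, for any countable set of centres \<open>c\<close>, one unit
  vector \<open>v\<close> of \<open>E\<close> with \<open>\<parallel>v - c\<parallel> \<ge> \<parallel>c\<parallel>\<close> for all of them, and for this it is enough that the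
  singular values of \<open>v - c\<close> dominate those of \<open>c\<close>.

  The singular values of a measurable operator \<open>c\<close> are determined by its action on countably many
  vectors. Indeed \<open>\<mu>(t;c) > s\<close> forces the spectral projection \<open>g\<close> of \<open>|c|\<close> for
  \<open>(s,\<infinity>)\<close> to have trace above \<open>t\<close>. The cyclic projections \<open>[M'\<Xi>]\<close> of finite sets \<open>\<Xi>\<close> of vectors
  in the range of \<open>g\<close> form an increasing net in \<open>M\<close> with supremum \<open>g\<close>, so by normality one of
  them, say \<open>h\<close>, still has trace above \<open>t\<close>. On the part of its domain in the range
  of \<open>h\<close> the operator \<open>c\<close> expands norms by at least \<open>s\<close>, and so does \<open>v - c\<close> if \<open>v\<close> vanishes on the
  range of \<open>h\<close>. Hence a projection \<open>r\<close> with
  \<open>\<parallel>(v - c)r\<parallel> < s\<close> satisfies \<open>h \<and> r = 0\<close>, and the comparison inequality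
  \<open>h \<and> r = 0 \<Longrightarrow> \<tau>(h) \<le> \<tau>(1 - r)\<close> gives \<open>\<tau>(1 - r) > t\<close>. Letting \<open>s\<close> and \<open>t\<close> run
  through the rationals leaves countably many vectors
  (lemma \<open>countable_vectors_determine_singular_values\<close>).

  It remains to find a \<open>v\<close> that vanishes on the cyclic space of a given countable set \<open>\<Xi>\<close>. By
  Bessel's inequality each \<open>\<xi>\<close> is annihilated by all but countably many members of an orthogonal
  family of projections. Therefore an uncountable orthogonal family, which exists because \<open>M\<close> is
  not \<open>\<sigma>\<close>-finite, contains a nonzero projection \<open>f\<close> that annihilates \<open>\<Xi>\<close>, hence also its cyclic
  space. As the carrier projection of \<open>E\<close> is the identity, \<open>fp \<noteq> 0\<close> for some projection \<open>p\<close> in \<open>E\<close>.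
  The range projection \<open>e\<close> of \<open>fp\<close> lies below \<open>f\<close> and meets the kernel of \<open>p\<close> trivially, so
  \<open>\<tau>(e) \<le> \<tau>(p)\<close> by the comparison inequality, and symmetry puts \<open>e\<close> into \<open>E\<close>. The normalization
  of \<open>e\<close> is the required \<open>v\<close>.

  The comparison inequality (lemma \<open>trace_le_if_kernel_meets_trivially\<close>) is usually read off from
  the polar decomposition of \<open>(1 - r)h\<close>. Here the partial isometry of that decomposition is
  approximated inside \<open>M\<close> by the Newton--Schulz iteration, which involves only polynomials; its
  moduli squared increase to \<open>h\<close>, so that normality and the trace property can be applied.
  The spectral estimates need that a closed operator \<open>x\<close> and \<open>|x|\<close> have the same domain and
  satisfy \<open>\<parallel>x\<xi>\<parallel> = \<parallel>|x|\<xi>\<parallel>\<close>; this follows since the domain of \<open>x\<^sup>*x\<close> is a core for both.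
\<close>

section \<open>Complex inner products, adjoints and positive operators\<close>

lemma Im_cinner:
  fixes x y :: "'h::complex_hilbert_space"
  shows "Im (cinner x y) = inner ((- \<i>) *\<^sub>C x) y"
  by (simp add: inner_Re_cinner cinner_scaleC_left)

lemma cinner_add_right: "cinner x (y + z) = cinner x y + cinner x (z::'h::complex_hilbert_space)"
  by (metis cinner_add_left cinner_commute complex_cnj_add)

lemma cinner_scaleC_right: "cinner x (c *\<^sub>C y) = cnj c * cinner x (y::'h::complex_hilbert_space)"
  by (metis cinner_commute cinner_scaleC_left complex_cnj_mult)

lemma cinner_self: "cinner x x = complex_of_real ((norm (x::'h::complex_hilbert_space))\<^sup>2)"
proof -
  have "Im (cinner x x) = 0"
    using cinner_commute[of x x] by (metis Reals_cnj_iff complex_is_Real_iff)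
  moreover have "Re (cinner x x) = (norm x)\<^sup>2"
    by (metis inner_Re_cinner power2_norm_eq_inner)
  ultimately show ?thesis by (simp add: complex_eq_iff)
qed

lemma scaleC_one [simp]: "1 *\<^sub>C (x::'h::complex_hilbert_space) = x"
  by (metis of_real_1 scaleR_one scaleR_scaleC)

lemma scaleC_minus_one [simp]: "(- 1) *\<^sub>C (x::'h::complex_hilbert_space) = - x"
  by (metis of_real_1 of_real_minus scaleR_minus1_left scaleR_scaleC)

lemma norm_scaleC: "norm (c *\<^sub>C x) = cmod c * norm (x::'h::complex_hilbert_space)"
proof -
  have "complex_of_real ((norm (c *\<^sub>C x))\<^sup>2) = c * cnj c * complex_of_real ((norm x)\<^sup>2)"
    unfolding cinner_self[symmetric] by (simp add: cinner_scaleC_left cinner_scaleC_right)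
  also have "\<dots> = complex_of_real ((cmod c * norm x)\<^sup>2)"
    by (simp add: complex_norm_square[symmetric] power_mult_distrib flip: of_real_mult of_real_power)
  finally have "(norm (c *\<^sub>C x))\<^sup>2 = (cmod c * norm x)\<^sup>2"
    using of_real_eq_iff by blast
  then show ?thesis by (simp add: power2_eq_iff_nonneg)
qed

lemma bounded_linear_scaleC: "bounded_linear ((*\<^sub>C) c :: 'h::complex_hilbert_space \<Rightarrow> 'h)"
proof (rule bounded_linear_intro)
  show "norm (c *\<^sub>C x) \<le> norm x * cmod c" for x :: 'h by (simp add: norm_scaleC mult.commute)
  show "c *\<^sub>C r *\<^sub>R x = r *\<^sub>R c *\<^sub>C x" for r and x :: 'h
    by (simp add: scaleR_scaleC scaleC_scaleC mult.commute)
qed (simp add: scaleC_add_right)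

definition scalar_op :: "complex \<Rightarrow> 'h::complex_hilbert_space \<Rightarrow>\<^sub>L 'h" where
  "scalar_op c = Blinfun ((*\<^sub>C) c)"

lemma scalar_op_apply [simp]: "scalar_op c x = c *\<^sub>C x"
  by (simp add: scalar_op_def bounded_linear_Blinfun_apply bounded_linear_scaleC)

text \<open>Only real parts have to be compared: replacing \<open>\<xi>\<close> by \<open>-\<i>\<xi>\<close> recovers the imaginary parts.
  This lets almost everything below be computed in the underlying real Hilbert space.\<close>

lemma is_adjointI:
  fixes S T :: "'h::complex_hilbert_space \<Rightarrow>\<^sub>L 'h"
  assumes "T \<in> bounded_ops" "\<And>\<xi> \<eta>. inner (T \<xi>) \<eta> = inner \<xi> (S \<eta>)"
  shows "is_adjoint T S"
  unfolding is_adjoint_def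
proof (intro allI complex_eqI)
  fix \<xi> \<eta>
  show "Re (cinner (T \<xi>) \<eta>) = Re (cinner \<xi> (S \<eta>))" using assms(2) by (simp add: inner_Re_cinner)
  have "T ((-\<i>) *\<^sub>C \<xi>) = (-\<i>) *\<^sub>C T \<xi>" using assms(1) by (auto simp: bounded_ops_def)
  then show "Im (cinner (T \<xi>) \<eta>) = Im (cinner \<xi> (S \<eta>))"
    unfolding Im_cinner using assms(2) by metis
qed

lemma is_adjointD: fixes S T :: "'h::complex_hilbert_space \<Rightarrow>\<^sub>L 'h" shows "is_adjoint T S \<Longrightarrow> inner (T \<xi>) \<eta> = inner \<xi> (S \<eta>)"
  by (simp add: is_adjoint_def inner_Re_cinner)

lemma is_adjoint_sym: "is_adjoint T S \<Longrightarrow> is_adjoint S T"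
  unfolding is_adjoint_def by (metis cinner_commute)

lemma is_adjoint_compose: "is_adjoint S S' \<Longrightarrow> is_adjoint T T' \<Longrightarrow> is_adjoint (S o\<^sub>L T) (T' o\<^sub>L S')"
  by (simp add: is_adjoint_def)

lemma positive_opI:
  assumes "a \<in> bounded_ops" "is_adjoint a a" "\<And>\<xi>. 0 \<le> inner (a \<xi>) \<xi>"
  shows "positive_op a"
  unfolding positive_op_def
proof (intro conjI allI)
  fix \<xi>
  have "cinner (a \<xi>) \<xi> = cnj (cinner (a \<xi>) \<xi>)"
    using assms(2) cinner_commute unfolding is_adjoint_def by metis
  then have "Im (cinner (a \<xi>) \<xi>) = 0" by (metis Reals_cnj_iff complex_is_Real_iff)
  with assms(3)[of \<xi>] show "cinner (a \<xi>) \<xi> \<in> \<real>\<^sub>\<ge>\<^sub>0"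
    by (simp add: complex_nonneg_Reals_iff inner_Re_cinner)
qed fact

lemma positive_opD: "positive_op a \<Longrightarrow> 0 \<le> inner (a \<xi>) \<xi>"
  by (simp add: positive_op_def complex_nonneg_Reals_iff inner_Re_cinner)

lemma bounded_ops_diff: "S \<in> bounded_ops \<Longrightarrow> T \<in> bounded_ops \<Longrightarrow> S - T \<in> bounded_ops"
  unfolding bounded_ops_def
  by (simp add: blinfun.diff_left linear_diff[OF bounded_linear.linear[OF bounded_linear_scaleC]])

lemma op_le_iff_inner:
  assumes "a \<in> bounded_ops" "is_adjoint a a" "b \<in> bounded_ops" "is_adjoint b b"
  shows "op_le a b \<longleftrightarrow> (\<forall>\<xi>. inner (a \<xi>) \<xi> \<le> inner (b \<xi>) \<xi>)"
proof
  assume "op_le a b"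
  then have "0 \<le> inner ((b - a) \<xi>) \<xi>" for \<xi> unfolding op_le_def by (rule positive_opD)
  then show "\<forall>\<xi>. inner (a \<xi>) \<xi> \<le> inner (b \<xi>) \<xi>" by (simp add: blinfun.diff_left inner_diff_left)
next
  assume *: "\<forall>\<xi>. inner (a \<xi>) \<xi> \<le> inner (b \<xi>) \<xi>"
  show "op_le a b" unfolding op_le_def
  proof (rule positive_opI)
    show "b - a \<in> bounded_ops" using assms bounded_ops_diff by blast
    then show "is_adjoint (b - a) (b - a)"
      by (rule is_adjointI) (simp add: blinfun.diff_left inner_diff_left inner_diff_right assms(2,4)[THEN is_adjointD])
  qed (use * in \<open>simp add: blinfun.diff_left inner_diff_left\<close>)
qed

section \<open>Orthogonal projections and adjoints in Hilbert space\<close>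

text \<open>The projection theorem: by the parallelogram law, a sequence in \<open>K\<close> minimizing the distance
  to \<open>x\<close> is Cauchy.\<close>

lemma orthogonal_decomposition:
  fixes K :: "'a::{real_inner,complete_space} set"
  assumes sub: "subspace K" and cl: "closed K"
  shows "\<exists>y\<in>K. \<forall>z\<in>K. inner (x - y) z = 0"
proof -
  define q where "q y = (norm (x - y))\<^sup>2" for y
  define d where "d = Inf (q ` K)"
  have "0 \<in> K" using sub by (rule subspace_0)
  have bdd: "bdd_below (q ` K)" by (rule bdd_belowI[of _ 0]) (auto simp: q_def)
  have dle: "d \<le> q y" if "y \<in> K" for y
    unfolding d_def using that bdd by (simp add: cInf_lower)
  have "\<exists>y\<in>K. q y < d + 1 / real (Suc n)" for n
  proof -
    have "\<exists>v\<in>q ` K. v < d + 1 / real (Suc n)"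
      using bdd \<open>0 \<in> K\<close> unfolding d_def by (subst cInf_less_iff[symmetric]) auto
    then show ?thesis by auto
  qed
  then obtain Y where YK: "\<And>n. Y n \<in> K" and Yq: "\<And>n. q (Y n) < d + 1 / real (Suc n)" by metis
  have close: "(norm (Y m - Y n))\<^sup>2 \<le> 2 / real (Suc m) + 2 / real (Suc n)" for m n
  proof -
    have "(1/2) *\<^sub>R (Y m + Y n) \<in> K" using sub YK by (simp add: subspace_add subspace_scale)
    then have "d \<le> q ((1/2) *\<^sub>R (Y m + Y n))" by (rule dle)
    moreover have "(norm (Y m - Y n))\<^sup>2 = 2 * q (Y m) + 2 * q (Y n) - 4 * q ((1/2) *\<^sub>R (Y m + Y n))"
      unfolding q_def power2_norm_eq_inner
      by (simp add: inner_simps algebra_simps inner_commute)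
    ultimately show ?thesis using Yq[of m] Yq[of n] by simp
  qed
  have "Cauchy Y"
  proof (rule metric_CauchyI)
    fix e :: real assume "e > 0"
    obtain k :: nat where k: "4 / e\<^sup>2 < real k" using reals_Archimedean2 by blast
    have kk: "4 / real (Suc k) < e\<^sup>2"
    proof -
      have "4 < real k * e\<^sup>2" using k \<open>e > 0\<close> by (simp add: pos_divide_less_eq)
      also have "\<dots> \<le> real (Suc k) * e\<^sup>2" by (intro mult_right_mono) auto
      finally show ?thesis by (simp add: pos_divide_less_eq mult.commute)
    qed
    have "dist (Y m) (Y n) < e" if "m \<ge> k" "n \<ge> k" for m n
    proof -
      have "2 / real (Suc m) \<le> 2 / real (Suc k)" "2 / real (Suc n) \<le> 2 / real (Suc k)"
        using that by (auto simp: frac_le)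
      then have "(norm (Y m - Y n))\<^sup>2 < e\<^sup>2" using close[of m n] kk by simp
      then show ?thesis using \<open>e > 0\<close> by (simp add: dist_norm power2_less_imp_less)
    qed
    then show "\<exists>M. \<forall>m\<ge>M. \<forall>n\<ge>M. dist (Y m) (Y n) < e" by blast
  qed
  then obtain y where y: "Y \<longlonglongrightarrow> y" using Cauchy_convergent convergent_def by blast
  have yK: "y \<in> K" using cl YK y closed_sequentially by blast
  have "(\<lambda>n. q (Y n)) \<longlonglongrightarrow> q y" unfolding q_def by (intro tendsto_intros y)
  moreover have "(\<lambda>n. d + 1 / real (Suc n)) \<longlonglongrightarrow> d + 0"
    by (intro tendsto_add tendsto_const LIMSEQ_Suc[OF lim_1_over_n])
  ultimately have "q y \<le> d + 0" using Yq by (intro LIMSEQ_le) (auto intro: less_imp_le)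
  then have "q y \<le> d" by simp
  have "inner (x - y) z = 0" if "z \<in> K" for z
  proof (cases "z = 0")
    case False
    \<comment> \<open>the step along \<open>z\<close> that minimizes the distance to \<open>x\<close>\<close>
    define t where "t = inner (x - y) z / inner z z"
    have "y + t *\<^sub>R z \<in> K" using sub yK that by (simp add: subspace_add subspace_scale)
    from dle[OF this] have "q y \<le> q (y + t *\<^sub>R z)" using \<open>q y \<le> d\<close> by linarith
    moreover have "q (y + t *\<^sub>R z) = q y - 2 * t * inner (x - y) z + t * t * inner z z"
      unfolding q_def power2_norm_eq_inner by (simp add: inner_simps algebra_simps inner_commute)
    moreover have "t * inner z z = inner (x - y) z" using False by (simp add: t_def)
    ultimately have "t * inner (x - y) z \<le> 0" by (simp add: algebra_simps)
    then have "(inner (x - y) z)\<^sup>2 / inner z z \<le> 0" by (simp add: t_def power2_eq_square)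
    moreover have "inner z z > 0" using False by simp
    ultimately have "(inner (x - y) z)\<^sup>2 \<le> 0" by (simp add: divide_le_0_iff)
    then show ?thesis by simp
  qed simp
  then show ?thesis using yK by blast
qed

definition orth_proj :: "'a::{real_inner,complete_space} set \<Rightarrow> 'a \<Rightarrow>\<^sub>L 'a" where
  "orth_proj K = Blinfun (\<lambda>x. SOME y. y \<in> K \<and> (\<forall>z\<in>K. inner (x - y) z = 0))"

context
  fixes K :: "'a::{real_inner,complete_space} set"
  assumes sub: "subspace K" and cl: "closed K"
begin

lemma orth_decomp_unique:
  assumes "y \<in> K" "\<forall>z\<in>K. inner (x - y) z = 0" "y' \<in> K" "\<forall>z\<in>K. inner (x - y') z = 0"
  shows "y = y'"
proof -
  have "y - y' \<in> K" using assms sub by (simp add: subspace_diff)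
  then have "inner (x - y') (y - y') = 0" "inner (x - y) (y - y') = 0" using assms by blast+
  then have "inner (y - y') (y - y') = 0" by (simp add: inner_diff_left)
  then show ?thesis by simp
qed

lemma orth_proj_apply:
  "orth_proj K x \<in> K" "z \<in> K \<Longrightarrow> inner (x - orth_proj K x) z = 0"
proof -
  define p where "p x = (SOME y. y \<in> K \<and> (\<forall>z\<in>K. inner (x - y) z = 0))" for x
  have p: "p x \<in> K \<and> (\<forall>z\<in>K. inner (x - p x) z = 0)" for x
  proof -
    have "\<exists>y. y \<in> K \<and> (\<forall>z\<in>K. inner (x - y) z = 0)"
      using orthogonal_decomposition[OF sub cl, of x] by blast
    then show ?thesis unfolding p_def by (rule someI_ex)
  qed
  have uniq: "p x = y" if "y \<in> K" "\<And>z. z \<in> K \<Longrightarrow> inner (x - y) z = 0" for x y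
    using orth_decomp_unique p that by blast
  have bl: "bounded_linear p"
  proof (rule bounded_linear_intro)
    show "p (x + y) = p x + p y" for x y
    proof (rule uniq)
      show "inner (x + y - (p x + p y)) z = 0" if "z \<in> K" for z
        using p[of x] p[of y] that by (simp add: inner_simps)
    qed (use p sub in \<open>simp add: subspace_add\<close>)
    show "p (r *\<^sub>R x) = r *\<^sub>R p x" for r x
    proof (rule uniq)
      show "inner (r *\<^sub>R x - r *\<^sub>R p x) z = 0" if "z \<in> K" for z
        using p[of x] that by (metis inner_scaleR_left mult_zero_right scaleR_diff_right)
    qed (use p sub in \<open>simp add: subspace_scale\<close>)
    show "norm (p x) \<le> norm x * 1" for x
    proof -
      have "inner (x - p x) (p x) = 0" using p by blast
      then have "norm (p x) * norm (p x) \<le> norm x * norm (p x)"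
        by (metis inner_diff_left norm_cauchy_schwarz eq_iff_diff_eq_0 power2_eq_square power2_norm_eq_inner)
      then show ?thesis by (cases "p x = 0") auto
    qed
  qed
  have "orth_proj K x = p x" for x
    unfolding orth_proj_def p_def[symmetric] using bl by (simp add: bounded_linear_Blinfun_apply)
  with p show "orth_proj K x \<in> K" "z \<in> K \<Longrightarrow> inner (x - orth_proj K x) z = 0" by auto
qed

lemma orth_proj_eqI:
  "y \<in> K \<Longrightarrow> (\<And>z. z \<in> K \<Longrightarrow> inner (x - y) z = 0) \<Longrightarrow> orth_proj K x = y"
  using orth_decomp_unique orth_proj_apply by blast

lemma orth_proj_in: "x \<in> K \<Longrightarrow> orth_proj K x = x"
  by (rule orth_proj_eqI) auto

lemma orth_proj_selfadjoint: "inner (orth_proj K x) y = inner x (orth_proj K y)"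
proof -
  have "inner (x - orth_proj K x) (orth_proj K y) = 0"
       "inner (y - orth_proj K y) (orth_proj K x) = 0"
    using orth_proj_apply by blast+
  then show ?thesis by (simp add: inner_diff_left) (metis inner_commute)
qed

end

definition complex_subspace :: "'h::complex_hilbert_space set \<Rightarrow> bool" where
  "complex_subspace K \<longleftrightarrow> subspace K \<and> closed K \<and> (\<forall>c. \<forall>x\<in>K. c *\<^sub>C x \<in> K)"

lemma projection_op_orth_proj:
  assumes "complex_subspace K"
  shows "projection_op (orth_proj K)"
proof -
  have sub: "subspace K" and cl: "closed K" and sc: "\<And>c x. x \<in> K \<Longrightarrow> c *\<^sub>C x \<in> K"
    using assms by (auto simp: complex_subspace_def)
  note op = orth_proj_apply[OF sub cl]
  have b: "orth_proj K \<in> bounded_ops"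
    unfolding bounded_ops_def
  proof (intro CollectI allI)
    fix c :: complex and \<xi> :: 'a
    show "orth_proj K (c *\<^sub>C \<xi>) = c *\<^sub>C orth_proj K \<xi>"
    proof (rule orth_proj_eqI[OF sub cl])
      fix z assume "z \<in> K"
      have "inner (c *\<^sub>C \<xi> - c *\<^sub>C orth_proj K \<xi>) z = inner (c *\<^sub>C (\<xi> - orth_proj K \<xi>)) z"
        by (simp add: bounded_linear.linear[OF bounded_linear_scaleC] linear_diff)
      also have "\<dots> = inner (\<xi> - orth_proj K \<xi>) (cnj c *\<^sub>C z)"
        by (simp add: inner_Re_cinner cinner_scaleC_left cinner_scaleC_right)
      finally show "inner (c *\<^sub>C \<xi> - c *\<^sub>C orth_proj K \<xi>) z = 0" using op(2) sc \<open>z \<in> K\<close> by simp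
    qed (use op sc in auto)
  qed
  have "orth_proj K o\<^sub>L orth_proj K = orth_proj K"
    by (rule blinfun_eqI) (simp add: orth_proj_in[OF sub cl] op)
  moreover have "is_adjoint (orth_proj K) (orth_proj K)"
    using b by (rule is_adjointI) (rule orth_proj_selfadjoint[OF sub cl])
  ultimately show ?thesis using b by (simp add: projection_op_def)
qed

text \<open>The representing vector spans the orthogonal complement of the kernel.\<close>

lemma riesz_representation:
  fixes \<phi> :: "'a::{real_inner,complete_space} \<Rightarrow> real"
  assumes "bounded_linear \<phi>"
  shows "\<exists>y. \<forall>x. \<phi> x = inner x y"
proof (cases "\<forall>x. \<phi> x = 0")
  case True
  then show ?thesis by (metis inner_zero_right)
next
  case False
  then obtain u where u: "\<phi> u \<noteq> 0" by blast
  interpret bounded_linear \<phi> by fact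
  define K where "K = {x. \<phi> x = 0}"
  have sub: "subspace K" unfolding K_def subspace_def by (simp add: add zero scaleR)
  have cl: "closed K" unfolding K_def
    by (intro closed_Collect_eq continuous_on continuous_on_const continuous_on_id)
  obtain y where y: "y \<in> K" "\<forall>z\<in>K. inner (u - y) z = 0" using orthogonal_decomposition[OF sub cl] by blast
  define w where "w = u - y"
  have w: "\<phi> w = \<phi> u" using y by (simp add: w_def diff K_def)
  have "w \<noteq> 0" using w u zero by auto
  have "\<phi> x = inner x ((\<phi> w / inner w w) *\<^sub>R w)" for x
  proof -
    have "x - (\<phi> x / \<phi> w) *\<^sub>R w \<in> K" using u w by (simp add: K_def diff scaleR)
    then have "inner w (x - (\<phi> x / \<phi> w) *\<^sub>R w) = 0" using y w_def by blast
    then have "inner x w = \<phi> x / \<phi> w * inner w w" by (simp add: inner_diff_right inner_commute)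
    then show ?thesis using \<open>w \<noteq> 0\<close> u w by simp
  qed
  then show ?thesis by blast
qed

lemma adjoint_exists:
  fixes T :: "'h::complex_hilbert_space \<Rightarrow>\<^sub>L 'h"
  assumes "T \<in> bounded_ops"
  shows "\<exists>S\<in>bounded_ops. is_adjoint T S"
proof -
  have "\<exists>y. \<forall>x. inner (T x) \<eta> = inner x y" for \<eta>
    by (rule riesz_representation) (intro bounded_linear_inner_left_comp blinfun.bounded_linear_right)
  then obtain S where S: "\<And>x \<eta>. inner (T x) \<eta> = inner x (S \<eta>)" by metis
  have ext: "y = z" if "\<And>x::'h. inner x y = inner x z" for y z
    using that[of "y - z"] by (metis inner_diff_right inner_eq_zero_iff right_minus_eq)
  have bl: "bounded_linear S"
  proof (rule bounded_linear_intro)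
    show "S (x + y) = S x + S y" for x y
      by (rule ext) (simp add: S[symmetric] inner_add_right)
    show "S (r *\<^sub>R x) = r *\<^sub>R S x" for r x
      by (rule ext) (simp add: S[symmetric])
    show "norm (S x) \<le> norm x * norm T" for x
    proof -
      have "norm (S x) * norm (S x) = inner (T (S x)) x"
        by (simp add: S power2_norm_eq_inner flip: power2_eq_square)
      also have "\<dots> \<le> norm (T (S x)) * norm x" by (rule norm_cauchy_schwarz)
      also have "\<dots> \<le> norm T * norm (S x) * norm x" by (intro mult_right_mono norm_blinfun) auto
      finally have "norm (S x) * norm (S x) \<le> (norm x * norm T) * norm (S x)" by (simp add: ac_simps)
      then show ?thesis by (cases "S x = 0") auto
    qed
  qed
  have app: "Blinfun S x = S x" for x using bl by (simp add: bounded_linear_Blinfun_apply)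
  have adj: "is_adjoint T (Blinfun S)" using assms by (rule is_adjointI) (simp add: app S)
  have "Blinfun S \<in> bounded_ops"
    unfolding bounded_ops_def
  proof (intro CollectI allI)
    fix c :: complex and \<xi> :: 'h
    have "inner x (c *\<^sub>C S \<xi>) = inner x (S (c *\<^sub>C \<xi>))" for x
    proof -
      have "inner x (c *\<^sub>C S \<xi>) = inner (cnj c *\<^sub>C x) (S \<xi>)"
        by (simp add: inner_Re_cinner cinner_scaleC_left cinner_scaleC_right)
      also have "\<dots> = inner (cnj c *\<^sub>C T x) \<xi>"
        using assms by (simp add: S[symmetric] bounded_ops_def)
      also have "\<dots> = inner (T x) (c *\<^sub>C \<xi>)"
        by (simp add: inner_Re_cinner cinner_scaleC_left cinner_scaleC_right)
      finally show ?thesis by (simp add: S)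
    qed
    then show "Blinfun S (c *\<^sub>C \<xi>) = c *\<^sub>C Blinfun S \<xi>" unfolding app by (metis ext)
  qed
  with adj show ?thesis by blast
qed

section \<open>Projections of a von Neumann algebra\<close>

lemma projection_opD:
  fixes p :: "'h::complex_hilbert_space \<Rightarrow>\<^sub>L 'h"
  assumes "projection_op p"
  shows "p (p \<xi>) = p \<xi>" "inner (p \<xi>) \<eta> = inner \<xi> (p \<eta>)" "(norm (p \<xi>))\<^sup>2 = inner (p \<xi>) \<xi>"
    "norm (p \<xi>) \<le> norm \<xi>"
proof -
  show 1: "p (p \<xi>) = p \<xi>" for \<xi>
    using assms by (metis blinfun_apply_blinfun_compose projection_op_def)
  show 2: "inner (p \<xi>) \<eta> = inner \<xi> (p \<eta>)" for \<xi> \<eta>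
    using assms is_adjointD by (auto simp: projection_op_def)
  show 3: "(norm (p \<xi>))\<^sup>2 = inner (p \<xi>) \<xi>"
    unfolding power2_norm_eq_inner by (metis 1 2)
  have "(norm (p \<xi>))\<^sup>2 \<le> norm (p \<xi>) * norm \<xi>" unfolding 3 by (rule norm_cauchy_schwarz)
  then show "norm (p \<xi>) \<le> norm \<xi>" by (cases "p \<xi> = 0") (auto simp: power2_eq_square)
qed

lemma positive_op_projection: "projection_op p \<Longrightarrow> positive_op p"
  by (rule positive_opI) (auto simp: projection_op_def simp flip: projection_opD(3))

lemma blinfun_eq_iff: "S = T \<longleftrightarrow> (\<forall>x. blinfun_apply S x = blinfun_apply T x)"
  by (auto intro: blinfun_eqI)

lemma commutant_closed:
  assumes "S \<in> commutant A" "T \<in> commutant A"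
  shows "S o\<^sub>L T \<in> commutant A" "S + T \<in> commutant A" "S - T \<in> commutant A" "r *\<^sub>R S \<in> commutant A"
proof -
  have b: "S \<in> bounded_ops" "T \<in> bounded_ops" using assms by (auto simp: commutant_def)
  have c: "S (R \<xi>) = R (S \<xi>)" "T (R \<xi>) = R (T \<xi>)" if "R \<in> A" for R \<xi>
    using assms that unfolding commutant_def by (auto dest!: bspec simp: blinfun_eq_iff)
  have "S o\<^sub>L T \<in> bounded_ops" "S + T \<in> bounded_ops" "S - T \<in> bounded_ops" "r *\<^sub>R S \<in> bounded_ops"
    using b by (auto simp: bounded_ops_def blinfun.add_left scaleC_add_right bounded_ops_diff[unfolded bounded_ops_def, simplified]
       blinfun.scaleR_left scaleR_scaleC scaleC_scaleC mult.commute)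
  then show "S o\<^sub>L T \<in> commutant A" "S + T \<in> commutant A" "S - T \<in> commutant A" "r *\<^sub>R S \<in> commutant A"
    unfolding commutant_def
    by (simp_all add: blinfun_eq_iff blinfun.bilinear_simps c)
qed

lemma scalar_op_commutant:
  assumes "A \<subseteq> bounded_ops" shows "scalar_op c \<in> commutant A" "id_blinfun \<in> commutant A"
proof -
  have "S (c *\<^sub>C \<xi>) = c *\<^sub>C S \<xi>" if "S \<in> A" for S \<xi>
    using assms that unfolding bounded_ops_def by blast
  then show "scalar_op c \<in> commutant A" "id_blinfun \<in> commutant A"
    by (simp_all add: commutant_def bounded_ops_def blinfun_eq_iff scaleC_scaleC mult.commute)
qed

lemma von_neumann_algebra_closed:
  assumes "von_neumann_algebra M"
  shows "id_blinfun \<in> M" "S \<in> M \<Longrightarrow> T \<in> M \<Longrightarrow> S o\<^sub>L T \<in> M" "S \<in> M \<Longrightarrow> T \<in> M \<Longrightarrow> S + T \<in> M"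
    "S \<in> M \<Longrightarrow> T \<in> M \<Longrightarrow> S - T \<in> M" "S \<in> M \<Longrightarrow> r *\<^sub>R S \<in> M"
proof -
  have M: "M = commutant (commutant M)" using assms by (simp add: von_neumann_algebra_def)
  have "commutant M \<subseteq> bounded_ops" unfolding commutant_def by blast
  then show "id_blinfun \<in> M" by (subst M) (rule scalar_op_commutant)
  note closed = commutant_closed[where A = "commutant M", folded M]
  show "S \<in> M \<Longrightarrow> T \<in> M \<Longrightarrow> S o\<^sub>L T \<in> M" by (rule closed(1))
  show "S \<in> M \<Longrightarrow> T \<in> M \<Longrightarrow> S + T \<in> M" by (rule closed(2))
  show "S \<in> M \<Longrightarrow> T \<in> M \<Longrightarrow> S - T \<in> M" by (rule closed(3))
  show "S \<in> M \<Longrightarrow> r *\<^sub>R S \<in> M" by (rule closed(4)[of S S])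
qed

lemma von_neumann_algebra_subset: "von_neumann_algebra M \<Longrightarrow> M \<subseteq> bounded_ops"
  by (simp add: von_neumann_algebra_def)

lemma commutant_commutes: "T \<in> commutant M \<Longrightarrow> S \<in> M \<Longrightarrow> T (S \<xi>) = S (T \<xi>)"
  unfolding commutant_def by (metis (mono_tags, lifting) blinfun_apply_blinfun_compose mem_Collect_eq)

lemma inner_ext: "(\<And>x. inner x y = inner x z) \<Longrightarrow> y = (z::'a::real_inner)"
  by (metis inner_diff_right inner_eq_zero_iff right_minus_eq)

lemma adjoint_in_commutant:
  assumes M: "von_neumann_algebra M" and T: "T \<in> commutant M"
  shows "\<exists>S\<in>commutant M. is_adjoint T S"
proof -
  obtain S where S: "S \<in> bounded_ops" "is_adjoint T S"
    using T adjoint_exists by (auto simp: commutant_def)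
  have "S o\<^sub>L R = R o\<^sub>L S" if R: "R \<in> M" for R
  proof (rule blinfun_eqI)
    fix \<xi>
    obtain R' where R': "R' \<in> M" "is_adjoint R R'" using M R unfolding von_neumann_algebra_def by blast
    note adj = is_adjointD[OF S(2), symmetric] is_adjointD[OF is_adjoint_sym[OF R'(2)], symmetric]
    have "inner x (S (R \<xi>)) = inner x (R (S \<xi>))" for x
      by (simp add: adj commutant_commutes[OF T R'(1)])
    then have "S (R \<xi>) = R (S \<xi>)" by (rule inner_ext)
    then show "(S o\<^sub>L R) \<xi> = (R o\<^sub>L S) \<xi>" by simp
  qed
  with S show ?thesis unfolding commutant_def by blast
qed

lemma id_projection:
  assumes "von_neumann_algebra M"
  shows "id_blinfun \<in> projections M"
  using von_neumann_algebra_closed(1)[OF assms]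
  by (auto simp: projections_def projection_op_def bounded_ops_def is_adjointI blinfun_eq_iff)

lemma projection_complement:
  assumes M: "von_neumann_algebra M" and p: "p \<in> projections M"
  shows "id_blinfun - p \<in> projections M"
proof -
  have pp: "projection_op p" "p \<in> M" using p by (auto simp: projections_def)
  have m: "id_blinfun - p \<in> M" using von_neumann_algebra_closed(1,4)[OF M] pp by blast
  then have b: "id_blinfun - p \<in> bounded_ops" using von_neumann_algebra_subset[OF M] by blast
  moreover have "(id_blinfun - p) o\<^sub>L (id_blinfun - p) = id_blinfun - p"
    by (simp add: blinfun_eq_iff blinfun.diff_left blinfun.diff_right projection_opD(1)[OF pp(1)])
  moreover have "is_adjoint (id_blinfun - p) (id_blinfun - p)"
    using b by (rule is_adjointI)
      (simp add: blinfun.diff_left inner_diff_left inner_diff_right projection_opD(2)[OF pp(1)])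
  ultimately show ?thesis using m by (simp add: projections_def projection_op_def)
qed

text \<open>The commutant of \<open>M\<close> is closed under adjoints, so it leaves invariant the orthogonal
  complement of \<open>K\<close> as well; hence the projection commutes with it and lies in \<open>M'' = M\<close>.\<close>

lemma orth_proj_in_von_neumann_algebra:
  assumes M: "von_neumann_algebra M" and K: "complex_subspace K"
    and inv: "\<And>T \<xi>. T \<in> commutant M \<Longrightarrow> \<xi> \<in> K \<Longrightarrow> T \<xi> \<in> K"
  shows "orth_proj K \<in> projections M"
proof -
  have sub: "subspace K" and cl: "closed K" using K by (auto simp: complex_subspace_def)
  note op = orth_proj_apply[OF sub cl]
  have p: "projection_op (orth_proj K)" using K by (rule projection_op_orth_proj)
  have "orth_proj K o\<^sub>L T = T o\<^sub>L orth_proj K" if T: "T \<in> commutant M" for T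
  proof (rule blinfun_eqI)
    fix \<xi>
    obtain S where S: "S \<in> commutant M" "is_adjoint T S" using adjoint_in_commutant[OF M T] by blast
    have "orth_proj K (T \<xi>) = T (orth_proj K \<xi>)"
    proof (rule orth_proj_eqI[OF sub cl])
      show "T (orth_proj K \<xi>) \<in> K" using inv[OF T] op by blast
      show "inner (T \<xi> - T (orth_proj K \<xi>)) z = 0" if "z \<in> K" for z
        using op(2)[OF inv[OF S(1) that], of \<xi>] is_adjointD[OF S(2), of "\<xi> - orth_proj K \<xi>" z]
        by (simp add: blinfun.diff_right)
    qed
    then show "(orth_proj K o\<^sub>L T) \<xi> = (T o\<^sub>L orth_proj K) \<xi>" by simp
  qed
  then have "orth_proj K \<in> commutant (commutant M)"
    using p unfolding commutant_def[of "commutant M"] projection_op_def by blast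
  then have "orth_proj K \<in> M" using M by (simp add: von_neumann_algebra_def)
  with p show ?thesis by (simp add: projections_def)
qed

lemma closure_span_invariant:
  assumes "bounded_linear f" "f ` A \<subseteq> A" "x \<in> closure (span A)"
  shows "f x \<in> closure (span A)"
proof -
  have "f ` span A \<subseteq> span A"
    using linear_span_image[OF bounded_linear.linear[OF assms(1)], of A] assms(2) by (metis span_mono)
  then have "closure (f ` span A) \<subseteq> closure (span A)" by (rule closure_mono)
  moreover have "f ` closure (span A) \<subseteq> closure (f ` span A)"
    using assms(1) by (rule closure_bounded_linear_image_subset)
  ultimately show ?thesis using assms(3) by blast
qed

lemma subspace_closure_span: "subspace (closure (span (A::'a::real_normed_vector set)))"
  unfolding subspace_def
proof (intro conjI ballI allI)
  show "0 \<in> closure (span A)" using closure_subset span_zero by blast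
  fix x y assume "x \<in> closure (span A)" "y \<in> closure (span A)"
  then obtain X Y where "\<forall>n. X n \<in> span A" "X \<longlonglongrightarrow> x" "\<forall>n. Y n \<in> span A" "Y \<longlonglongrightarrow> y"
    unfolding closure_sequential by blast
  then show "x + y \<in> closure (span A)"
    unfolding closure_sequential by (intro exI[of _ "\<lambda>n. X n + Y n"]) (auto intro: span_add tendsto_add)
next
  fix c x assume "x \<in> closure (span A)"
  then obtain X where "\<forall>n. X n \<in> span A" "X \<longlonglongrightarrow> x"
    unfolding closure_sequential by blast
  then show "c *\<^sub>R x \<in> closure (span A)"
    unfolding closure_sequential by (intro exI[of _ "\<lambda>n. c *\<^sub>R X n"]) (auto intro: span_scale tendsto_scaleR)
qed

lemma zero_on_closure_span:
  assumes S: "bounded_linear S" and "\<And>x. x \<in> A \<Longrightarrow> S x = 0" "\<eta> \<in> closure (span A)"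
  shows "S \<eta> = 0"
proof -
  interpret bounded_linear S by fact
  have "subspace {x. S x = 0}" by (auto simp: subspace_def add scaleR zero)
  moreover have "closed {x. S x = 0}"
    by (intro closed_Collect_eq continuous_on continuous_on_const continuous_on_id)
  ultimately have "closure (span A) \<subseteq> {x. S x = 0}"
    using assms(2) by (intro closure_minimal span_minimal) auto
  with assms(3) show ?thesis by blast
qed

lemma complex_subspace_closure_span:
  assumes "\<And>c x. x \<in> A \<Longrightarrow> c *\<^sub>C x \<in> A"
  shows "complex_subspace (closure (span A))"
  unfolding complex_subspace_def
proof (intro conjI allI ballI)
  show "c *\<^sub>C x \<in> closure (span A)" if "x \<in> closure (span A)" for c x
    using closure_span_invariant[OF bounded_linear_scaleC _ that] assms by blast
qed (auto intro: subspace_closure_span)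

section \<open>Cyclic projections\<close>

text \<open>This is the space usually written \<open>[M'\<Xi>]\<close>.\<close>

definition cyclic_space ::
    "('h::complex_hilbert_space \<Rightarrow>\<^sub>L 'h) set \<Rightarrow> 'h set \<Rightarrow> 'h set" where
  "cyclic_space M \<Xi> = closure (span {blinfun_apply T \<xi> |T \<xi>. T \<in> commutant M \<and> \<xi> \<in> \<Xi>})"

context
  fixes M :: "('h::complex_hilbert_space \<Rightarrow>\<^sub>L 'h) set"
  assumes M: "von_neumann_algebra M"
begin

lemma complex_subspace_cyclic_space: "complex_subspace (cyclic_space M \<Xi>)"
  unfolding cyclic_space_def
proof (rule complex_subspace_closure_span)
  fix c x assume "x \<in> {blinfun_apply T \<xi> |T \<xi>. T \<in> commutant M \<and> \<xi> \<in> \<Xi>}"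
  then obtain T \<xi> where "T \<in> commutant M" "\<xi> \<in> \<Xi>" "x = T \<xi>" by blast
  then have "c *\<^sub>C x = (scalar_op c o\<^sub>L T) \<xi>" "scalar_op c o\<^sub>L T \<in> commutant M"
    using commutant_closed(1)[OF scalar_op_commutant(1)[OF von_neumann_algebra_subset[OF M]]] by auto
  with \<open>\<xi> \<in> \<Xi>\<close> show "c *\<^sub>C x \<in> {blinfun_apply T \<xi> |T \<xi>. T \<in> commutant M \<and> \<xi> \<in> \<Xi>}" by blast
qed

lemma cyclic_projection: "orth_proj (cyclic_space M \<Xi>) \<in> projections M"
proof (rule orth_proj_in_von_neumann_algebra[OF M complex_subspace_cyclic_space])
  fix T \<eta> assume T: "T \<in> commutant M" and "\<eta> \<in> cyclic_space M \<Xi>"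
  then show "T \<eta> \<in> cyclic_space M \<Xi>"
    unfolding cyclic_space_def
  proof (intro closure_span_invariant[OF blinfun.bounded_linear_right])
    show "blinfun_apply T ` {blinfun_apply S \<xi> |S \<xi>. S \<in> commutant M \<and> \<xi> \<in> \<Xi>} \<subseteq> {blinfun_apply S \<xi> |S \<xi>. S \<in> commutant M \<and> \<xi> \<in> \<Xi>}"
    proof clarify
      fix S \<xi> assume "S \<in> commutant M" "\<xi> \<in> \<Xi>"
      then show "\<exists>R \<zeta>. T (blinfun_apply S \<xi>) = blinfun_apply R \<zeta> \<and> R \<in> commutant M \<and> \<zeta> \<in> \<Xi>"
        using commutant_closed(1)[OF T, of S] by (intro exI[of _ "T o\<^sub>L S"] exI[of _ \<xi>]) auto
    qed
  qed
qed

lemma cyclic_space_mem: "\<xi> \<in> \<Xi> \<Longrightarrow> \<xi> \<in> cyclic_space M \<Xi>"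
  unfolding cyclic_space_def
  using scalar_op_commutant(2)[OF von_neumann_algebra_subset[OF M]]
  by (intro subsetD[OF closure_subset] span_base) (auto intro!: exI[of _ id_blinfun])

text \<open>Elements of \<open>M\<close> commute with \<open>M'\<close>, so whether they vanish on a cyclic space can be tested on
  the generating vectors.\<close>

lemma cyclic_space_minimal:
  assumes "S \<in> M" "\<And>\<xi>. \<xi> \<in> \<Xi> \<Longrightarrow> S \<xi> = 0" "\<eta> \<in> cyclic_space M \<Xi>"
  shows "S \<eta> = 0"
  by (rule zero_on_closure_span[OF blinfun.bounded_linear_right _ assms(3)[unfolded cyclic_space_def]])
    (use assms(1,2) in \<open>auto simp: commutant_commutes[symmetric] blinfun.zero_right\<close>)

lemma cyclic_space_mono: "\<Xi> \<subseteq> \<Xi>' \<Longrightarrow> cyclic_space M \<Xi> \<subseteq> cyclic_space M \<Xi>'"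
  unfolding cyclic_space_def by (intro closure_mono span_mono) blast

lemma projections_positive: "p \<in> projections M \<Longrightarrow> p \<in> positive_part M"
  by (simp add: projections_def positive_part_def positive_op_projection)

lemma op_le_projections:
  assumes "p \<in> projections M" "q \<in> projections M"
  shows "op_le p q \<longleftrightarrow> (\<forall>\<xi>. norm (p \<xi>) \<le> norm (q \<xi>))"
proof -
  have pq: "projection_op p" "projection_op q" using assms by (auto simp: projections_def)
  have "op_le p q \<longleftrightarrow> (\<forall>\<xi>. (norm (p \<xi>))\<^sup>2 \<le> (norm (q \<xi>))\<^sup>2)"
    unfolding projection_opD(3)[OF pq(1)] projection_opD(3)[OF pq(2)]
    by (rule op_le_iff_inner) (use pq in \<open>auto simp: projection_op_def\<close>)
  then show ?thesis by (simp add: power_mono_iff)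
qed

text \<open>The cyclic projections of the finite sets of vectors in the range of \<open>g\<close> are directed, with
  supremum \<open>g\<close>: an upper bound \<open>b\<close> dominates \<open>g\<close> at \<open>\<xi>\<close> because it dominates the cyclic
  projection of \<open>{g \<xi>}\<close>, which agrees with \<open>g\<close> at \<open>\<xi>\<close>. Normality of the trace does the rest.\<close>

lemma trace_exceeds_on_cyclic_projection:
  assumes \<tau>: "normal_trace M \<tau>" and g: "g \<in> projections M" and t: "t < \<tau> g"
  shows "\<exists>\<Xi>. finite \<Xi> \<and> (\<forall>\<xi>\<in>\<Xi>. g \<xi> = \<xi>) \<and> t < \<tau> (orth_proj (cyclic_space M \<Xi>))"
proof -
  let ?e = "\<lambda>\<Xi>. orth_proj (cyclic_space M \<Xi>)"
  define I where "I = {\<Xi>. finite \<Xi> \<and> (\<forall>\<xi>\<in>\<Xi>. g \<xi> = \<xi>)}"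
  have gp: "projection_op g" "g \<in> M" using g by (auto simp: projections_def)
  have sub: "subspace (cyclic_space M \<Xi>)" "closed (cyclic_space M \<Xi>)" for \<Xi>
    using complex_subspace_cyclic_space by (auto simp: complex_subspace_def)
  have fix_g: "g \<eta> = \<eta>" if "\<Xi> \<in> I" "\<eta> \<in> cyclic_space M \<Xi>" for \<Xi> \<eta>
  proof -
    have "(id_blinfun - g) \<eta> = 0"
      by (rule cyclic_space_minimal[OF _ _ that(2)])
        (use that(1) gp von_neumann_algebra_closed[OF M] in \<open>auto simp: I_def blinfun.diff_left\<close>)
    then show ?thesis by (simp add: blinfun.diff_left)
  qed
  have le: "op_le (?e \<Xi>) (?e \<Xi>')" if "\<Xi> \<subseteq> \<Xi>'" for \<Xi> \<Xi>'
    unfolding op_le_projections[OF cyclic_projection cyclic_projection]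
  proof
    fix \<xi>
    have "?e \<Xi> (?e \<Xi>' \<xi>) = ?e \<Xi> \<xi>"
    proof (rule orth_proj_eqI[OF sub])
      show "inner (?e \<Xi>' \<xi> - ?e \<Xi> \<xi>) z = 0" if z: "z \<in> cyclic_space M \<Xi>" for z
      proof -
        have "inner (\<xi> - ?e \<Xi> \<xi>) z = 0" "inner (\<xi> - ?e \<Xi>' \<xi>) z = 0"
          using z cyclic_space_mono[OF \<open>\<Xi> \<subseteq> \<Xi>'\<close>] orth_proj_apply(2)[OF sub] by blast+
        then show ?thesis by (simp add: inner_diff_left)
      qed
    qed (rule orth_proj_apply(1)[OF sub])
    then show "norm (?e \<Xi> \<xi>) \<le> norm (?e \<Xi>' \<xi>)"
      using projection_opD(4)[of "?e \<Xi>" "?e \<Xi>' \<xi>"] cyclic_projection by (auto simp: projections_def)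
  qed
  have "\<tau> g = (SUP a\<in>?e ` I. \<tau> a)"
  proof (rule \<tau>[unfolded normal_trace_def, THEN spec, THEN spec, THEN mp], intro conjI ballI impI)
    show "?e ` I \<subseteq> positive_part M" using cyclic_projection projections_positive by blast
    show "?e ` I \<noteq> {}" by (auto simp: I_def)
    show "g \<in> positive_part M" using g by (rule projections_positive)
    show "\<exists>c\<in>?e ` I. op_le a c \<and> op_le b c" if ab: "a \<in> ?e ` I" "b \<in> ?e ` I" for a b
    proof -
      obtain X Y where XY: "X \<in> I" "Y \<in> I" "a = ?e X" "b = ?e Y" using ab by blast
      then have "X \<union> Y \<in> I" by (auto simp: I_def)
      then show ?thesis using XY le by (intro bexI[of _ "?e (X \<union> Y)"]) auto
    qed
    show "op_le a g" if a: "a \<in> ?e ` I" for a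
    proof -
      obtain X where X: "X \<in> I" "a = ?e X" using a by blast
      have "norm (?e X \<xi>) \<le> norm (g \<xi>)" for \<xi>
      proof -
        have "g (?e X \<xi>) = ?e X \<xi>" using fix_g X(1) orth_proj_apply(1)[OF sub] by blast
        then have "(norm (?e X \<xi>))\<^sup>2 = inner (?e X \<xi>) (g \<xi>)"
          using projection_opD(2)[OF gp(1)] projection_opD(3)[of "?e X"] cyclic_projection[of X]
          by (metis (no_types, lifting) mem_Collect_eq projections_def)
        also have "\<dots> \<le> norm (?e X \<xi>) * norm (g \<xi>)" by (rule norm_cauchy_schwarz)
        finally show ?thesis by (cases "?e X \<xi> = 0") (auto simp: power2_eq_square)
      qed
      then show ?thesis unfolding X(2) op_le_projections[OF cyclic_projection g] by blast
    qed
    show "op_le g b" if b: "b \<in> positive_part M" and ub: "\<forall>a\<in>?e ` I. op_le a b" for b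
    proof -
      have bp: "positive_op b" "b \<in> M" using b by (auto simp: positive_part_def)
      have "0 \<le> inner ((b - g) \<xi>) \<xi> \<and> Im (cinner ((b - g) \<xi>) \<xi>) = 0" for \<xi>
      proof -
        have I: "{g \<xi>} \<in> I" using projection_opD(1)[OF gp(1)] by (auto simp: I_def)
        have e\<xi>: "?e {g \<xi>} \<xi> = g \<xi>"
        proof (rule orth_proj_eqI[OF sub])
          show "inner (\<xi> - g \<xi>) z = 0" if "z \<in> cyclic_space M {g \<xi>}" for z
            using fix_g[OF I that] projection_opD(2)[OF gp(1), of "\<xi>" z]
            by (simp add: inner_diff_left)
        qed (simp add: cyclic_space_mem)
        have p: "positive_op (b - ?e {g \<xi>})" using ub I unfolding op_le_def by blast
        have "(b - ?e {g \<xi>}) \<xi> = (b - g) \<xi>" by (simp add: blinfun.diff_left e\<xi>)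
        with p show ?thesis unfolding positive_op_def
          by (metis complex_nonneg_Reals_iff inner_Re_cinner)
      qed
      moreover have "b - g \<in> bounded_ops"
        using von_neumann_algebra_closed(4)[OF M bp(2) gp(2)] von_neumann_algebra_subset[OF M] by blast
      ultimately show ?thesis
        by (simp add: op_le_def positive_op_def complex_nonneg_Reals_iff inner_Re_cinner)
    qed
  qed
  with t have "\<exists>\<Xi>\<in>I. t < \<tau> (?e \<Xi>)" by (auto simp: less_SUP_iff)
  then show ?thesis by (auto simp: I_def)
qed

lemma trace_zero:
  assumes "trace_on M \<tau>"
  shows "\<tau> 0 = 0"
proof -
  have "\<tau> (0 *\<^sub>R id_blinfun) = ennreal 0 * \<tau> id_blinfun"
    using assms projections_positive[OF id_projection[OF M]] unfolding trace_on_def by blast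
  then show ?thesis by simp
qed

lemma trace_mono:
  assumes \<tau>: "trace_on M \<tau>" and a: "a \<in> positive_part M" and b: "b \<in> positive_part M" and le: "op_le a b"
  shows "\<tau> a \<le> \<tau> b"
proof -
  have "b - a \<in> positive_part M"
    using a b le von_neumann_algebra_closed(4)[OF M] by (auto simp: positive_part_def op_le_def)
  then have "\<tau> (a + (b - a)) = \<tau> a + \<tau> (b - a)" using \<tau> a unfolding trace_on_def by blast
  then show ?thesis by simp
qed

end

text \<open>By Bessel's inequality the numbers \<open>\<parallel>f \<xi>\<parallel>\<^sup>2\<close> are summable over \<open>F\<close>.\<close>

lemma countably_many_projections_not_annihilating:
  fixes F :: "('h::complex_hilbert_space \<Rightarrow>\<^sub>L 'h) set" and \<xi> :: 'h
  assumes F: "\<And>f. f \<in> F \<Longrightarrow> projection_op f" and orth: "pairwise (\<lambda>p q. p o\<^sub>L q = 0) F"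
  shows "countable {f\<in>F. blinfun_apply f \<xi> \<noteq> 0}"
proof -
  have bessel: "(\<Sum>f\<in>A. (norm (blinfun_apply f \<xi>))\<^sup>2) \<le> (norm \<xi>)\<^sup>2" if A: "finite A" "A \<subseteq> F" for A
  proof -
    define s where "s = (\<Sum>f\<in>A. blinfun_apply f \<xi>)"
    define S where "S = (\<Sum>f\<in>A. (norm (blinfun_apply f \<xi>))\<^sup>2)"
    have "inner s s = (\<Sum>f\<in>A. \<Sum>g\<in>A. inner (blinfun_apply f \<xi>) (blinfun_apply g \<xi>))"
      unfolding s_def inner_sum_left inner_sum_right by (rule sum.swap)
    also have "\<dots> = (\<Sum>f\<in>A. \<Sum>g\<in>A. if g = f then (norm (blinfun_apply f \<xi>))\<^sup>2 else 0)"
    proof (intro sum.cong refl)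
      fix f g assume fg: "f \<in> A" "g \<in> A"
      show "inner (blinfun_apply f \<xi>) (blinfun_apply g \<xi>) = (if g = f then (norm (blinfun_apply f \<xi>))\<^sup>2 else 0)"
      proof (cases "g = f")
        case False
        then have "f o\<^sub>L g = 0" using fg A pairwiseD[OF orth, of f g] by auto
        then have "blinfun_apply f (blinfun_apply g \<xi>) = 0" by (metis blinfun_apply_blinfun_compose zero_blinfun.rep_eq)
        then show ?thesis using False projection_opD(2)[OF F, of f \<xi> "blinfun_apply g \<xi>"] fg A by auto
      qed (simp add: power2_norm_eq_inner)
    qed
    also have "\<dots> = S" using A by (simp add: S_def)
    finally have "(norm s)\<^sup>2 = S" by (simp add: power2_norm_eq_inner)
    have "S = inner s \<xi>"
      unfolding S_def s_def inner_sum_left using A F projection_opD(3) by (auto intro!: sum.cong)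
    also have "\<dots> \<le> norm s * norm \<xi>" by (rule norm_cauchy_schwarz)
    finally have "norm s \<le> norm \<xi>" using \<open>(norm s)\<^sup>2 = S\<close>
      by (cases "s = 0") (auto simp: power2_eq_square)
    then have "(norm s)\<^sup>2 \<le> (norm \<xi>)\<^sup>2" by (simp add: power_mono)
    then show ?thesis using \<open>(norm s)\<^sup>2 = S\<close> by (simp add: S_def)
  qed
  have "(\<lambda>f. (norm (blinfun_apply f \<xi>))\<^sup>2) summable_on F"
    by (rule nonneg_bdd_above_summable_on) (auto intro!: bdd_aboveI2 bessel)
  then have "countable {f\<in>F. (norm (blinfun_apply f \<xi>))\<^sup>2 \<noteq> 0}" by (rule summable_countable_real)
  then show ?thesis by simp
qed

section \<open>Comparison of traces of projections\<close>

text \<open>For a positive contraction \<open>W = b\<^sup>*b\<close>, one Newton--Schulz step replaces \<open>b\<close> by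
  \<open>b(3 - W)/2\<close> and thus \<open>W\<close> by \<open>W(3 - W)\<^sup>2/4\<close>. On \<open>[0,1]\<close> the map \<open>w \<mapsto> w(3 - w)\<^sup>2/4\<close> is increasing
  and fixes \<open>0\<close> and \<open>1\<close>, and its iterates converge to \<open>1\<close> at every \<open>w > 0\<close>; so the
  iterates of \<open>W\<close> increase to its range projection.\<close>

locale positive_contraction =
  fixes W :: "'a::real_inner \<Rightarrow>\<^sub>L 'a"
  assumes selfadjoint: "inner (W x) y = inner x (W y)"
    and nonneg: "0 \<le> inner (W x) x" and le_one: "inner (W x) x \<le> inner x x"

definition newton_factor :: "('a::real_normed_vector \<Rightarrow>\<^sub>L 'a) \<Rightarrow> 'a \<Rightarrow>\<^sub>L 'a" where
  "newton_factor W = (3/2) *\<^sub>R id_blinfun - (1/2) *\<^sub>R W"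

lemma newton_factor_apply: "newton_factor W x = (3/2) *\<^sub>R x - (1/2) *\<^sub>R W x"
  by (simp add: newton_factor_def blinfun.diff_left blinfun.scaleR_left)

definition newton_step :: "('a::real_normed_vector \<Rightarrow>\<^sub>L 'a) \<Rightarrow> 'a \<Rightarrow>\<^sub>L 'a" where
  "newton_step W = newton_factor W o\<^sub>L W o\<^sub>L newton_factor W"

context positive_contraction
begin

text \<open>With \<open>U = 1 - W\<close> these facts rest on the identities \<open>W - W\<^sup>2 = UWU + WUW\<close>,
  \<open>1 - W(3 - W)\<^sup>2/4 = 3/4 U\<^sup>2 + 1/4 U\<^sup>3\<close> and \<open>W(3 - W)\<^sup>2/4 - W = 5/4 UWU + WUW\<close>. Their right-hand
  sides are visibly positive. Each one is linear in the
  moments \<open>\<langle>W\<^sup>kx, x\<rangle>\<close> for \<open>k \<le> 3\<close>, so after naming the moments only linear arithmetic remains.\<close>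

lemma
  shows complement_square_le: "(norm (x - W x))\<^sup>2 \<le> inner (x - W x) x"
    and square_le: "(norm (W x))\<^sup>2 \<le> inner (W x) x"
    and newton_step_nonneg: "0 \<le> inner (newton_step W x) x"
    and newton_step_le_one: "inner (newton_step W x) x \<le> inner x x"
    and newton_step_gain: "inner (W (x - W x)) (x - W x) \<le> inner (newton_step W x) x - inner (W x) x"
proof -
  define m1 m2 m3 where "m1 = inner (W x) x" and "m2 = inner (W x) (W x)" and "m3 = inner (W (W x)) (W x)"
  have sw: "inner x (W x) = m1" "inner (W (W x)) x = m2" "inner x (W (W x)) = m2" "inner (W x) (W (W x)) = m3"
    "inner (W (W (W x))) x = m3"
    unfolding m1_def m2_def m3_def by (simp_all add: selfadjoint)
  note m = m1_def[symmetric] m2_def[symmetric] m3_def[symmetric] sw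
  have gain: "inner (W (x - W x)) (x - W x) = m1 - 2 * m2 + m3"
    by (simp add: blinfun.diff_right inner_diff_left inner_diff_right m)
  have u0: "0 \<le> m1 - 2 * m2 + m3" using nonneg[of "x - W x"] gain by simp
  have u1: "m1 - 2 * m2 + m3 \<le> inner x x - 2 * m1 + m2"
    using le_one[of "x - W x"] unfolding gain by (simp add: inner_diff_left inner_diff_right m)
  have v: "0 \<le> m3" "m3 \<le> m2" using nonneg[of "W x"] le_one[of "W x"] by (simp_all add: m)
  show sq: "(norm (W x))\<^sup>2 \<le> inner (W x) x" unfolding power2_norm_eq_inner m using u0 v by linarith
  show "(norm (x - W x))\<^sup>2 \<le> inner (x - W x) x"
    using sq unfolding power2_norm_eq_inner by (simp add: inner_diff_left inner_diff_right m)
  have step: "inner (newton_step W x) x = 9/4 * m1 - 3/2 * m2 + 1/4 * m3"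
    unfolding newton_step_def
    by (simp add: newton_factor_apply blinfun.diff_right blinfun.scaleR_right inner_diff_left inner_diff_right m algebra_simps)
  show "0 \<le> inner (newton_step W x) x" "inner (newton_step W x) x \<le> inner x x"
    unfolding step using u0 u1 v le_one[of x] m1_def by linarith+
  show "inner (W (x - W x)) (x - W x) \<le> inner (newton_step W x) x - inner (W x) x"
    unfolding gain step m using v u0 by linarith
qed

lemma newton_step_contraction: "positive_contraction (newton_step W)"
proof
  show "inner (newton_step W x) y = inner x (newton_step W y)" for x y
  proof -
    have "inner (newton_factor W x) y = inner x (newton_factor W y)" for x y
      by (simp add: newton_factor_apply inner_diff_left inner_diff_right selfadjoint)
    then show ?thesis by (simp add: newton_step_def selfadjoint)
  qed
qed (rule newton_step_nonneg newton_step_le_one)+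

primrec newton_iter :: "nat \<Rightarrow> 'a \<Rightarrow>\<^sub>L 'a" where
  "newton_iter 0 = W"
| "newton_iter (Suc n) = newton_step (newton_iter n)"

lemma newton_iter_contraction: "positive_contraction (newton_iter n)"
  by (induction n) (auto simp: positive_contraction_axioms positive_contraction.newton_step_contraction)

lemma newton_iter_commute: "newton_iter n (W x) = W (newton_iter n x)"
  by (induction n arbitrary: x)
    (simp_all add: newton_step_def newton_factor_apply blinfun.diff_right blinfun.scaleR_right)

lemma newton_iter_mono: "incseq (\<lambda>n. inner (newton_iter n x) x)"
proof (rule incseq_SucI)
  fix n
  interpret V: positive_contraction "newton_iter n" by (rule newton_iter_contraction)
  show "inner (newton_iter n x) x \<le> inner (newton_iter (Suc n) x) x"
    using V.newton_step_gain[of x] V.nonneg[of "x - newton_iter n x"] by simp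
qed

text \<open>Let \<open>U\<^sub>n = 1 - W\<^sub>n\<close>. The increments of the bounded increasing sequence \<open>\<langle>W\<^sub>nx, x\<rangle>\<close> tend to \<open>0\<close>
  and bound \<open>\<langle>W\<^sub>nU\<^sub>nx, U\<^sub>nx\<rangle>\<close>, hence also \<open>\<langle>WU\<^sub>nx, U\<^sub>nx\<rangle> \<ge> \<parallel>WU\<^sub>nx\<parallel>\<^sup>2 = \<parallel>U\<^sub>nWx\<parallel>\<^sup>2\<close>.\<close>

lemma newton_iter_tendsto_on_range:
  "(\<lambda>n. W x - newton_iter n (W x)) \<longlonglongrightarrow> 0"
proof -
  let ?u = "\<lambda>n. x - newton_iter n x"
  have "inner (newton_iter n x) x \<le> inner x x" for n
    using newton_iter_contraction by (rule positive_contraction.le_one)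
  then obtain L where L: "(\<lambda>n. inner (newton_iter n x) x) \<longlonglongrightarrow> L"
    using incseq_convergent[OF newton_iter_mono, of x "inner x x"] by blast
  have "(\<lambda>n. inner (newton_iter (Suc n) x) x - inner (newton_iter n x) x) \<longlonglongrightarrow> L - L"
    by (intro tendsto_diff L LIMSEQ_Suc)
  then have increments: "(\<lambda>n. inner (newton_iter (Suc n) x) x - inner (newton_iter n x) x) \<longlonglongrightarrow> 0" by simp
  have bound: "(norm (W (?u n)))\<^sup>2 \<le> inner (newton_iter (Suc n) x) x - inner (newton_iter n x) x" for n
  proof -
    have "(norm (W (?u n)))\<^sup>2 \<le> inner (W (?u n)) (?u n)" by (rule square_le)
    also have "\<dots> \<le> inner (newton_iter n (?u n)) (?u n)"
      using incseqD[OF newton_iter_mono, of 0 n "?u n"] by simp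
    also have "\<dots> \<le> inner (newton_iter (Suc n) x) x - inner (newton_iter n x) x"
      using positive_contraction.newton_step_gain[OF newton_iter_contraction] by simp
    finally show ?thesis .
  qed
  have "(\<lambda>n. (norm (W (?u n)))\<^sup>2) \<longlonglongrightarrow> 0"
    by (rule tendsto_sandwich[OF _ _ tendsto_const increments]) (use bound in \<open>auto intro: always_eventually\<close>)
  then have "(\<lambda>n. sqrt ((norm (W (?u n)))\<^sup>2)) \<longlonglongrightarrow> sqrt 0" by (rule tendsto_real_sqrt)
  then have "(\<lambda>n. W (?u n)) \<longlonglongrightarrow> 0" by (subst tendsto_norm_zero_iff[symmetric]) simp
  then show ?thesis by (simp add: blinfun.diff_right newton_iter_commute)
qed

lemma newton_iter_tendsto:
  assumes x: "x \<in> closure (range W)"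
  shows "(\<lambda>n. inner (newton_iter n x) x) \<longlonglongrightarrow> inner x x"
proof -
  have "(\<lambda>n. x - newton_iter n x) \<longlonglongrightarrow> 0"
  proof (rule LIMSEQ_I)
    fix e :: real assume "e > 0"
    then obtain y where y: "norm (x - W y) < e / 2"
      using x unfolding closure_approachable by (metis dist_commute dist_norm half_gt_zero imageE)
    obtain n0 where n0: "norm (W y - newton_iter n (W y)) < e / 2" if "n \<ge> n0" for n
      using LIMSEQ_D[OF newton_iter_tendsto_on_range, of "e/2" y] \<open>e > 0\<close> by auto
    have "norm (x - newton_iter n x - 0) < e" if "n \<ge> n0" for n
    proof -
      interpret V: positive_contraction "newton_iter n" by (rule newton_iter_contraction)
      define z where "z = x - W y"
      have "(norm (z - newton_iter n z))\<^sup>2 \<le> norm (z - newton_iter n z) * norm z"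
        using V.complement_square_le norm_cauchy_schwarz order_trans by blast
      then have "norm (z - newton_iter n z) \<le> norm z"
        by (cases "z - newton_iter n z = 0") (auto simp: power2_eq_square)
      moreover have eq: "x - newton_iter n x = (z - newton_iter n z) + (W y - newton_iter n (W y))"
        by (simp add: z_def blinfun.diff_right)
      moreover have "norm z < e / 2" using y by (simp add: z_def)
      ultimately have "norm (x - newton_iter n x) < e"
        unfolding eq
        using norm_triangle_ineq[of "z - newton_iter n z" "W y - newton_iter n (W y)"] n0[OF that]
        by linarith
      then show ?thesis by simp
    qed
    then show "\<exists>no. \<forall>n\<ge>no. norm (x - newton_iter n x - 0) < e" by blast
  qed
  then have "(\<lambda>n. inner x x - inner (x - newton_iter n x) x) \<longlonglongrightarrow> inner x x - inner 0 x"
    by (intro tendsto_intros)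
  then show ?thesis by (simp add: inner_diff_left)
qed

end

text \<open>This is the inequality \<open>\<tau>(e) \<le> \<tau>(q)\<close> for \<open>e \<and> (1 - q) = 0\<close>. Start the iteration at \<open>b\<^sub>0 = qe\<close>.
  Then \<open>b\<^sub>n\<^sup>*b\<^sub>n\<close> increases to the range projection of \<open>eqe\<close>, which is \<open>e\<close> by the hypothesis,
  whereas \<open>b\<^sub>nb\<^sub>n\<^sup>* \<le> q\<close> because \<open>b\<^sub>n\<^sup>*\<close> is a contraction with \<open>b\<^sub>n\<^sup>*q = b\<^sub>n\<^sup>*\<close>. The two products have
  the same trace.\<close>

lemma trace_le_if_kernel_meets_trivially:
  fixes M :: "('h::complex_hilbert_space \<Rightarrow>\<^sub>L 'h) set"
  assumes M: "von_neumann_algebra M" and \<tau>: "trace_on M \<tau>" "normal_trace M \<tau>"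
    and e: "e \<in> projections M" and q: "q \<in> projections M"
    and inj: "\<And>\<xi>. e \<xi> = \<xi> \<Longrightarrow> q \<xi> = 0 \<Longrightarrow> \<xi> = 0"
  shows "\<tau> e \<le> \<tau> q"
proof -
  note closed = von_neumann_algebra_closed[OF M]
  have bounded: "T \<in> bounded_ops" if "T \<in> M" for T using that von_neumann_algebra_subset[OF M] by blast
  have ep: "projection_op e" "e \<in> M" and qp: "projection_op q" "q \<in> M"
    using e q by (auto simp: projections_def)
  have adj: "is_adjoint e e" "is_adjoint q q" using ep qp by (auto simp: projection_op_def)
  note e_simps = projection_opD(1,2)[OF ep(1)] and q_simps = projection_opD(1,2)[OF qp(1)]
  define h where "h = e o\<^sub>L q o\<^sub>L e"
  interpret h: positive_contraction h
  proof
    show "inner (h x) y = inner x (h y)" for x y by (simp add: h_def e_simps q_simps)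
    have h: "inner (h x) x = (norm (q (e x)))\<^sup>2" for x
      by (simp add: h_def e_simps projection_opD(3)[OF qp(1)])
    then show "0 \<le> inner (h x) x" for x by simp
    have "norm (q (e x)) \<le> norm x" for x
      using projection_opD(4)[OF qp(1), of "e x"] projection_opD(4)[OF ep(1), of x] by linarith
    then show "inner (h x) x \<le> inner x x" for x
      unfolding h power2_norm_eq_inner[symmetric] by (simp add: power_mono)
  qed
  define w where "w = h.newton_iter"
  have w_0: "w 0 = h" and w_Suc: "w (Suc n) = newton_step (w n)" for n by (simp_all add: w_def)
  have w_contraction: "positive_contraction (w n)" for n unfolding w_def by (rule h.newton_iter_contraction)
  have w_M: "w n \<in> M" for n
    by (induction n)
      (simp_all add: w_0 w_Suc h_def newton_step_def newton_factor_def closed ep(2) qp(2))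
  have w_adj: "is_adjoint (w n) (w n)" for n
    using bounded[OF w_M] positive_contraction.selfadjoint[OF w_contraction] by (rule is_adjointI)
  have w_pos: "w n \<in> positive_part M" for n
    using w_M bounded[OF w_M] w_adj positive_contraction.nonneg[OF w_contraction]
    by (auto simp: positive_part_def intro: positive_opI)
  have w_e: "w n (e x) = w n x \<and> e (w n x) = w n x" for n x
    by (induction n arbitrary: x)
      (auto simp: w_0 w_Suc h_def e_simps newton_step_def newton_factor_apply blinfun.diff_right blinfun.scaleR_right)
  \<comment> \<open>the iterates \<open>b\<close> together with their adjoints \<open>c\<close>\<close>
  have "\<exists>b c. b \<in> M \<and> c \<in> M \<and> is_adjoint b c \<and> c o\<^sub>L b = w n \<and> c o\<^sub>L q = c" for n
  proof (induction n)
    case 0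
    show ?case
      by (rule exI[of _ "q o\<^sub>L e"], rule exI[of _ "e o\<^sub>L q"])
        (auto simp: closed ep(2) qp(2) is_adjoint_compose adj w_0 h_def blinfun_eq_iff q_simps)
  next
    case (Suc n)
    then obtain b c where bc: "b \<in> M" "c \<in> M" "is_adjoint b c" "c o\<^sub>L b = w n" "c o\<^sub>L q = c" by blast
    define k where "k = newton_factor (w n)"
    have k: "k \<in> M" unfolding k_def newton_factor_def by (simp add: closed w_M)
    have "is_adjoint k k"
      using bounded[OF k] by (rule is_adjointI)
        (simp add: k_def newton_factor_apply inner_diff_left inner_diff_right positive_contraction.selfadjoint[OF w_contraction])
    then have "is_adjoint (b o\<^sub>L k) (k o\<^sub>L c)" using bc(3) by (rule is_adjoint_compose[rotated])
    moreover have "(k o\<^sub>L c) o\<^sub>L (b o\<^sub>L k) = w (Suc n)"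
      using fun_cong[OF arg_cong[OF bc(4), of blinfun_apply]]
      by (simp add: w_Suc newton_step_def k_def blinfun_eq_iff)
    moreover have "(k o\<^sub>L c) o\<^sub>L q = k o\<^sub>L c" using bc(5) by (simp add: blinfun_eq_iff)
    ultimately show ?case using bc k closed(2) by blast
  qed
  then obtain b c where b: "\<And>n. b n \<in> M" and c: "\<And>n. c n \<in> M" and bc: "\<And>n. is_adjoint (b n) (c n)"
    and cb: "\<And>n. c n o\<^sub>L b n = w n" and cq: "\<And>n. c n o\<^sub>L q = c n" by metis
  have w_le: "\<tau> (w n) \<le> \<tau> q" for n
  proof -
    have bcM: "b n o\<^sub>L c n \<in> M" by (simp add: closed b c)
    have bc_adj: "is_adjoint (b n o\<^sub>L c n) (b n o\<^sub>L c n)"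
      using bc is_adjoint_sym is_adjoint_compose by blast
    have bc_inner: "inner ((b n o\<^sub>L c n) x) x = (norm (c n x))\<^sup>2" for x
      using is_adjointD[OF bc] by (simp add: power2_norm_eq_inner)
    have c_le: "norm (c n x) \<le> norm x" for x
    proof -
      have "(norm (b n y))\<^sup>2 \<le> (norm y)\<^sup>2" for y
      proof -
        have "(norm (b n y))\<^sup>2 = inner (w n y) y"
          unfolding cb[symmetric] power2_norm_eq_inner using is_adjointD[OF is_adjoint_sym[OF bc]] by simp
        also have "\<dots> \<le> (norm y)\<^sup>2"
          using positive_contraction.le_one[OF w_contraction] by (simp add: power2_norm_eq_inner)
        finally show ?thesis .
      qed
      then have "norm (b n y) \<le> norm y" for y by (simp add: power_mono_iff)
      moreover have "(norm (c n x))\<^sup>2 \<le> norm (b n (c n x)) * norm x"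
        using bc_inner[of x] norm_cauchy_schwarz[of "(b n o\<^sub>L c n) x" x] by simp
      ultimately have "(norm (c n x))\<^sup>2 \<le> norm (c n x) * norm x"
        by (meson mult_right_mono norm_ge_zero order_trans)
      then show ?thesis by (cases "c n x = 0") (auto simp: power2_eq_square)
    qed
    have "inner ((b n o\<^sub>L c n) x) x \<le> inner (q x) x" for x
    proof -
      have "c n x = c n (q x)" using cq[of n] by (metis blinfun_apply_blinfun_compose)
      then have "norm (c n x) \<le> norm (q x)" using c_le by metis
      then show ?thesis unfolding bc_inner projection_opD(3)[OF qp(1), symmetric] by (simp add: power_mono)
    qed
    then have "op_le (b n o\<^sub>L c n) q"
      using op_le_iff_inner[OF bounded[OF bcM] bc_adj bounded[OF qp(2)] adj(2)] by blast
    moreover have "positive_op (b n o\<^sub>L c n)"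
      using bounded[OF bcM] bc_adj by (rule positive_opI) (simp add: bc_inner del: blinfun_apply_blinfun_compose)
    ultimately have "\<tau> (b n o\<^sub>L c n) \<le> \<tau> q"
      using bcM trace_mono[OF M \<tau>(1) _ projections_positive[OF M q]] by (auto simp: positive_part_def)
    moreover have "\<tau> (c n o\<^sub>L b n) = \<tau> (b n o\<^sub>L c n)" using \<tau>(1) b c bc unfolding trace_on_def by blast
    ultimately show ?thesis by (simp add: cb)
  qed
  \<comment> \<open>a vector of \<open>e\<close> orthogonal to the range of \<open>eqe\<close> is in the kernel of \<open>q\<close>\<close>
  have range_dense: "\<xi> \<in> closure (range h)" if \<xi>: "e \<xi> = \<xi>" for \<xi>
  proof -
    let ?K = "closure (span (range h))"
    have h_range: "span (range h) = range h"
      using linear_subspace_image[OF bounded_linear.linear[OF blinfun.bounded_linear_right] subspace_UNIV] by (auto simp: span_eq_iff)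
    note pr = orth_proj_apply[OF subspace_closure_span[of "range h"] closed_closure]
    define \<delta> where "\<delta> = \<xi> - orth_proj ?K \<xi>"
    have "inner \<delta> (h y) = 0" for y
      unfolding \<delta>_def by (rule pr(2)) (intro subsetD[OF closure_subset] span_base rangeI)
    then have "inner (h \<delta>) y = 0" for y by (simp add: h.selfadjoint)
    then have "h \<delta> = 0" using inner_eq_zero_iff by blast
    have "orth_proj ?K \<xi> \<in> {x. (id_blinfun - e) x = 0}"
    proof (rule subsetD[OF _ pr(1)], rule closure_minimal)
      show "span (range h) \<subseteq> {x. (id_blinfun - e) x = 0}"
        unfolding h_range by (auto simp: blinfun.diff_left h_def e_simps)
      show "closed {x. (id_blinfun - e) x = 0}" by (intro closed_Collect_eq continuous_intros)
    qed
    then have e\<delta>: "e \<delta> = \<delta>" using \<xi> by (simp add: \<delta>_def blinfun.diff_left blinfun.diff_right)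
    have "(norm (q \<delta>))\<^sup>2 = inner (h \<delta>) \<delta>"
      unfolding projection_opD(3)[OF qp(1)] h_def using e\<delta> by (simp add: e_simps)
    then have "q \<delta> = 0" using \<open>h \<delta> = 0\<close> by simp
    then have "\<delta> = 0" using inj e\<delta> by blast
    then show ?thesis using pr(1)[of \<xi>] by (simp add: \<delta>_def h_range)
  qed
  have w_limit: "(\<lambda>n. inner (w n x) x) \<longlonglongrightarrow> (norm (e x))\<^sup>2" for x
  proof -
    have "inner (w n x) x = inner (w n (e x)) (e x)" for n
      using w_e[of n x] e_simps(2)[of "w n x" x] by simp
    then show ?thesis
      using h.newton_iter_tendsto[OF range_dense[of "e x"]] by (simp add: w_def e_simps power2_norm_eq_inner)
  qed
  have w_mono: "incseq (\<lambda>n. inner (w n x) x)" for x unfolding w_def by (rule h.newton_iter_mono)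
  have w_op_le: "op_le (w m) (w n)" if "m \<le> n" for m n
    using op_le_iff_inner[OF bounded[OF w_M] w_adj bounded[OF w_M] w_adj] incseqD[OF w_mono that] by blast
  have "\<tau> e = (SUP a\<in>range w. \<tau> a)"
  proof (rule \<tau>(2)[unfolded normal_trace_def, THEN spec, THEN spec, THEN mp], intro conjI ballI impI)
    show "range w \<subseteq> positive_part M" using w_pos by blast
    show "range w \<noteq> {}" by simp
    show "e \<in> positive_part M" using e by (rule projections_positive[OF M])
    show "\<exists>c\<in>range w. op_le a c \<and> op_le b c" if a: "a \<in> range w" and b: "b \<in> range w" for a b
    proof -
      obtain m n where "a = w m" "b = w n" using a b by blast
      then show ?thesis by (intro bexI[of _ "w (max m n)"]) (auto intro: w_op_le)
    qed
    show "op_le a e" if a: "a \<in> range w" for a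
    proof -
      obtain n where n: "a = w n" using a by blast
      have "inner (w n x) x \<le> (norm (e x))\<^sup>2" for x using w_mono w_limit by (rule incseq_le)
      then show ?thesis
        unfolding n op_le_iff_inner[OF bounded[OF w_M] w_adj bounded[OF ep(2)] adj(1)] projection_opD(3)[OF ep(1)]
        by blast
    qed
    show "op_le e b" if b: "b \<in> positive_part M" and ub: "\<forall>a\<in>range w. op_le a b" for b
    proof -
      have bp: "b \<in> M" "positive_op b" using b by (auto simp: positive_part_def)
      have lim: "(\<lambda>n. inner ((b - w n) x) x) \<longlonglongrightarrow> inner ((b - e) x) x" for x
        unfolding blinfun.diff_left inner_diff_left projection_opD(3)[OF ep(1), symmetric]
        by (intro tendsto_diff tendsto_const w_limit)
      have "0 \<le> inner ((b - w n) x) x" for n x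
        using ub by (auto simp: op_le_def dest: positive_opD)
      then have nn: "0 \<le> inner ((b - e) x) x" for x using LIMSEQ_le_const[OF lim] by blast
      have be: "b - e \<in> bounded_ops" using bounded closed(4) bp(1) ep(2) by blast
      have "Im (cinner ((b - e) x) x) = 0" for x
      proof -
        have "Im (cinner (b x) x) = 0"
          using bp(2) by (simp add: positive_op_def complex_nonneg_Reals_iff)
        moreover have "Im (cinner (e x) x) = 0"
          using positive_op_projection[OF ep(1)] by (simp add: positive_op_def complex_nonneg_Reals_iff)
        moreover have "cinner (b x) x = cinner ((b - e) x) x + cinner (e x) x"
          by (simp add: blinfun.diff_left flip: cinner_add_left)
        ultimately show ?thesis by simp
      qed
      then show ?thesis
        using nn be by (simp add: op_le_def positive_op_def complex_nonneg_Reals_iff inner_Re_cinner)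
    qed
  qed
  also have "\<dots> \<le> \<tau> q" using w_le by (auto intro: SUP_least)
  finally show ?thesis .
qed

section \<open>Closed operators and their absolute values\<close>

lemma closed_dd_operatorD:
  assumes "closed_dd_operator x"
  shows "(0, 0) \<in> x" "(\<xi>, \<eta>) \<in> x \<Longrightarrow> (\<xi>', \<eta>') \<in> x \<Longrightarrow> (\<xi> + \<xi>', \<eta> + \<eta>') \<in> x"
    "(\<xi>, \<eta>) \<in> x \<Longrightarrow> (c *\<^sub>C \<xi>, c *\<^sub>C \<eta>) \<in> x" "(\<xi>, \<eta>) \<in> x \<Longrightarrow> (r *\<^sub>R \<xi>, r *\<^sub>R \<eta>) \<in> x"
    "(\<xi>, \<eta>) \<in> x \<Longrightarrow> (\<xi>', \<eta>') \<in> x \<Longrightarrow> (\<xi> - \<xi>', \<eta> - \<eta>') \<in> x"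
    "(\<xi>, \<eta>) \<in> x \<Longrightarrow> (\<xi>, \<eta>') \<in> x \<Longrightarrow> \<eta> = \<eta>'" "closed x" "closure (Domain x) = UNIV"
proof -
  have d: "(0, 0) \<in> x" "\<And>\<xi> \<eta> \<xi>' \<eta>'. (\<xi>, \<eta>) \<in> x \<Longrightarrow> (\<xi>', \<eta>') \<in> x \<Longrightarrow> (\<xi> + \<xi>', \<eta> + \<eta>') \<in> x"
    "\<And>c \<xi> \<eta>. (\<xi>, \<eta>) \<in> x \<Longrightarrow> (c *\<^sub>C \<xi>, c *\<^sub>C \<eta>) \<in> x" "single_valued x" "closed x" "closure (Domain x) = UNIV"
    using assms unfolding closed_dd_operator_def by blast+
  show "(0, 0) \<in> x" "(\<xi>, \<eta>) \<in> x \<Longrightarrow> (\<xi>', \<eta>') \<in> x \<Longrightarrow> (\<xi> + \<xi>', \<eta> + \<eta>') \<in> x"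
    "(\<xi>, \<eta>) \<in> x \<Longrightarrow> (c *\<^sub>C \<xi>, c *\<^sub>C \<eta>) \<in> x" "closed x" "closure (Domain x) = UNIV"
    using d by blast+
  show "(\<xi>, \<eta>) \<in> x \<Longrightarrow> (r *\<^sub>R \<xi>, r *\<^sub>R \<eta>) \<in> x" unfolding scaleR_scaleC by (rule d(3))
  show "(\<xi>, \<eta>) \<in> x \<Longrightarrow> (\<xi> - \<xi>', \<eta> - \<eta>') \<in> x" if "(\<xi>', \<eta>') \<in> x"
    using d(2)[of \<xi> \<eta> "- \<xi>'" "- \<eta>'"] d(3)[OF that, of "- 1"] by simp
  show "(\<xi>, \<eta>) \<in> x \<Longrightarrow> (\<xi>, \<eta>') \<in> x \<Longrightarrow> \<eta> = \<eta>'" using d(4) by (rule single_valuedD)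
qed

lemma adjoint_graphD:
  assumes "(\<eta>, \<zeta>) \<in> adjoint_graph x" "(\<xi>, \<theta>) \<in> x"
  shows "inner \<theta> \<eta> = inner \<xi> \<zeta>"
  using assms by (auto simp: adjoint_graph_def inner_Re_cinner)

lemma adjoint_graph_linear:
  assumes "(\<eta>, \<zeta>) \<in> adjoint_graph x" "(\<eta>', \<zeta>') \<in> adjoint_graph x"
  shows "(\<eta> + \<eta>', \<zeta> + \<zeta>') \<in> adjoint_graph x" "(c *\<^sub>C \<eta>, c *\<^sub>C \<zeta>) \<in> adjoint_graph x"
    "(r *\<^sub>R \<eta>, r *\<^sub>R \<zeta>) \<in> adjoint_graph x" "(\<eta> - \<eta>', \<zeta> - \<zeta>') \<in> adjoint_graph x"
proof -
  have add: "(\<eta> + \<eta>', \<zeta> + \<zeta>') \<in> adjoint_graph x" if "(\<eta>, \<zeta>) \<in> adjoint_graph x" "(\<eta>', \<zeta>') \<in> adjoint_graph x" for \<eta> \<zeta> \<eta>' \<zeta>'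
    using that by (fastforce simp: adjoint_graph_def cinner_add_right)
  have sc: "(c *\<^sub>C \<eta>, c *\<^sub>C \<zeta>) \<in> adjoint_graph x" if "(\<eta>, \<zeta>) \<in> adjoint_graph x" for \<eta> \<zeta> c
    using that by (fastforce simp: adjoint_graph_def cinner_scaleC_right)
  show "(\<eta> + \<eta>', \<zeta> + \<zeta>') \<in> adjoint_graph x" "(c *\<^sub>C \<eta>, c *\<^sub>C \<zeta>) \<in> adjoint_graph x"
    "(r *\<^sub>R \<eta>, r *\<^sub>R \<zeta>) \<in> adjoint_graph x"
    using add assms sc unfolding scaleR_scaleC by blast+
  show "(\<eta> - \<eta>', \<zeta> - \<zeta>') \<in> adjoint_graph x" using add[OF assms(1) sc[OF assms(2), of "- 1"]] by simp
qed

lemma adjoint_graphI: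
  assumes x: "closed_dd_operator x" and eq: "\<And>\<xi> \<theta>. (\<xi>, \<theta>) \<in> x \<Longrightarrow> inner \<theta> \<eta> = inner \<xi> \<zeta>"
  shows "(\<eta>, \<zeta>) \<in> adjoint_graph x"
proof -
  have "cinner \<theta> \<eta> = cinner \<xi> \<zeta>" if "(\<xi>, \<theta>) \<in> x" for \<xi> \<theta>
  proof (rule complex_eqI)
    show "Re (cinner \<theta> \<eta>) = Re (cinner \<xi> \<zeta>)" using eq[OF that] by (simp add: inner_Re_cinner)
    show "Im (cinner \<theta> \<eta>) = Im (cinner \<xi> \<zeta>)"
      unfolding Im_cinner using eq closed_dd_operatorD(3)[OF x that] by blast
  qed
  then show ?thesis by (auto simp: adjoint_graph_def)
qed

lemma subspace_closed_dd_operator: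
  assumes "closed_dd_operator x" shows "subspace x"
  using closed_dd_operatorD(1,2,4)[OF assms] by (auto simp: subspace_def zero_prod_def)

text \<open>Project \<open>(\<alpha>, 0)\<close> onto the graph of \<open>x\<close>: orthogonality of the remainder to the graph is
  exactly the statement that \<open>\<eta>\<close> is in the domain of \<open>x\<^sup>*\<close> and \<open>x\<^sup>*\<eta> = \<alpha> - \<xi>\<close>.\<close>

lemma one_plus_adjoint_square_surjective:
  assumes x: "closed_dd_operator x"
  obtains \<xi> \<eta> \<zeta> where "(\<xi>, \<eta>) \<in> x" "(\<eta>, \<zeta>) \<in> adjoint_graph x" "\<alpha> = \<xi> + \<zeta>"
proof -
  obtain y where "y \<in> x" "\<forall>z\<in>x. inner ((\<alpha>, 0) - y) z = 0"
    using orthogonal_decomposition[OF subspace_closed_dd_operator[OF x] closed_dd_operatorD(7)[OF x], of "(\<alpha>, 0)"]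
    by blast
  moreover obtain \<xi> \<eta> where "y = (\<xi>, \<eta>)" by fastforce
  ultimately have y: "(\<xi>, \<eta>) \<in> x" "\<And>u v. (u, v) \<in> x \<Longrightarrow> inner ((\<alpha>, 0) - (\<xi>, \<eta>)) (u, v) = 0" by blast+
  have "(\<eta>, \<alpha> - \<xi>) \<in> adjoint_graph x"
  proof (rule adjoint_graphI[OF x])
    show "inner v \<eta> = inner u (\<alpha> - \<xi>)" if "(u, v) \<in> x" for u v
      using y(2)[OF that] by (simp add: inner_diff_left inner_diff_right inner_commute)
  qed
  then show ?thesis using that y(1) by fastforce
qed

text \<open>Von Neumann's theorem that the domain of \<open>x\<^sup>*x\<close> is a core for \<open>x\<close>. An element \<open>(\<alpha>, \<beta>)\<close> of the
  graph orthogonal to that part of the graph satisfies \<open>\<alpha> \<bottom> (1 + x\<^sup>*x)\<xi>\<close> for all \<open>\<xi>\<close>, and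
  \<open>1 + x\<^sup>*x\<close> is surjective.\<close>

lemma domain_adjoint_square_core:
  assumes x: "closed_dd_operator x"
  shows "x \<subseteq> closure {(\<xi>, \<eta>). (\<xi>, \<eta>) \<in> x \<and> (\<exists>\<zeta>. (\<eta>, \<zeta>) \<in> adjoint_graph x)}" (is "_ \<subseteq> closure ?G")
proof
  fix z assume z: "z \<in> x"
  have "(0, 0) \<in> adjoint_graph x"
    by (rule adjoint_graphI[OF x]) simp
  have "subspace ?G"
    unfolding subspace_def zero_prod_def
  proof (intro conjI ballI allI)
    show "(0, 0) \<in> ?G" using \<open>(0, 0) \<in> adjoint_graph x\<close> closed_dd_operatorD(1)[OF x] by auto
    show "u + v \<in> ?G" if uv: "u \<in> ?G" "v \<in> ?G" for u v
    proof -
      obtain \<xi> \<eta> \<zeta> \<xi>' \<eta>' \<zeta>' where "u = (\<xi>, \<eta>)" "v = (\<xi>', \<eta>')" "(\<xi>, \<eta>) \<in> x" "(\<xi>', \<eta>') \<in> x"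
        "(\<eta>, \<zeta>) \<in> adjoint_graph x" "(\<eta>', \<zeta>') \<in> adjoint_graph x" using uv by blast
      then show ?thesis
        using closed_dd_operatorD(2)[OF x, of \<xi> \<eta> \<xi>' \<eta>'] adjoint_graph_linear(1)[of \<eta> \<zeta> x \<eta>' \<zeta>'] by auto
    qed
    show "r *\<^sub>R u \<in> ?G" if u: "u \<in> ?G" for r u
    proof -
      obtain \<xi> \<eta> \<zeta> where "u = (\<xi>, \<eta>)" "(\<xi>, \<eta>) \<in> x" "(\<eta>, \<zeta>) \<in> adjoint_graph x" using u by blast
      then show ?thesis
        using closed_dd_operatorD(4)[OF x, of \<xi> \<eta> r] adjoint_graph_linear(3)[of \<eta> \<zeta> x \<eta> \<zeta> r] by auto
    qed
  qed
  then have "span ?G = ?G" by (simp add: span_eq_iff)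
  then have sub: "subspace (closure ?G)" using subspace_closure_span[of ?G] by metis
  obtain y where y: "y \<in> closure ?G" "\<forall>w\<in>closure ?G. inner (z - y) w = 0"
    using orthogonal_decomposition[OF sub closed_closure] by blast
  obtain \<alpha> \<beta> where \<alpha>\<beta>: "z - y = (\<alpha>, \<beta>)" by fastforce
  have "closure ?G \<subseteq> x" using closed_dd_operatorD(7)[OF x] by (intro closure_minimal) auto
  then have "(\<alpha>, \<beta>) \<in> x"
    using subspace_diff[OF subspace_closed_dd_operator[OF x] z, of y] y(1) \<alpha>\<beta> by auto
  obtain \<xi> \<eta> \<zeta> where s: "(\<xi>, \<eta>) \<in> x" "(\<eta>, \<zeta>) \<in> adjoint_graph x" "\<alpha> = \<xi> + \<zeta>"
    using one_plus_adjoint_square_surjective[OF x] by blast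
  have "(\<xi>, \<eta>) \<in> closure ?G" using s(1,2) by (intro subsetD[OF closure_subset]) auto
  then have "inner (z - y) (\<xi>, \<eta>) = 0" using y(2) by blast
  then have "inner (\<alpha>, \<beta>) (\<xi>, \<eta>) = 0" by (simp only: \<alpha>\<beta>)
  then have "inner \<alpha> \<xi> + inner \<alpha> \<zeta> = 0" using adjoint_graphD[OF s(2) \<open>(\<alpha>, \<beta>) \<in> x\<close>] by simp
  then have "inner \<alpha> \<alpha> = 0" by (simp add: s(3) inner_add_right)
  then have "\<alpha> = 0" by simp
  moreover have "\<beta> = 0"
    using closed_dd_operatorD(6)[OF x] closed_dd_operatorD(1)[OF x] \<open>(\<alpha>, \<beta>) \<in> x\<close> \<open>\<alpha> = 0\<close> by blast
  ultimately have "z = y" using \<alpha>\<beta> by (metis right_minus_eq zero_prod_def)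
  then show "z \<in> closure ?G" using y(1) by simp
qed

text \<open>On the domain of \<open>x\<^sup>*x = y\<^sup>*y\<close> both norms squared equal \<open>\<langle>x\<^sup>*x\<xi>, \<xi>\<rangle>\<close>. This domain is a core for
  \<open>x\<close>, and \<open>y\<close> is closed, so the equality extends. For \<open>y = |x|\<close> it transfers
  the estimates by the spectral measure from \<open>|x|\<close> to \<open>x\<close>.\<close>

lemma same_adjoint_square_imp_same_norm:
  assumes x: "closed_dd_operator x" and y: "closed_dd_operator y"
    and eq: "x O adjoint_graph x = y O adjoint_graph y" and \<xi>: "(\<xi>, \<eta>) \<in> x"
  shows "\<exists>\<eta>'. (\<xi>, \<eta>') \<in> y \<and> norm \<eta>' = norm \<eta>"
proof -
  have "(\<xi>, \<eta>) \<in> closure {(\<xi>, \<eta>). (\<xi>, \<eta>) \<in> x \<and> (\<exists>\<zeta>. (\<eta>, \<zeta>) \<in> adjoint_graph x)}"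
    using \<xi> domain_adjoint_square_core[OF x] by blast
  then obtain Z where Z: "\<And>n. Z n \<in> {(\<xi>, \<eta>). (\<xi>, \<eta>) \<in> x \<and> (\<exists>\<zeta>. (\<eta>, \<zeta>) \<in> adjoint_graph x)}" "Z \<longlonglongrightarrow> (\<xi>, \<eta>)"
    unfolding closure_sequential by blast
  define X Y where "X n = fst (Z n)" and "Y n = snd (Z n)" for n
  have XY: "(X n, Y n) \<in> x" "\<exists>\<zeta>. (Y n, \<zeta>) \<in> adjoint_graph x" for n
    using Z(1)[of n] by (auto simp: X_def Y_def case_prod_unfold)
  have lim: "X \<longlonglongrightarrow> \<xi>" "Y \<longlonglongrightarrow> \<eta>"
    unfolding X_def Y_def using tendsto_fst[OF Z(2)] tendsto_snd[OF Z(2)] by simp_all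
  obtain V where V: "\<And>n. (Y n, V n) \<in> adjoint_graph x" using XY(2) by metis
  have "(X n, V n) \<in> y O adjoint_graph y" for n unfolding eq[symmetric] using XY(1) V by blast
  then have "\<exists>w. (X n, w) \<in> y \<and> (w, V n) \<in> adjoint_graph y" for n by blast
  then obtain W where W: "\<And>n. (X n, W n) \<in> y" "\<And>n. (W n, V n) \<in> adjoint_graph y" by metis
  have norm_eq: "norm (W m - W n) = norm (Y m - Y n)" for m n
  proof -
    have "inner (W m - W n) (W m - W n) = inner (X m - X n) (V m - V n)"
      using W by (intro adjoint_graphD[of _ _ y] adjoint_graph_linear(4) closed_dd_operatorD(5)[OF y])
    also have "\<dots> = inner (Y m - Y n) (Y m - Y n)"
      using XY V by (intro adjoint_graphD[of _ _ x, symmetric] adjoint_graph_linear(4) closed_dd_operatorD(5)[OF x])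
    finally show ?thesis by (simp add: norm_eq_sqrt_inner)
  qed
  have norm_eq': "norm (W n) = norm (Y n)" for n
  proof -
    have "inner (W n) (W n) = inner (X n) (V n)" using W by (intro adjoint_graphD)
    also have "\<dots> = inner (Y n) (Y n)" using XY V by (intro adjoint_graphD[symmetric])
    finally show ?thesis by (simp add: norm_eq_sqrt_inner)
  qed
  have "Cauchy Y" using lim(2) by (rule LIMSEQ_imp_Cauchy)
  then have "Cauchy W" by (simp add: Cauchy_iff norm_eq)
  then obtain \<eta>' where \<eta>': "W \<longlonglongrightarrow> \<eta>'" using Cauchy_convergent convergent_def by blast
  have "(\<lambda>n. (X n, W n)) \<longlonglongrightarrow> (\<xi>, \<eta>')" using lim(1) \<eta>' by (rule tendsto_Pair)
  then have "(\<xi>, \<eta>') \<in> y" using closed_sequentially[OF closed_dd_operatorD(7)[OF y], of "\<lambda>n. (X n, W n)"] W(1) by simp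
  moreover have "norm \<eta>' = norm \<eta>"
    using tendsto_norm[OF \<eta>'] tendsto_norm[OF lim(2)] unfolding norm_eq' by (rule LIMSEQ_unique)
  ultimately show ?thesis by blast
qed

section \<open>Spectral subspaces\<close>

context
  fixes P :: "real set \<Rightarrow> 'h::complex_hilbert_space \<Rightarrow>\<^sub>L 'h"
  assumes P: "projection_valued_measure P"
begin

lemma pvm_projection: "B \<in> sets borel \<Longrightarrow> projection_op (P B)"
  using P by (simp add: projection_valued_measure_def)

lemma pvm_UNIV [simp]: "P UNIV \<xi> = \<xi>"
  using P by (simp add: projection_valued_measure_def)

lemma pvm_sums: "range B \<subseteq> sets borel \<Longrightarrow> disjoint_family B \<Longrightarrow> (\<lambda>n. P (B n) \<xi>) sums P (\<Union>n. B n) \<xi>" for B :: "nat \<Rightarrow> real set"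
  using P unfolding projection_valued_measure_def by blast

lemma pvm_empty: "P {} \<xi> = 0"
proof -
  have "(\<lambda>n::nat. P {} \<xi>) sums P (\<Union>n::nat. {}) \<xi>"
    by (rule pvm_sums) (auto simp: disjoint_family_on_def)
  then show ?thesis using summable_const_iff sums_summable by blast
qed

lemma pvm_Un:
  assumes "A \<in> sets borel" "B \<in> sets borel" "A \<inter> B = {}"
  shows "P (A \<union> B) \<xi> = P A \<xi> + P B \<xi>"
proof -
  have "(\<lambda>n. P (binaryset A B n) \<xi>) sums P (\<Union>n. binaryset A B n) \<xi>"
    using assms by (intro pvm_sums) (auto simp: range_binaryset_eq disjoint_family_on_def binaryset_def)
  moreover have "(\<lambda>n. P (binaryset A B n) \<xi>) sums (P A \<xi> + P B \<xi>)"
    by (rule binaryset_sums) (rule pvm_empty)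
  ultimately show ?thesis by (simp add: UN_binaryset_eq sums_unique2)
qed

text \<open>Multiplicativity is a consequence of additivity: for \<open>\<zeta>\<close> in the range of \<open>P(A)\<close>,
  \<open>\<parallel>\<zeta>\<parallel>\<^sup>2 + \<parallel>P(B)\<zeta>\<parallel>\<^sup>2 = \<parallel>P(A \<union> B)\<zeta>\<parallel>\<^sup>2 \<le> \<parallel>\<zeta>\<parallel>\<^sup>2\<close>.\<close>

lemma pvm_disjoint:
  assumes AB: "A \<in> sets borel" "B \<in> sets borel" "A \<inter> B = {}"
  shows "P B (P A \<xi>) = 0"
proof -
  note pr = pvm_projection[OF AB(1)] pvm_projection[OF AB(2)]
  have AuB: "A \<union> B \<in> sets borel" using AB by simp
  define \<zeta> where "\<zeta> = P A \<xi>"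
  have \<zeta>: "P A \<zeta> = \<zeta>" unfolding \<zeta>_def by (rule projection_opD(1)[OF pr(1)])
  have "(norm \<zeta>)\<^sup>2 + (norm (P B \<zeta>))\<^sup>2 = inner (P (A \<union> B) \<zeta>) \<zeta>"
    using projection_opD(3)[OF pr(1), of \<zeta>] projection_opD(3)[OF pr(2), of \<zeta>]
    by (simp add: pvm_Un[OF AB] inner_add_left \<zeta>)
  also have "\<dots> \<le> (norm \<zeta>)\<^sup>2"
    unfolding projection_opD(3)[OF pvm_projection[OF AuB], symmetric]
    using projection_opD(4)[OF pvm_projection[OF AuB]] by (simp add: power_mono)
  finally have "(norm (P B \<zeta>))\<^sup>2 \<le> 0" by simp
  then show ?thesis by (simp add: \<zeta>_def)
qed

lemma pvm_Int:
  assumes AB: "A \<in> sets borel" "B \<in> sets borel"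
  shows "P A (P B \<xi>) = P (A \<inter> B) \<xi>"
proof -
  have s: "A \<inter> B \<in> sets borel" "B - A \<in> sets borel" "A - B \<in> sets borel" using AB by auto
  have "P B \<xi> = P (A \<inter> B) \<xi> + P (B - A) \<xi>"
  proof -
    have "B = (A \<inter> B) \<union> (B - A)" by blast
    moreover have "(A \<inter> B) \<inter> (B - A) = {}" by blast
    ultimately show ?thesis using pvm_Un[OF s(1,2), of \<xi>] by simp
  qed
  then have "P A (P B \<xi>) = P A (P (A \<inter> B) \<xi>) + P A (P (B - A) \<xi>)" by (simp add: blinfun.add_right)
  also have "P A (P (B - A) \<xi>) = 0" using AB s by (intro pvm_disjoint) auto
  also have "P A (P (A \<inter> B) \<xi>) = P (A \<inter> B) (P (A \<inter> B) \<xi>) + P (A - B) (P (A \<inter> B) \<xi>)"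
  proof -
    have "A = (A \<inter> B) \<union> (A - B)" by blast
    moreover have "(A \<inter> B) \<inter> (A - B) = {}" by blast
    ultimately show ?thesis using pvm_Un[OF s(1,3), of "P (A \<inter> B) \<xi>"] by simp
  qed
  also have "P (A - B) (P (A \<inter> B) \<xi>) = 0" using AB s by (intro pvm_disjoint) auto
  also have "P (A \<inter> B) (P (A \<inter> B) \<xi>) = P (A \<inter> B) \<xi>" using projection_opD(1)[OF pvm_projection[OF s(1)]] .
  finally show ?thesis by simp
qed

lemma sets_scalar_measure [simp, measurable_cong]: "sets (scalar_measure P \<xi>) = sets borel"
  unfolding scalar_measure_def
  using sets.sigma_sets_eq[of "borel :: real measure"] by (simp add: sets_measure_of_conv)

lemma space_scalar_measure [simp]: "space (scalar_measure P \<xi>) = UNIV"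
  using sets_eq_imp_space_eq[OF sets_scalar_measure] by simp

lemma emeasure_scalar_measure:
  assumes "B \<in> sets borel"
  shows "emeasure (scalar_measure P \<xi>) B = ennreal ((norm (P B \<xi>))\<^sup>2)"
  unfolding scalar_measure_def
proof (rule emeasure_measure_of_sigma)
  show "sigma_algebra UNIV (sets (borel :: real measure))"
    using sets.sigma_algebra_axioms[of "borel :: real measure"] by simp
  show "positive (sets borel) (\<lambda>B. ennreal ((norm (P B \<xi>))\<^sup>2))"
    by (simp add: positive_def pvm_empty)
  show "countably_additive (sets borel) (\<lambda>B. ennreal ((norm (P B \<xi>))\<^sup>2))"
  proof (rule countably_additiveI)
    fix A :: "nat \<Rightarrow> real set"
    assume A: "range A \<subseteq> sets borel" "disjoint_family A" "(\<Union>i. A i) \<in> sets borel"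
    have "(\<lambda>n. inner (P (A n) \<xi>) \<xi>) sums inner (P (\<Union>i. A i) \<xi>) \<xi>"
      using pvm_sums[OF A(1,2)] by (rule bounded_linear.sums[OF bounded_linear_inner_left])
    then have "(\<lambda>n. (norm (P (A n) \<xi>))\<^sup>2) sums (norm (P (\<Union>i. A i) \<xi>))\<^sup>2"
      using A projection_opD(3)[OF pvm_projection] by (simp add: range_subsetD)
    then show "(\<Sum>i. ennreal ((norm (P (A i) \<xi>))\<^sup>2)) = ennreal ((norm (P (\<Union>i. A i) \<xi>))\<^sup>2)"
      by (intro suminf_ennreal_eq) auto
  qed
qed fact

lemma finite_scalar_measure: "finite_measure (scalar_measure P \<xi>)"
  by (rule finite_measureI) (simp add: emeasure_scalar_measure)

lemma measure_scalar_measure_UNIV: "measure (scalar_measure P \<xi>) UNIV = (norm \<xi>)\<^sup>2"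
  by (simp add: measure_def emeasure_scalar_measure)

lemma scalar_measure_restrict:
  assumes "C \<in> sets borel"
  shows "scalar_measure P (P C \<xi>) = density (scalar_measure P \<xi>) (indicator C)"
proof (rule measure_eqI)
  fix B assume "B \<in> sets (scalar_measure P (P C \<xi>))"
  then have B: "B \<in> sets borel" by simp
  then show "emeasure (scalar_measure P (P C \<xi>)) B = emeasure (density (scalar_measure P \<xi>) (indicator C)) B"
    using assms by (simp add: emeasure_restricted emeasure_scalar_measure pvm_Int Int_commute)
qed simp

lemma AE_scalar_measure:
  assumes "C \<in> sets borel" "P C \<xi> = \<xi>"
  shows "AE t in scalar_measure P \<xi>. t \<in> C"
proof -
  have "AE t in density (scalar_measure P \<xi>) (indicator C). t \<in> C"
    using assms(1) by (subst AE_density) (auto simp: indicator_def)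
  moreover have "scalar_measure P \<xi> = density (scalar_measure P \<xi>) (indicator C)"
    using scalar_measure_restrict[OF assms(1), of \<xi>] assms(2) by simp
  ultimately show ?thesis by metis
qed

lemma nn_square_finite_bounded:
  assumes "AE t in scalar_measure P \<xi>. \<bar>t\<bar> \<le> c"
  shows "(\<integral>\<^sup>+t. ennreal (t\<^sup>2) \<partial>scalar_measure P \<xi>) < \<infinity>"
proof -
  have "(\<integral>\<^sup>+t. ennreal (t\<^sup>2) \<partial>scalar_measure P \<xi>) \<le> (\<integral>\<^sup>+t. ennreal (c\<^sup>2) \<partial>scalar_measure P \<xi>)"
    using assms by (intro nn_integral_mono_AE) (auto elim!: eventually_mono intro!: ennreal_leI simp: abs_le_square_iff[symmetric])
  also have "\<dots> < \<infinity>"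
    by (simp add: emeasure_scalar_measure ennreal_mult_less_top)
  finally show ?thesis .
qed

lemma integrable_scalar_measure:
  assumes "(\<integral>\<^sup>+t. ennreal (t\<^sup>2) \<partial>scalar_measure P \<xi>) < \<infinity>"
  shows "integrable (scalar_measure P \<xi>) (\<lambda>t. t)"
proof -
  interpret finite_measure "scalar_measure P \<xi>" by (rule finite_scalar_measure)
  have "integrable (scalar_measure P \<xi>) (\<lambda>t. t\<^sup>2)"
    using assms by (intro integrableI_nonneg) auto
  then have "integrable (scalar_measure P \<xi>) (\<lambda>t. t\<^sup>2 + 1)" by simp
  then show ?thesis
  proof (rule Bochner_Integration.integrable_bound)
    have "\<bar>t\<bar> \<le> t\<^sup>2 + 1" for t :: real
    proof -
      have "0 \<le> (\<bar>t\<bar> - 1)\<^sup>2" "0 \<le> \<bar>t\<bar>" by simp_all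
      then show ?thesis by (simp add: power2_diff)
    qed
    then show "AE t in scalar_measure P \<xi>. norm t \<le> norm (t\<^sup>2 + 1)" by simp
  qed simp
qed

lemma integral_scalar_measure_restrict:
  assumes "C \<in> sets borel"
  shows "(\<integral>t. t \<partial>scalar_measure P (P C \<xi>)) = (\<integral>t. indicator C t * t \<partial>scalar_measure P \<xi>)"
proof -
  have "(\<integral>t. t \<partial>density (scalar_measure P \<xi>) (\<lambda>t. ennreal (indicator C t))) = (\<integral>t. indicator C t *\<^sub>R t \<partial>scalar_measure P \<xi>)"
    using assms by (intro integral_density) auto
  then show ?thesis by (simp add: scalar_measure_restrict[OF assms] ennreal_indicator)
qed

end

context
  fixes a :: "'h::complex_hilbert_space graph" and P :: "real set \<Rightarrow> 'h \<Rightarrow>\<^sub>L 'h"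
  assumes a: "closed_dd_operator a" and selfadj: "adjoint_graph a = a"
    and pos: "\<forall>(\<xi>, \<eta>)\<in>a. cinner \<eta> \<xi> \<in> \<real>\<^sub>\<ge>\<^sub>0" and spec: "is_spectral_measure a P"
begin

lemma spectral_measure_pvm: "projection_valued_measure P" using spec by (simp add: is_spectral_measure_def)

lemma spectral_inner: "(\<xi>, \<eta>) \<in> a \<Longrightarrow> inner \<eta> \<xi> = (\<integral>t. t \<partial>scalar_measure P \<xi>)"
  using spec by (auto simp: is_spectral_measure_def inner_Re_cinner)

lemma spectral_domain: "\<xi> \<in> Domain a \<longleftrightarrow> (\<integral>\<^sup>+t. ennreal (t\<^sup>2) \<partial>scalar_measure P \<xi>) < \<infinity>"
  using spec by (auto simp: is_spectral_measure_def)

lemma spectral_integrable: "(\<xi>, \<eta>) \<in> a \<Longrightarrow> integrable (scalar_measure P \<xi>) (\<lambda>t. t)"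
  using spectral_domain by (intro integrable_scalar_measure[OF spectral_measure_pvm]) blast

lemma graph_nonneg: "(\<xi>, \<eta>) \<in> a \<Longrightarrow> 0 \<le> inner \<eta> \<xi>"
  using pos by (auto simp: complex_nonneg_Reals_iff inner_Re_cinner)

lemma graph_symmetric: "(\<xi>, \<eta>) \<in> a \<Longrightarrow> (\<xi>', \<eta>') \<in> a \<Longrightarrow> inner \<eta>' \<xi> = inner \<xi>' \<eta>"
  using adjoint_graphD[of \<xi> \<eta> a \<xi>' \<eta>'] by (simp add: selfadj)

lemma norm_lower_bound_on_spectral_subspace:
  assumes \<xi>: "P {s<..} \<xi> = \<xi>" "(\<xi>, \<eta>) \<in> a"
  shows "s * norm \<xi> \<le> norm \<eta>"
proof -
  interpret finite_measure "scalar_measure P \<xi>" by (rule finite_scalar_measure[OF spectral_measure_pvm])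
  have "AE t in scalar_measure P \<xi>. t \<in> {s<..}" using \<xi>(1) by (intro AE_scalar_measure[OF spectral_measure_pvm]) auto
  then have "AE t in scalar_measure P \<xi>. s \<le> t" by (auto elim!: eventually_mono)
  then have "(\<integral>t. s \<partial>scalar_measure P \<xi>) \<le> (\<integral>t. t \<partial>scalar_measure P \<xi>)"
    using spectral_integrable[OF \<xi>(2)] by (intro integral_mono_AE) auto
  then have "s * (norm \<xi>)\<^sup>2 \<le> inner \<eta> \<xi>"
    by (simp add: spectral_inner[OF \<xi>(2)] measure_scalar_measure_UNIV[OF spectral_measure_pvm] space_scalar_measure[OF spectral_measure_pvm] mult.commute)
  also have "\<dots> \<le> norm \<eta> * norm \<xi>" by (rule norm_cauchy_schwarz)
  finally show ?thesis by (cases "\<xi> = 0") (auto simp: power2_eq_square)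
qed

text \<open>A vector of \<open>P([-n-1,-n))\<close> lies in the domain of \<open>a\<close> and has
  \<open>\<langle>a\<xi>, \<xi>\<rangle> = \<integral>t d\<langle>P\<xi>, \<xi>\<rangle> \<ge> 0\<close>, although the integrand is negative almost everywhere.\<close>

lemma spectral_measure_negative: "P {..<0} \<zeta> = 0"
proof -
  define B where "B n = {- (real n + 1)..<- real n}" for n
  have B: "B n \<in> sets borel" for n by (simp add: B_def)
  have zero: "P (B n) \<zeta> = 0" for n
  proof -
    define \<xi> where "\<xi> = P (B n) \<zeta>"
    have "P (B n) \<xi> = \<xi>" unfolding \<xi>_def by (rule projection_opD(1)[OF pvm_projection[OF spectral_measure_pvm B]])
    then have AE: "AE t in scalar_measure P \<xi>. t \<in> B n" by (rule AE_scalar_measure[OF spectral_measure_pvm B])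
    then have "AE t in scalar_measure P \<xi>. \<bar>t\<bar> \<le> real n + 1" by eventually_elim (auto simp: B_def)
    then have "\<xi> \<in> Domain a" unfolding spectral_domain by (rule nn_square_finite_bounded[OF spectral_measure_pvm])
    then obtain \<eta> where \<eta>: "(\<xi>, \<eta>) \<in> a" by blast
    have int: "integrable (scalar_measure P \<xi>) (\<lambda>t. - t)" using spectral_integrable[OF \<eta>] by simp
    have nn: "AE t in scalar_measure P \<xi>. 0 \<le> - t" using AE by eventually_elim (auto simp: B_def)
    have "(\<integral>t. - t \<partial>scalar_measure P \<xi>) \<le> 0" using graph_nonneg[OF \<eta>] spectral_inner[OF \<eta>] by simp
    moreover have "0 \<le> (\<integral>t. - t \<partial>scalar_measure P \<xi>)" using nn by (rule integral_nonneg_AE)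
    ultimately have "(\<integral>t. - t \<partial>scalar_measure P \<xi>) = 0" by linarith
    then have "AE t in scalar_measure P \<xi>. - t = 0" using integral_nonneg_eq_0_iff_AE[OF int nn] by blast
    then have "AE t in scalar_measure P \<xi>. False" using AE by eventually_elim (auto simp: B_def)
    then have "emeasure (scalar_measure P \<xi>) UNIV = 0"
      by (simp add: eventually_False ae_filter_eq_bot_iff space_scalar_measure[OF spectral_measure_pvm])
    then show ?thesis by (simp add: emeasure_scalar_measure[OF spectral_measure_pvm] pvm_UNIV[OF spectral_measure_pvm] flip: \<xi>_def)
  qed
  have "(\<Union>n. B n) = {..<0}"
  proof (intro equalityI subsetI)
    fix t :: real assume "t \<in> {..<0}"
    then have t: "t < 0" by simp
    define n where "n = nat (\<lceil>- t\<rceil> - 1)"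
    have "real n = real_of_int \<lceil>- t\<rceil> - 1" using t by (simp add: n_def)
    then have "t \<in> B n" by (simp add: B_def) linarith
    then show "t \<in> (\<Union>n. B n)" by blast
  qed (auto simp: B_def)
  moreover have "disjoint_family B"
    unfolding disjoint_family_on_def
  proof (intro ballI impI)
    fix m n :: nat assume "m \<noteq> n"
    then have "real m + 1 \<le> real n \<or> real n + 1 \<le> real m" by linarith
    then show "B m \<inter> B n = {}" by (auto simp: B_def)
  qed
  moreover have "range B \<subseteq> sets borel" using B by blast
  ultimately have "(\<lambda>n. P (B n) \<zeta>) sums P {..<0} \<zeta>" using pvm_sums[OF spectral_measure_pvm] by metis
  then have "(\<lambda>n. 0) sums P {..<0} \<zeta>" unfolding zero .
  then show ?thesis by (simp add: sums_unique2 sums_zero)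
qed

text \<open>The spectral measure determines \<open>a\<close> only through its quadratic form, so invariance of the
  spectral subspaces under \<open>a\<close> is not immediate. It comes from additivity of the form: the
  measure of \<open>\<xi> + \<xi>'\<close> restricts to that of \<open>\<xi>\<close> on \<open>C\<close> and to that of \<open>\<xi>'\<close> off \<open>C\<close>, so that
  the mixed terms cancel.\<close>

lemma spectral_subspaces_orthogonal:
  assumes C: "C \<in> sets borel" and \<xi>: "(\<xi>, \<eta>) \<in> a" "P C \<xi> = \<xi>" and \<xi>': "(\<xi>', \<eta>') \<in> a" "P C \<xi>' = 0"
  shows "inner \<eta> \<xi>' = 0"
proof -
  let ?\<mu> = "scalar_measure P (\<xi> + \<xi>')"
  have sum: "(\<xi> + \<xi>', \<eta> + \<eta>') \<in> a" using \<xi>(1) \<xi>'(1) by (rule closed_dd_operatorD(2)[OF a])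
  note int = spectral_integrable[OF sum]
  have nC: "- C \<in> sets borel" using C by (simp add: borel_comp)
  have PC: "P C (\<xi> + \<xi>') = \<xi>" using \<xi>(2) \<xi>'(2) by (simp add: blinfun.add_right)
  have "P (C \<union> - C) (\<xi> + \<xi>') = P C (\<xi> + \<xi>') + P (- C) (\<xi> + \<xi>')"
    by (rule pvm_Un[OF spectral_measure_pvm C nC]) simp
  then have PnC: "P (- C) (\<xi> + \<xi>') = \<xi>'" by (simp add: PC pvm_UNIV[OF spectral_measure_pvm])
  have "inner \<eta> \<xi> + inner \<eta>' \<xi>' = (\<integral>t. indicator C t * t \<partial>?\<mu>) + (\<integral>t. indicator (- C) t * t \<partial>?\<mu>)"
    unfolding spectral_inner[OF \<xi>(1)] spectral_inner[OF \<xi>'(1)]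
    unfolding integral_scalar_measure_restrict[OF spectral_measure_pvm C, symmetric] integral_scalar_measure_restrict[OF spectral_measure_pvm nC, symmetric] PC PnC ..
  also have "\<dots> = (\<integral>t. indicator C t * t + indicator (- C) t * t \<partial>?\<mu>)"
    using integrable_mult_indicator[of C ?\<mu> "\<lambda>t. t"] integrable_mult_indicator[of "- C" ?\<mu> "\<lambda>t. t"] int C nC
    by (intro Bochner_Integration.integral_add[symmetric]) (simp_all add: sets_scalar_measure[OF spectral_measure_pvm])
  also have "\<dots> = (\<integral>t. t \<partial>?\<mu>)" by (rule Bochner_Integration.integral_cong) (auto simp: indicator_def)
  also have "\<dots> = inner (\<eta> + \<eta>') (\<xi> + \<xi>')" by (rule spectral_inner[OF sum, symmetric])
  finally have "inner \<eta> \<xi>' + inner \<eta>' \<xi> = 0" by (simp add: inner_add_left inner_add_right)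
  moreover have "inner \<eta>' \<xi> = inner \<eta> \<xi>'" using graph_symmetric[OF \<xi>(1) \<xi>'(1)] by (simp add: inner_commute)
  ultimately show ?thesis by simp
qed

text \<open>On the range of \<open>P((-\<infinity>,s])\<close> the form of \<open>a\<close> lies between \<open>0\<close> and \<open>s\<parallel>\<cdot>\<parallel>\<^sup>2\<close>. Polarization and the
  parallelogram law bound \<open>\<langle>a\<xi>, \<zeta>\<rangle>\<close> by \<open>s/2 (\<parallel>\<xi>\<parallel>\<^sup>2 + \<parallel>\<zeta>\<parallel>\<^sup>2)\<close> for \<open>\<zeta>\<close> in this range, the preceding
  lemma extends the bound to the domain of \<open>a\<close>, and density extends it to all \<open>\<zeta>\<close>. Then \<open>\<zeta>\<close> may be chosen
  parallel to \<open>a\<xi>\<close> with \<open>\<parallel>\<zeta>\<parallel> = \<parallel>\<xi>\<parallel>\<close>.\<close>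

lemma norm_upper_bound_on_spectral_subspace:
  assumes s: "0 \<le> s" and \<xi>: "P {..s} \<xi> = \<xi>"
  shows "\<exists>\<eta>. (\<xi>, \<eta>) \<in> a \<and> norm \<eta> \<le> s * norm \<xi>"
proof -
  have C: "{..s} \<in> sets borel" by simp
  have bounds: "\<exists>\<eta>. (\<zeta>, \<eta>) \<in> a \<and> inner \<eta> \<zeta> \<le> s * (norm \<zeta>)\<^sup>2" if \<zeta>: "P {..s} \<zeta> = \<zeta>" for \<zeta>
  proof -
    interpret finite_measure "scalar_measure P \<zeta>" by (rule finite_scalar_measure[OF spectral_measure_pvm])
    have "P ({..<0} \<union> {0..s}) \<zeta> = P {..<0} \<zeta> + P {0..s} \<zeta>" by (rule pvm_Un[OF spectral_measure_pvm]) auto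
    moreover have "{..<0} \<union> {0..s} = {..s}" using s by auto
    ultimately have "P {0..s} \<zeta> = \<zeta>" using \<zeta> by (simp add: spectral_measure_negative)
    then have "AE t in scalar_measure P \<zeta>. t \<in> {0..s}" by (intro AE_scalar_measure[OF spectral_measure_pvm]) auto
    then have AE: "AE t in scalar_measure P \<zeta>. \<bar>t\<bar> \<le> s" by eventually_elim auto
    then have "\<zeta> \<in> Domain a" unfolding spectral_domain by (rule nn_square_finite_bounded[OF spectral_measure_pvm])
    then obtain \<eta> where \<eta>: "(\<zeta>, \<eta>) \<in> a" by blast
    have "(\<integral>t. t \<partial>scalar_measure P \<zeta>) \<le> (\<integral>t. s \<partial>scalar_measure P \<zeta>)"
      using spectral_integrable[OF \<eta>] AE by (intro integral_mono_AE) (auto elim!: eventually_mono)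
    then have "inner \<eta> \<zeta> \<le> s * (norm \<zeta>)\<^sup>2"
      by (simp add: spectral_inner[OF \<eta>] measure_scalar_measure_UNIV[OF spectral_measure_pvm] space_scalar_measure[OF spectral_measure_pvm] mult.commute)
    with \<eta> show ?thesis by blast
  qed
  obtain \<eta> where \<eta>: "(\<xi>, \<eta>) \<in> a" using bounds[OF \<xi>] by blast
  have "Domain a \<subseteq> {\<zeta>. inner \<eta> \<zeta> \<le> s / 2 * ((norm \<xi>)\<^sup>2 + (norm \<zeta>)\<^sup>2)}"
  proof (safe)
    fix \<zeta> \<theta> assume \<zeta>: "(\<zeta>, \<theta>) \<in> a"
    define \<zeta>1 where "\<zeta>1 = P {..s} \<zeta>"
    have P1: "P {..s} \<zeta>1 = \<zeta>1" unfolding \<zeta>1_def by (rule projection_opD(1)[OF pvm_projection[OF spectral_measure_pvm C]])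
    then obtain \<theta>1 where \<theta>1: "(\<zeta>1, \<theta>1) \<in> a" using bounds by blast
    have "inner \<eta> (\<zeta> - \<zeta>1) = 0"
      by (rule spectral_subspaces_orthogonal[OF C \<eta> \<xi> closed_dd_operatorD(5)[OF a \<zeta> \<theta>1]])
        (simp add: blinfun.diff_right P1, simp add: \<zeta>1_def)
    then have "4 * inner \<eta> \<zeta> = 4 * inner \<eta> \<zeta>1" by (simp add: inner_diff_right)
    also have "\<dots> = inner (\<eta> + \<theta>1) (\<xi> + \<zeta>1) - inner (\<eta> - \<theta>1) (\<xi> - \<zeta>1)"
      using graph_symmetric[OF \<eta> \<theta>1] by (simp add: inner_simps inner_commute)
    also have "\<dots> \<le> inner (\<eta> + \<theta>1) (\<xi> + \<zeta>1)"
      using graph_nonneg[OF closed_dd_operatorD(5)[OF a \<eta> \<theta>1]] by simp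
    also have "\<dots> \<le> s * (norm (\<xi> + \<zeta>1))\<^sup>2"
    proof -
      have "P {..s} (\<xi> + \<zeta>1) = \<xi> + \<zeta>1" by (simp add: blinfun.add_right \<xi> P1)
      then obtain \<kappa> where \<kappa>: "(\<xi> + \<zeta>1, \<kappa>) \<in> a" "inner \<kappa> (\<xi> + \<zeta>1) \<le> s * (norm (\<xi> + \<zeta>1))\<^sup>2"
        using bounds by blast
      then have "\<kappa> = \<eta> + \<theta>1"
        using closed_dd_operatorD(6)[OF a] closed_dd_operatorD(2)[OF a \<eta> \<theta>1] by blast
      with \<kappa>(2) show ?thesis by simp
    qed
    also have "\<dots> \<le> s * (2 * (norm \<xi>)\<^sup>2 + 2 * (norm \<zeta>1)\<^sup>2)"
    proof (rule mult_left_mono[OF _ s])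
      have "0 \<le> (norm (\<xi> - \<zeta>1))\<^sup>2" by simp
      then show "(norm (\<xi> + \<zeta>1))\<^sup>2 \<le> 2 * (norm \<xi>)\<^sup>2 + 2 * (norm \<zeta>1)\<^sup>2"
        unfolding power2_norm_eq_inner by (simp add: inner_simps inner_commute)
    qed
    also have "\<dots> \<le> s * (2 * (norm \<xi>)\<^sup>2 + 2 * (norm \<zeta>)\<^sup>2)"
      using s projection_opD(4)[OF pvm_projection[OF spectral_measure_pvm C], of \<zeta>]
      by (intro mult_left_mono add_left_mono power_mono) (auto simp: \<zeta>1_def)
    finally show "inner \<eta> \<zeta> \<le> s / 2 * ((norm \<xi>)\<^sup>2 + (norm \<zeta>)\<^sup>2)" by (simp add: algebra_simps)
  qed
  then have "closure (Domain a) \<subseteq> {\<zeta>. inner \<eta> \<zeta> \<le> s / 2 * ((norm \<xi>)\<^sup>2 + (norm \<zeta>)\<^sup>2)}"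
    by (rule closure_minimal) (intro closed_Collect_le continuous_intros)
  then have all: "inner \<eta> \<zeta> \<le> s / 2 * ((norm \<xi>)\<^sup>2 + (norm \<zeta>)\<^sup>2)" for \<zeta>
    unfolding closed_dd_operatorD(8)[OF a] by blast
  have "norm \<eta> \<le> s * norm \<xi>"
  proof (cases "\<xi> = 0 \<or> \<eta> = 0")
    case True
    then have "\<eta> = 0" using closed_dd_operatorD(6)[OF a \<eta>] closed_dd_operatorD(1)[OF a] by blast
    then show ?thesis using s by simp
  next
    case False
    have "norm \<xi> * norm \<eta> = inner \<eta> ((norm \<xi> / norm \<eta>) *\<^sub>R \<eta>)"
      using False by (simp add: power2_norm_eq_inner[symmetric] power2_eq_square)
    also have "\<dots> \<le> s / 2 * ((norm \<xi>)\<^sup>2 + (norm ((norm \<xi> / norm \<eta>) *\<^sub>R \<eta>))\<^sup>2)" by (rule all)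
    also have "norm ((norm \<xi> / norm \<eta>) *\<^sub>R \<eta>) = norm \<xi>" using False by simp
    finally have "norm \<xi> * norm \<eta> \<le> norm \<xi> * (s * norm \<xi>)" by (simp add: power2_eq_square algebra_simps)
    then show ?thesis using False by simp
  qed
  with \<eta> show ?thesis by blast
qed

end

section \<open>Singular values\<close>

text \<open>The properties of the spectral projections \<open>g s\<close> of \<open>|x|\<close> for \<open>(s,\<infinity>)\<close> from which all
  statements about singular values are derived.\<close>

lemma measurable_op_spectral_projections:
  assumes x: "x \<in> measurable_ops M \<tau>" and M: "von_neumann_algebra M"
  obtains g :: "real \<Rightarrow> 'h::complex_hilbert_space \<Rightarrow>\<^sub>L 'h"
  where "\<And>s. s > 0 \<Longrightarrow> g s \<in> projections M"
    and "\<And>s \<xi> \<eta>. g s \<xi> = \<xi> \<Longrightarrow> (\<xi>, \<eta>) \<in> x \<Longrightarrow> s * norm \<xi> \<le> norm \<eta>"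
    and "\<And>s \<xi>. s > 0 \<Longrightarrow> g s \<xi> = 0 \<Longrightarrow> \<exists>\<eta>. (\<xi>, \<eta>) \<in> x \<and> norm \<eta> \<le> s * norm \<xi>"
proof -
  obtain a P where xc: "closed_dd_operator x" and ab: "is_absolute_value x a"
    and sp: "is_spectral_measure a P" and PM: "\<And>s. s > 0 \<Longrightarrow> P {s<..} \<in> M"
    using x by (auto simp: measurable_ops_def)
  have ac: "closed_dd_operator a" and sa: "adjoint_graph a = a"
    and ap: "\<forall>(\<xi>, \<eta>)\<in>a. cinner \<eta> \<xi> \<in> \<real>\<^sub>\<ge>\<^sub>0" and sq: "a O a = x O adjoint_graph x"
    using ab by (auto simp: is_absolute_value_def)
  have sq': "a O adjoint_graph a = x O adjoint_graph x" unfolding sa by (rule sq)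
  note P = spectral_measure_pvm[OF ac sa ap sp]
  show ?thesis
  proof (rule that[of "\<lambda>s. P {s<..}"])
    show "P {s<..} \<in> projections M" if "s > 0" for s
      using PM[OF that] pvm_projection[OF P, of "{s<..}"] by (simp add: projections_def)
    show "s * norm \<xi> \<le> norm \<eta>" if "P {s<..} \<xi> = \<xi>" "(\<xi>, \<eta>) \<in> x" for s \<xi> \<eta>
    proof -
      obtain \<eta>' where "(\<xi>, \<eta>') \<in> a" "norm \<eta>' = norm \<eta>"
        using same_adjoint_square_imp_same_norm[OF xc ac sq'[symmetric] \<open>(\<xi>, \<eta>) \<in> x\<close>] by blast
      then show ?thesis using norm_lower_bound_on_spectral_subspace[OF ac sa ap sp] that(1) by metis
    qed
    show "\<exists>\<eta>. (\<xi>, \<eta>) \<in> x \<and> norm \<eta> \<le> s * norm \<xi>" if s: "s > 0" "P {s<..} \<xi> = 0" for s \<xi>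
    proof -
      have "P ({..s} \<union> {s<..}) \<xi> = P {..s} \<xi> + P {s<..} \<xi>" by (rule pvm_Un[OF P]) auto
      moreover have "{..s} \<union> {s<..} = UNIV" by auto
      ultimately have "P {..s} \<xi> = \<xi>" using s(2) by (simp add: pvm_UNIV[OF P])
      then obtain \<eta>' where \<eta>': "(\<xi>, \<eta>') \<in> a" "norm \<eta>' \<le> s * norm \<xi>"
        using norm_upper_bound_on_spectral_subspace[OF ac sa ap sp, of s \<xi>] s(1) by auto
      then show ?thesis
        using same_adjoint_square_imp_same_norm[OF ac xc sq' \<eta>'(1)] by metis
    qed
  qed
qed

lemma singular_value_leI:
  assumes "r \<in> projections M" "\<tau> (id_blinfun - r) \<le> ennreal t" "0 \<le> s"
    and x: "\<And>\<xi> \<eta>. (\<xi>, \<eta>) \<in> x \<Longrightarrow> r \<xi> = \<xi> \<Longrightarrow> norm \<eta> \<le> s * norm \<xi>" "\<And>\<xi>. r \<xi> = \<xi> \<Longrightarrow> \<xi> \<in> Domain x"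
  shows "singular_value M \<tau> t x \<le> ennreal s"
proof -
  have pr: "projection_op r" using assms(1) by (simp add: projections_def)
  have "Domain (op_graph r O x) = UNIV"
  proof safe
    fix \<xi> :: 'a
    obtain \<eta> where "(r \<xi>, \<eta>) \<in> x" using x(2)[of "r \<xi>"] projection_opD(1)[OF pr] by blast
    then show "\<xi> \<in> Domain (op_graph r O x)" by (auto simp: op_graph_def)
  qed simp
  moreover have "norm \<eta> \<le> s" if \<xi>: "(\<xi>, \<eta>) \<in> op_graph r O x" "norm \<xi> \<le> 1" for \<xi> \<eta>
  proof -
    have "(r \<xi>, \<eta>) \<in> x" using \<xi>(1) by (auto simp: op_graph_def)
    then have "norm \<eta> \<le> s * norm (r \<xi>)" using x(1) projection_opD(1)[OF pr] by blast
    also have "\<dots> \<le> s * 1"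
      using projection_opD(4)[OF pr, of \<xi>] \<xi>(2) \<open>0 \<le> s\<close> by (intro mult_left_mono) linarith+
    finally show ?thesis by simp
  qed
  ultimately have "uniform_norm (op_graph r O x) \<le> ennreal s"
    by (auto simp: uniform_norm_def intro!: SUP_least ennreal_leI)
  then show ?thesis unfolding singular_value_def
    using assms(1,2) by (intro INF_lower2[of r]) auto
qed

text \<open>Restricting to unit vectors makes this hold for every graph \<open>x\<close>, linear or not.\<close>

lemma singular_value_lessD:
  assumes "singular_value M \<tau> t x < ennreal s"
  obtains r where "r \<in> projections M" "\<tau> (id_blinfun - r) \<le> ennreal t"
    "\<And>\<xi>. r \<xi> = \<xi> \<Longrightarrow> norm \<xi> = 1 \<Longrightarrow> \<exists>\<eta>. (\<xi>, \<eta>) \<in> x \<and> norm \<eta> < s"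
proof -
  obtain r where r: "r \<in> projections M" "\<tau> (id_blinfun - r) \<le> ennreal t"
    and u: "uniform_norm (op_graph r O x) < ennreal s"
    using assms unfolding singular_value_def INF_less_iff by blast
  have dom: "Domain (op_graph r O x) = UNIV"
    using u by (auto simp: uniform_norm_def split: if_splits)
  show ?thesis
  proof (rule that[OF r])
    fix \<xi> assume \<xi>: "r \<xi> = \<xi>" "norm \<xi> = 1"
    obtain \<eta> where \<eta>: "(\<xi>, \<eta>) \<in> op_graph r O x" using dom by blast
    then have "(\<xi>, \<eta>) \<in> x" using \<xi>(1) by (auto simp: op_graph_def)
    moreover have "ennreal (norm \<eta>) \<le> uniform_norm (op_graph r O x)"
      using \<eta> \<xi>(2) dom by (auto simp: uniform_norm_def intro!: SUP_upper2[of "(\<xi>, \<eta>)"])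
    then have "ennreal (norm \<eta>) < ennreal s" using u by (rule le_less_trans)
    then have "norm \<eta> < s" by (simp add: ennreal_less_iff)
    ultimately show "\<exists>\<eta>. (\<xi>, \<eta>) \<in> x \<and> norm \<eta> < s" by blast
  qed
qed

lemma eq_zero_if_no_unit_vector:
  fixes \<xi> :: "'a::real_normed_vector"
  assumes "\<And>u. norm u = 1 \<Longrightarrow> T u = u \<Longrightarrow> S u = u \<Longrightarrow> False" "T \<xi> = \<xi>" "S \<xi> = \<xi>" "linear T" "linear S"
  shows "\<xi> = 0"
proof (rule ccontr)
  assume "\<xi> \<noteq> 0"
  then show False
    using assms(1)[of "(1 / norm \<xi>) *\<^sub>R \<xi>"] assms(2-) by (simp add: linear_cmul)
qed

lemma strong_scale_minus_one:
  assumes "closed_dd_operator x"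
  shows "strong_scale (- 1) x = {(\<xi>, \<zeta>). (\<xi>, - \<zeta>) \<in> x}"
proof -
  have "{(\<xi>, (- 1) *\<^sub>C \<eta>) |\<xi> \<eta>. (\<xi>, \<eta>) \<in> x} = {(\<xi>, \<zeta>). (\<xi>, - \<zeta>) \<in> x}"
    by auto (metis minus_minus)
  moreover have "{(\<xi>, \<zeta>). (\<xi>, - \<zeta>) \<in> x} = (\<lambda>z. (fst z, - snd z)) -` x" by auto
  moreover have "closed ((\<lambda>z. (fst z, - snd z)) -` x)"
    using closed_dd_operatorD(7)[OF assms] by (rule closed_vimage) (intro continuous_intros)
  ultimately show ?thesis unfolding strong_scale_def by simp
qed

text \<open>The algebraic difference of a bounded and a closed operator is already closed.\<close>

lemma strong_minus_bounded:
  assumes "closed_dd_operator x"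
  shows "strong_minus (op_graph V) x = {(\<xi>, \<zeta>). (\<xi>, V \<xi> - \<zeta>) \<in> x}"
proof -
  have "{(\<xi>, \<eta> + \<zeta>) |\<xi> \<eta> \<zeta>. (\<xi>, \<eta>) \<in> op_graph V \<and> (\<xi>, \<zeta>) \<in> {(\<xi>, \<zeta>). (\<xi>, - \<zeta>) \<in> x}} = {(\<xi>, \<zeta>). (\<xi>, V \<xi> - \<zeta>) \<in> x}"
    (is "?L = ?R")
  proof safe
    fix \<xi> \<zeta> assume "(\<xi>, V \<xi> - \<zeta>) \<in> x"
    then show "\<exists>\<xi>' \<eta> \<zeta>'. (\<xi>, \<zeta>) = (\<xi>', \<eta> + \<zeta>') \<and> (\<xi>', \<eta>) \<in> op_graph V \<and> (\<xi>', \<zeta>') \<in> {(\<xi>, \<zeta>). (\<xi>, - \<zeta>) \<in> x}"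
      by (intro exI[of _ \<xi>] exI[of _ "V \<xi>"] exI[of _ "\<zeta> - V \<xi>"]) (auto simp: op_graph_def)
  qed (auto simp: op_graph_def)
  moreover have "?R = (\<lambda>z. (fst z, V (fst z) - snd z)) -` x" by auto
  moreover have "closed ((\<lambda>z. (fst z, V (fst z) - snd z)) -` x)"
    using closed_dd_operatorD(7)[OF assms] by (rule closed_vimage) (intro continuous_intros)
  ultimately show ?thesis
    unfolding strong_minus_def strong_scale_minus_one[OF assms] strong_add_def by simp
qed

lemma strong_scale_op_graph: "strong_scale c (op_graph T) = op_graph (scalar_op c o\<^sub>L T)"
proof -
  have "{(\<xi>, c *\<^sub>C \<eta>) |\<xi> \<eta>. (\<xi>, \<eta>) \<in> op_graph T} = {z. snd z = (scalar_op c o\<^sub>L T) (fst z)}"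
    by (auto simp: op_graph_def)
  moreover have "op_graph (scalar_op c o\<^sub>L T) = {z. snd z = (scalar_op c o\<^sub>L T) (fst z)}"
    by (auto simp: op_graph_def)
  moreover have "closed {z. snd z = (scalar_op c o\<^sub>L T) (fst z)}"
    by (intro closed_Collect_eq continuous_intros)
  ultimately show ?thesis unfolding strong_scale_def by simp
qed

text \<open>Perturbing \<open>x\<close> by a bounded operator that vanishes on the cyclic space of these vectors
  cannot decrease any singular value. They are chosen for rational pairs \<open>(s, b)\<close> such that \<open>g s\<close> has trace
  above \<open>b\<close>: finitely many vectors of \<open>g s\<close> whose cyclic projection also has trace above \<open>b\<close>.\<close>

lemma countable_vectors_determine_singular_values:
  fixes M :: "('h::complex_hilbert_space \<Rightarrow>\<^sub>L 'h) set"
  assumes M: "von_neumann_algebra M" and \<tau>: "trace_on M \<tau>" "normal_trace M \<tau>" and x: "x \<in> measurable_ops M \<tau>"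
  shows "\<exists>\<Xi>. countable \<Xi> \<and> (\<forall>V. (\<forall>\<eta>\<in>cyclic_space M \<Xi>. blinfun_apply V \<eta> = 0) \<longrightarrow>
    (\<forall>t>0. singular_value M \<tau> t x \<le> singular_value M \<tau> t (strong_minus (op_graph V) x)))"
proof -
  obtain g where gM: "\<And>s. s > 0 \<Longrightarrow> g s \<in> projections M"
    and g_lower: "\<And>s \<xi> \<eta>. blinfun_apply (g s) \<xi> = \<xi> \<Longrightarrow> (\<xi>, \<eta>) \<in> x \<Longrightarrow> s * norm \<xi> \<le> norm \<eta>"
    and g_upper: "\<And>s \<xi>. s > 0 \<Longrightarrow> blinfun_apply (g s) \<xi> = 0 \<Longrightarrow> \<exists>\<eta>. (\<xi>, \<eta>) \<in> x \<and> norm \<eta> \<le> s * norm \<xi>"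
    using measurable_op_spectral_projections[OF x M] by blast
  have xc: "closed_dd_operator x" using x by (simp add: measurable_ops_def)
  define I :: "(rat \<times> rat) set" where
    "I = {(a, b). real_of_rat a > 0 \<and> ennreal (real_of_rat b) < \<tau> (g (real_of_rat a))}"
  have "\<exists>X. finite X \<and> (\<forall>\<xi>\<in>X. g (real_of_rat (fst i)) \<xi> = \<xi>) \<and>
    ennreal (real_of_rat (snd i)) < \<tau> (orth_proj (cyclic_space M X))" if "i \<in> I" for i
    using that gM by (intro trace_exceeds_on_cyclic_projection[OF M \<tau>(2)]) (auto simp: I_def)
  then obtain X where X: "\<And>i. i \<in> I \<Longrightarrow> finite (X i)"
      "\<And>i \<xi>. i \<in> I \<Longrightarrow> \<xi> \<in> X i \<Longrightarrow> g (real_of_rat (fst i)) \<xi> = \<xi>"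
      "\<And>i. i \<in> I \<Longrightarrow> ennreal (real_of_rat (snd i)) < \<tau> (orth_proj (cyclic_space M (X i)))"
    by metis
  define \<Xi> where "\<Xi> = (\<Union>i\<in>I. X i)"
  have "countable \<Xi>"
    unfolding \<Xi>_def by (rule countable_UN[OF countableI_type]) (rule countable_finite[OF X(1)])
  moreover have "singular_value M \<tau> t x \<le> singular_value M \<tau> t (strong_minus (op_graph V) x)"
    if V: "\<forall>\<eta>\<in>cyclic_space M \<Xi>. blinfun_apply V \<eta> = 0" and t: "t > 0" for V t
  proof (rule ccontr)
    assume "\<not> ?thesis"
    then obtain a :: rat where a: "singular_value M \<tau> t (strong_minus (op_graph V) x) < ennreal (real_of_rat a)"
      "ennreal (real_of_rat a) < singular_value M \<tau> t x"
      using ennreal_rat_dense[of "singular_value M \<tau> t (strong_minus (op_graph V) x)"] by (auto simp: not_le)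
    define s where "s = real_of_rat a"
    have s: "s > 0" using a(1) unfolding s_def by (metis ennreal_eq_0_iff not_le not_less_zero)
    note gs = gM[OF s]
    have gp: "projection_op (g s)" using gs by (simp add: projections_def)
    have "\<not> \<tau> (g s) \<le> ennreal t"
    proof
      assume "\<tau> (g s) \<le> ennreal t"
      have "singular_value M \<tau> t x \<le> ennreal s"
      proof (rule singular_value_leI[OF projection_complement[OF M gs]])
        show "norm \<eta> \<le> s * norm \<xi>" if "(\<xi>, \<eta>) \<in> x" "(id_blinfun - g s) \<xi> = \<xi>" for \<xi> \<eta>
          using g_upper[OF s, of \<xi>] that closed_dd_operatorD(6)[OF xc] by (fastforce simp: blinfun.diff_left)
        show "\<xi> \<in> Domain x" if "(id_blinfun - g s) \<xi> = \<xi>" for \<xi>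
          using g_upper[OF s, of \<xi>] that by (auto simp: blinfun.diff_left)
      qed (use s \<open>\<tau> (g s) \<le> ennreal t\<close> in auto)
      then show False using a(2) by (simp add: s_def)
    qed
    \<comment> \<open>a rational strictly between \<open>t\<close> and \<open>\<tau> (g s)\<close>, since only rational thresholds were prepared\<close>
    then obtain b :: rat where b: "ennreal t < ennreal (real_of_rat b)" "ennreal (real_of_rat b) < \<tau> (g s)"
      using ennreal_rat_dense[of "ennreal t" "\<tau> (g s)"] by (auto simp: not_le)
    have ab: "(a, b) \<in> I" using s b(2) by (simp add: I_def s_def)
    let ?K = "cyclic_space M (X (a, b))"
    let ?e = "orth_proj ?K"
    have K: "subspace ?K" "closed ?K"
      using complex_subspace_cyclic_space[OF M] by (auto simp: complex_subspace_def)
    obtain r where r: "r \<in> projections M" "\<tau> (id_blinfun - r) \<le> ennreal t"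
      and r_unit: "\<And>\<xi>. blinfun_apply r \<xi> = \<xi> \<Longrightarrow> norm \<xi> = 1 \<Longrightarrow> \<exists>\<eta>. (\<xi>, \<eta>) \<in> strong_minus (op_graph V) x \<and> norm \<eta> < s"
      using singular_value_lessD[OF a(1)] unfolding s_def by metis
    have "\<tau> ?e \<le> \<tau> (id_blinfun - r)"
    proof (rule trace_le_if_kernel_meets_trivially[OF M \<tau> cyclic_projection[OF M] projection_complement[OF M r(1)]])
      fix \<xi> assume \<xi>: "?e \<xi> = \<xi>" "(id_blinfun - r) \<xi> = 0"
      show "\<xi> = 0"
      proof (rule eq_zero_if_no_unit_vector[of ?e r])
        fix u assume u: "norm u = 1" "?e u = u" "r u = u"
        obtain \<eta> where \<eta>: "(u, \<eta>) \<in> strong_minus (op_graph V) x" "norm \<eta> < s" using r_unit u by blast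
        have uK: "u \<in> ?K" using orth_proj_apply(1)[OF K, of u] u(2) by simp
        have "V u = 0" using V uK cyclic_space_mono[OF M, of "X (a, b)" \<Xi>] ab by (auto simp: \<Xi>_def)
        then have ux: "(u, - \<eta>) \<in> x" using \<eta>(1) by (simp add: strong_minus_bounded[OF xc])
        have "(id_blinfun - g s) u = 0"
        proof (rule cyclic_space_minimal[OF M _ _ uK])
          show "id_blinfun - g s \<in> M" using projection_complement[OF M gs] by (simp add: projections_def)
          show "(id_blinfun - g s) \<xi> = 0" if "\<xi> \<in> X (a, b)" for \<xi>
            using X(2)[OF ab that] by (simp add: blinfun.diff_left s_def)
        qed
        then have "g s u = u" by (simp add: blinfun.diff_left)
        from g_lower[OF this ux] \<eta>(2) u(1) show False by simp
      qed (use \<xi> in \<open>auto simp: blinfun.diff_left bounded_linear.linear blinfun.bounded_linear_right\<close>)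
    qed
    also have "\<dots> < ennreal (real_of_rat b)" using r(2) b(1) by (rule le_less_trans)
    also have "\<dots> < \<tau> ?e" using X(3)[OF ab] by simp
    finally show False .
  qed
  ultimately show ?thesis by blast
qed

section \<open>Projections as measurable operators\<close>

lemma closed_dd_op_graph:
  assumes "T \<in> bounded_ops" shows "closed_dd_operator (op_graph T)"
proof -
  have "op_graph T = {z. snd z = T (fst z)}" by (auto simp: op_graph_def)
  moreover have "closed {z. snd z = T (fst z)}" by (intro closed_Collect_eq continuous_intros)
  moreover have "Domain (op_graph T) = UNIV" by (auto simp: op_graph_def)
  ultimately show ?thesis
    using assms unfolding closed_dd_operator_def bounded_ops_def
    by (auto simp: blinfun.add_right blinfun.zero_right single_valued_def)
qed

lemma projection_measurable:
  fixes p :: "'h::complex_hilbert_space \<Rightarrow>\<^sub>L 'h"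
  assumes M: "von_neumann_algebra M" and \<tau>: "trace_on M \<tau>" and p: "p \<in> projections M"
  shows "op_graph p \<in> measurable_ops M \<tau>"
proof -
  have pp: "projection_op p" "p \<in> M" using p by (auto simp: projections_def)
  note p_simps = projection_opD(1,2)[OF pp(1)]
  have pb: "p \<in> bounded_ops" using pp(1) by (simp add: projection_op_def)
  have cinner_p: "cinner (p \<xi>) \<eta> = cinner \<xi> (p \<eta>)" for \<xi> \<eta>
    using pp(1) by (simp add: projection_op_def is_adjoint_def)
  have cd: "closed_dd_operator (op_graph p)" using pb by (rule closed_dd_op_graph)
  have aff: "affiliated M (op_graph p)"
    unfolding affiliated_def
  proof (intro ballI impI)
    fix u assume u: "u \<in> commutant M" "unitary_op u"
    obtain v where v: "u o\<^sub>L v = id_blinfun" using u(2) by (auto simp: unitary_op_def)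
    have uv: "u (v \<xi>) = \<xi>" for \<xi> using v by (metis blinfun_apply_blinfun_compose blinfun_apply_id_blinfun id_apply)
    have up: "u (p \<xi>) = p (u \<xi>)" for \<xi> using u(1) pp(2) by (rule commutant_commutes)
    show "(\<lambda>(\<xi>, \<eta>). (u \<xi>, u \<eta>)) ` op_graph p = op_graph p"
    proof (intro equalityI subsetI)
      fix z assume "z \<in> op_graph p"
      then obtain \<xi> where "z = (\<xi>, p \<xi>)" by (auto simp: op_graph_def)
      then have "z = (\<lambda>(\<xi>, \<eta>). (u \<xi>, u \<eta>)) (v \<xi>, p (v \<xi>))" by (simp add: up uv)
      then show "z \<in> (\<lambda>(\<xi>, \<eta>). (u \<xi>, u \<eta>)) ` op_graph p"
        by (rule image_eqI) (simp add: op_graph_def)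
    qed (auto simp: op_graph_def up)
  qed
  have adj: "adjoint_graph (op_graph p) = op_graph p"
  proof (intro equalityI subsetI)
    fix z assume "z \<in> adjoint_graph (op_graph p)"
    then obtain \<eta> \<zeta> where z: "z = (\<eta>, \<zeta>)" "(\<eta>, \<zeta>) \<in> adjoint_graph (op_graph p)" by (cases z) auto
    have "inner \<xi> \<zeta> = inner \<xi> (p \<eta>)" for \<xi>
      using adjoint_graphD[OF z(2), of \<xi> "p \<xi>"] by (simp add: op_graph_def p_simps)
    then have "\<zeta> = p \<eta>" by (rule inner_ext)
    then show "z \<in> op_graph p" by (simp add: z(1) op_graph_def)
  qed (auto simp: op_graph_def adjoint_graph_def cinner_p)
  have cpp: "cinner (p \<xi>) \<xi> = complex_of_real ((norm (p \<xi>))\<^sup>2)" for \<xi>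
    using cinner_self[of "p \<xi>"] by (simp add: cinner_p p_simps)
  have abs: "is_absolute_value (op_graph p) (op_graph p)"
    unfolding is_absolute_value_def adj
    using cd by (auto simp: op_graph_def cpp complex_nonneg_Reals_iff)
  \<comment> \<open>the spectral measure of a projection is supported on \<open>{0, 1}\<close>\<close>
  define P :: "real set \<Rightarrow> 'h \<Rightarrow>\<^sub>L 'h" where "P B = indicat_real B 0 *\<^sub>R (id_blinfun - p) + indicat_real B 1 *\<^sub>R p" for B
  have P_apply: "P B \<xi> = indicat_real B 0 *\<^sub>R (\<xi> - p \<xi>) + indicat_real B 1 *\<^sub>R p \<xi>" for B \<xi>
    by (simp add: P_def blinfun.add_left blinfun.scaleR_left blinfun.diff_left)
  have q: "projection_op (id_blinfun - p)"
    using projection_complement[OF M p] by (simp add: projections_def)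
  have "projection_op (0 :: 'h \<Rightarrow>\<^sub>L 'h)" "projection_op (id_blinfun :: 'h \<Rightarrow>\<^sub>L 'h)"
    by (auto simp: projection_op_def bounded_ops_def is_adjointI blinfun_eq_iff
      linear_0[OF bounded_linear.linear[OF bounded_linear_scaleC]])
  then have P_proj: "projection_op (P B)" for B
    using pp(1) q by (auto simp: P_def indicator_def)
  have pvm: "projection_valued_measure P"
    unfolding projection_valued_measure_def
  proof (intro conjI ballI allI impI)
    show "P UNIV = id_blinfun" by (simp add: P_def)
    fix B :: "nat \<Rightarrow> real set" and \<xi>
    assume B: "range B \<subseteq> sets borel \<and> disjoint_family B"
    have "(\<lambda>n. indicat_real (B n) t) sums indicat_real (\<Union>n. B n) t" for t
      using B by (intro indicator_sums) (auto simp: disjoint_family_on_def)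
    then show "(\<lambda>n. P (B n) \<xi>) sums P (\<Union>n. B n) \<xi>"
      unfolding P_apply by (intro sums_add sums_scaleR_left)
  qed (rule P_proj)
  have AE01: "AE t in scalar_measure P \<xi>. t \<in> {0, 1}" for \<xi>
    by (rule AE_scalar_measure[OF pvm]) (simp_all add: P_apply)
  have "(\<integral>\<^sup>+t. ennreal (t\<^sup>2) \<partial>scalar_measure P \<xi>) < \<infinity>" for \<xi>
  proof (rule nn_square_finite_bounded[OF pvm])
    show "AE t in scalar_measure P \<xi>. \<bar>t\<bar> \<le> 1" using AE01[of \<xi>] by eventually_elim auto
  qed
  moreover have "(\<integral>t. t \<partial>scalar_measure P \<xi>) = (norm (p \<xi>))\<^sup>2" for \<xi>
  proof -
    have "(\<integral>t. t \<partial>scalar_measure P \<xi>) = (\<integral>t. indicat_real {1} t \<partial>scalar_measure P \<xi>)"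
    proof (rule integral_cong_AE)
      show "AE t in scalar_measure P \<xi>. t = indicat_real {1} t" using AE01[of \<xi>] by eventually_elim auto
    qed (simp_all add: sets_scalar_measure[OF pvm] cong: measurable_cong_sets)
    also have "\<dots> = measure (scalar_measure P \<xi>) {1}"
      by (simp add: space_scalar_measure[OF pvm])
    also have "\<dots> = (norm (p \<xi>))\<^sup>2"
      by (simp add: measure_def emeasure_scalar_measure[OF pvm] P_apply)
    finally show ?thesis .
  qed
  ultimately have spec: "is_spectral_measure (op_graph p) P"
    unfolding is_spectral_measure_def using pvm by (auto simp: op_graph_def cpp)
  have P_tail: "P {s<..} = (if s < 1 then p else 0)" if "s > 0" for s
    using that by (simp add: P_def)
  have zero_M: "0 \<in> M" using von_neumann_algebra_closed(4)[OF M pp(2) pp(2)] by simp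
  have "\<tau> 0 = 0" using \<tau> by (rule trace_zero[OF M])
  then have "\<exists>s>0. \<tau> (P {s<..}) < \<infinity>" using P_tail[of 1] by (intro exI[of _ 1]) simp
  moreover have "\<forall>s>0. P {s<..} \<in> M" using P_tail zero_M pp(2) by simp
  ultimately show ?thesis
    unfolding measurable_ops_def using cd aff abs spec by blast
qed

text \<open>By the comparison inequality \<open>\<tau>(f) \<le> \<tau>(p)\<close>. The singular values of a projection of trace \<open>T\<close>
  are \<open>1\<close> for \<open>t < T\<close> and \<open>0\<close> for \<open>t \<ge> T\<close>, so those of \<open>f\<close> are dominated by those of \<open>p\<close>.\<close>

lemma projection_in_symmetric_space:
  assumes M: "von_neumann_algebra M" and \<tau>: "trace_on M \<tau>" "normal_trace M \<tau>"
    and E: "symmetric_space M \<tau> E N" and p: "p \<in> projections M" "op_graph p \<in> E" and f: "f \<in> projections M"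
    and inj: "\<And>\<xi>. blinfun_apply f \<xi> = \<xi> \<Longrightarrow> blinfun_apply p \<xi> = 0 \<Longrightarrow> \<xi> = 0"
  shows "op_graph f \<in> E"
proof -
  have fp: "projection_op f" using f by (simp add: projections_def)
  have f_le_p: "\<tau> f \<le> \<tau> p" by (rule trace_le_if_kernel_meets_trivially[OF M \<tau> f p(1) inj])
  have "singular_value M \<tau> t (op_graph f) \<le> singular_value M \<tau> t (op_graph p)" for t
  proof (cases "\<tau> f \<le> ennreal t")
    case True
    have "singular_value M \<tau> t (op_graph f) \<le> ennreal 0"
      by (rule singular_value_leI[OF projection_complement[OF M f]])
        (use True in \<open>auto simp: op_graph_def blinfun.diff_left\<close>)
    then show ?thesis by simp
  next
    case False
    have "singular_value M \<tau> t (op_graph f) \<le> ennreal 1"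
      by (rule singular_value_leI[OF id_projection[OF M]])
        (use projection_opD(4)[OF fp] in \<open>auto simp: op_graph_def trace_zero[OF M \<tau>(1)]\<close>)
    also have "\<dots> \<le> singular_value M \<tau> t (op_graph p)"
    proof (rule ccontr)
      assume "\<not> ?thesis"
      then have "singular_value M \<tau> t (op_graph p) < ennreal 1" by simp
      then obtain r where r: "r \<in> projections M" "\<tau> (id_blinfun - r) \<le> ennreal t"
        "\<And>\<xi>. blinfun_apply r \<xi> = \<xi> \<Longrightarrow> norm \<xi> = 1 \<Longrightarrow> \<exists>\<eta>. (\<xi>, \<eta>) \<in> op_graph p \<and> norm \<eta> < 1"
        by (rule singular_value_lessD) blast
      have "\<tau> p \<le> \<tau> (id_blinfun - r)"
      proof (rule trace_le_if_kernel_meets_trivially[OF M \<tau> p(1) projection_complement[OF M r(1)]])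
        fix \<xi> assume \<xi>: "p \<xi> = \<xi>" "(id_blinfun - r) \<xi> = 0"
        show "\<xi> = 0"
        proof (rule eq_zero_if_no_unit_vector[of p r])
          fix u assume "norm u = 1" "p u = u" "r u = u"
          then show False using r(3)[of u] by (auto simp: op_graph_def)
        qed (use \<xi> in \<open>auto simp: blinfun.diff_left bounded_linear.linear blinfun.bounded_linear_right\<close>)
      qed
      with f_le_p r(2) False show False by (meson order_trans)
    qed
    finally show ?thesis .
  qed
  then show ?thesis
    using E p(2) projection_measurable[OF M \<tau>(1) f] unfolding symmetric_space_def by blast
qed

section \<open>The ball-covering property\<close>

text \<open>The projection \<open>e\<close> onto the closure of the range of \<open>fp\<close>. A vector \<open>\<xi>\<close> of \<open>e\<close> satisfies
  \<open>f\<xi> = \<xi>\<close>; if also \<open>p\<xi> = 0\<close>, then \<open>\<langle>\<xi>, fpy\<rangle> = \<langle>p\<xi>, y\<rangle> = 0\<close> for all \<open>y\<close>, and \<open>\<xi>\<close> is orthogonal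
  to the range of \<open>e\<close>.\<close>

lemma range_projection:
  fixes M :: "('h::complex_hilbert_space \<Rightarrow>\<^sub>L 'h) set"
  assumes M: "von_neumann_algebra M" and f: "f \<in> projections M" and p: "p \<in> projections M"
  obtains e where "e \<in> projections M" "\<And>\<xi>. blinfun_apply f \<xi> = 0 \<Longrightarrow> blinfun_apply e \<xi> = 0"
    "\<And>\<xi>. blinfun_apply e \<xi> = \<xi> \<Longrightarrow> blinfun_apply p \<xi> = 0 \<Longrightarrow> \<xi> = 0"
    "\<And>\<xi>. blinfun_apply e (blinfun_apply f (blinfun_apply p \<xi>)) = blinfun_apply f (blinfun_apply p \<xi>)"
proof -
  have fp: "projection_op f" "f \<in> M" and pp: "projection_op p" "p \<in> M"
    using f p by (auto simp: projections_def)
  define A where "A = range (\<lambda>\<xi>. f (p \<xi>))"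
  let ?K = "closure (span A)"
  let ?e = "orth_proj ?K"
  have fpM: "f o\<^sub>L p \<in> M" using von_neumann_algebra_closed(2)[OF M] fp pp by blast
  have sc: "c *\<^sub>C x \<in> A" if x: "x \<in> A" for c x
  proof -
    obtain y where "x = f (p y)" using x by (auto simp: A_def)
    then have "c *\<^sub>C x = f (p (c *\<^sub>C y))"
      using fp(1) pp(1) by (simp add: projection_op_def bounded_ops_def)
    then show ?thesis by (simp add: A_def)
  qed
  have K: "subspace ?K" "closed ?K" using subspace_closure_span by auto
  note pr = orth_proj_apply[OF K]
  have e: "?e \<in> projections M"
  proof (rule orth_proj_in_von_neumann_algebra[OF M complex_subspace_closure_span[OF sc]])
    fix T \<xi> assume T: "T \<in> commutant M" and \<xi>: "\<xi> \<in> ?K"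
    have "T ` A \<subseteq> A"
      using commutant_commutes[OF T fpM] by (auto simp: A_def)
    then show "T \<xi> \<in> ?K" using \<xi> by (intro closure_span_invariant[OF blinfun.bounded_linear_right])
  qed
  then have ep: "projection_op ?e" by (simp add: projections_def)
  have f_fix: "f \<eta> = \<eta>" if "\<eta> \<in> ?K" for \<eta>
  proof -
    have "(id_blinfun - f) \<eta> = 0"
      by (rule zero_on_closure_span[OF blinfun.bounded_linear_right _ that])
        (auto simp: A_def blinfun.diff_left projection_opD(1)[OF fp(1)])
    then show ?thesis by (simp add: blinfun.diff_left)
  qed
  show ?thesis
  proof (rule that[OF e])
    show "?e \<xi> = 0" if "f \<xi> = 0" for \<xi>
    proof -
      have "(norm (?e \<xi>))\<^sup>2 = inner (f (?e \<xi>)) \<xi>"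
        using projection_opD(3)[OF ep] f_fix[OF pr(1)] by simp
      also have "\<dots> = 0" using that by (simp add: projection_opD(2)[OF fp(1)])
      finally show ?thesis by simp
    qed
    show "\<xi> = 0" if \<xi>: "?e \<xi> = \<xi>" "p \<xi> = 0" for \<xi>
    proof -
      have \<xi>K: "\<xi> \<in> ?K" using pr(1)[of \<xi>] \<xi>(1) by simp
      have "inner \<xi> \<xi> = 0"
      proof (rule zero_on_closure_span[OF bounded_linear_inner_right _ \<xi>K])
        fix x assume "x \<in> A"
        then obtain y where "x = f (p y)" by (auto simp: A_def)
        then have "inner \<xi> x = inner (p (f \<xi>)) y"
          by (simp add: projection_opD(2)[OF fp(1)] projection_opD(2)[OF pp(1)])
        then show "inner \<xi> x = 0" using f_fix[OF \<xi>K] \<xi>(2) by simp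
      qed
      then show ?thesis by simp
    qed
    show "?e (f (p \<xi>)) = f (p \<xi>)" for \<xi>
      by (rule orth_proj_in[OF K]) (auto simp: A_def intro!: subsetD[OF closure_subset] span_base)
  qed
qed

text \<open>Otherwise \<open>1 - f\<close> would dominate every projection in \<open>E\<close>, and therefore the identity.\<close>

lemma carrier_meets_projection:
  assumes M: "von_neumann_algebra M" and c: "is_carrier_projection M E id_blinfun"
    and f: "f \<in> projections M" "f \<noteq> 0"
  shows "\<exists>p\<in>projections M. op_graph p \<in> E \<and> f o\<^sub>L p \<noteq> 0"
proof (rule ccontr)
  assume "\<not> ?thesis"
  then have fp: "f (p \<xi>) = 0" if "p \<in> projections M" "op_graph p \<in> E" for p \<xi>
    using that by (metis blinfun_apply_blinfun_compose zero_blinfun.rep_eq)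
  have f': "projection_op f" using f by (simp add: projections_def)
  note q = projection_complement[OF M f(1)]
  have "op_le p (id_blinfun - f)" if p: "p \<in> projections M" "op_graph p \<in> E" for p
    unfolding op_le_projections[OF M p(1) q]
  proof
    fix \<xi>
    have pp: "projection_op p" using p by (simp add: projections_def)
    have "(norm (p \<xi>))\<^sup>2 = inner (p \<xi>) ((id_blinfun - f) \<xi>)"
      using projection_opD(3)[OF pp, of \<xi>] projection_opD(2)[OF f', of "p \<xi>" \<xi>] fp[OF p, of \<xi>]
      by (simp add: blinfun.diff_left inner_diff_right)
    also have "\<dots> \<le> norm (p \<xi>) * norm ((id_blinfun - f) \<xi>)" by (rule norm_cauchy_schwarz)
    finally show "norm (p \<xi>) \<le> norm ((id_blinfun - f) \<xi>)"
      by (cases "p \<xi> = 0") (auto simp: power2_eq_square)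
  qed
  then have le: "op_le id_blinfun (id_blinfun - f)" and id: "id_blinfun \<in> projections M"
    using c q unfolding is_carrier_projection_def by blast+
  have "f \<eta> = 0" for \<eta>
    using le[unfolded op_le_projections[OF M id q], rule_format, of "f \<eta>"]
    by (simp add: blinfun.diff_left projection_opD(1)[OF f'])
  then have "f = 0" by (simp add: blinfun_eq_iff)
  with f(2) show False by simp
qed

text \<open>The balls can be forgotten: since such a ball omits the origin, its radius is at most the norm
  of its centre, and is smaller than that norm if the ball is closed.\<close>

lemma ball_covering_centres:
  assumes bcp: "ball_covering_property V sub zero N"
    and zero: "zero \<in> V" "\<And>c. c \<in> V \<Longrightarrow> N (sub zero c) = N c"
  obtains C where "countable C" "C \<subseteq> V" "\<And>v. v \<in> V \<Longrightarrow> N v = 1 \<Longrightarrow> \<exists>c\<in>C. N (sub v c) < N c"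
proof -
  from bcp obtain \<B> where \<B>: "countable \<B> \<and>
      (\<forall>B\<in>\<B>. zero \<notin> B \<and>
         (\<exists>c\<in>V. \<exists>r>0. B = {v \<in> V. N (sub v c) < r} \<or> B = {v \<in> V. N (sub v c) \<le> r})) \<and>
      {v \<in> V. N v = 1} \<subseteq> \<Union>\<B>"
    unfolding ball_covering_property_def by (rule exE)
  have "\<exists>c. c \<in> V \<and> (\<forall>v\<in>B. N (sub v c) < N c)" if B: "B \<in> \<B>" for B
  proof -
    have "zero \<notin> B" and "\<exists>c\<in>V. \<exists>r>0. B = {v \<in> V. N (sub v c) < r} \<or> B = {v \<in> V. N (sub v c) \<le> r}"
      using \<B>[THEN conjunct2, THEN conjunct1, THEN bspec, OF B] by (rule conjunct1, rule conjunct2)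
    then obtain c where c: "c \<in> V"
      and "\<exists>r>0. B = {v \<in> V. N (sub v c) < r} \<or> B = {v \<in> V. N (sub v c) \<le> r}"
      by - (rule bexE)
    then obtain r where "0 < r \<and> (B = {v \<in> V. N (sub v c) < r} \<or> B = {v \<in> V. N (sub v c) \<le> r})"
      by - (erule exE)
    then have "B = {v \<in> V. N (sub v c) < r} \<or> B = {v \<in> V. N (sub v c) \<le> r}" by (rule conjunct2)
    then have "\<forall>v\<in>B. N (sub v c) < N c"
      using \<open>zero \<notin> B\<close> zero(1) zero(2)[OF c] by auto
    with c show ?thesis by blast
  qed
  then obtain c where c: "\<And>B. B \<in> \<B> \<Longrightarrow> c B \<in> V" "\<And>B v. B \<in> \<B> \<Longrightarrow> v \<in> B \<Longrightarrow> N (sub v (c B)) < N (c B)"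
    by metis
  show ?thesis
  proof (rule that[of "c ` \<B>"])
    show "\<exists>c\<in>c ` \<B>. N (sub v c) < N c" if v: "v \<in> V" "N v = 1" for v
    proof -
      obtain B where "B \<in> \<B>" "v \<in> B" using \<B> v by blast
      then show ?thesis using c(2) by blast
    qed
  qed (use \<B> c(1) in auto)
qed

theorem proposition4p2:
  fixes M :: "('h::complex_hilbert_space \<Rightarrow>\<^sub>L 'h) set"
    and \<tau> :: "('h \<Rightarrow>\<^sub>L 'h) \<Rightarrow> ennreal"
    and E :: "'h graph set"
    and N :: "'h graph \<Rightarrow> real"
  assumes "von_neumann_algebra M"
    and "trace_on M \<tau>" and "semifinite_trace M \<tau>" and "faithful_trace M \<tau>" and "normal_trace M \<tau>"
    and "\<not> sigma_finite_algebra M"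
    and "symmetric_space M \<tau> E N"
    and "E \<noteq> {op_graph 0}"
    and "is_carrier_projection M E id_blinfun"
  shows "\<not> ball_covering_property E strong_minus (op_graph 0) N"
proof
  note M = assms(1) and \<tau> = assms(2,5) and E = assms(7)
  have E_meas: "E \<subseteq> measurable_ops M \<tau>" and lin: "linear_subspace_ops E" and norm: "norm_on_ops E N"
    and symm: "\<And>x y. x \<in> E \<Longrightarrow> y \<in> measurable_ops M \<tau> \<Longrightarrow>
      \<forall>t>0. singular_value M \<tau> t y \<le> singular_value M \<tau> t x \<Longrightarrow> N y \<le> N x"
    using E unfolding symmetric_space_def by blast+
  have E_closed: "closed_dd_operator x" if "x \<in> E" for x
    using that E_meas by (auto simp: measurable_ops_def)
  have E_scale: "strong_scale c x \<in> E" and N_scale: "N (strong_scale c x) = cmod c * N x" if "x \<in> E" for c x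
    using that lin norm unfolding linear_subspace_ops_def norm_on_ops_def by blast+
  have E_minus: "strong_minus x y \<in> E" if "x \<in> E" "y \<in> E" for x y
    using that lin E_scale unfolding linear_subspace_ops_def strong_minus_def by blast
  have zero_E: "op_graph 0 \<in> E" using lin by (simp add: linear_subspace_ops_def)
  have N_minus: "N (strong_minus (op_graph 0) x) = N x" if "x \<in> E" for x
    using N_scale[OF that, of "- 1"]
    by (simp add: strong_minus_bounded strong_scale_minus_one E_closed that)
  assume bcp: "ball_covering_property E strong_minus (op_graph 0) N"
  obtain C where C: "countable C" "C \<subseteq> E"
    and cover: "\<And>v. v \<in> E \<Longrightarrow> N v = 1 \<Longrightarrow> \<exists>c\<in>C. N (strong_minus v c) < N c"
    by (rule ball_covering_centres[OF bcp zero_E N_minus]) blast+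
  have "\<exists>\<Xi>. countable \<Xi> \<and> (\<forall>V. (\<forall>\<eta>\<in>cyclic_space M \<Xi>. blinfun_apply V \<eta> = 0) \<longrightarrow>
    (\<forall>t>0. singular_value M \<tau> t c \<le> singular_value M \<tau> t (strong_minus (op_graph V) c)))"
    if "c \<in> C" for c
    using that C(2) E_meas by (intro countable_vectors_determine_singular_values[OF M \<tau>]) blast
  then obtain X where X: "\<And>c. c \<in> C \<Longrightarrow> countable (X c)"
    and X_sv: "\<And>c V t. c \<in> C \<Longrightarrow> \<forall>\<eta>\<in>cyclic_space M (X c). blinfun_apply V \<eta> = 0 \<Longrightarrow> t > 0 \<Longrightarrow>
      singular_value M \<tau> t c \<le> singular_value M \<tau> t (strong_minus (op_graph V) c)"
    by metis
  define \<Xi> where "\<Xi> = (\<Union>c\<in>C. X c)"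
  have \<Xi>: "countable \<Xi>" unfolding \<Xi>_def using C(1) X by (rule countable_UN)
  obtain F where F: "F \<subseteq> projections M - {0}" and orth: "pairwise (\<lambda>p q. p o\<^sub>L q = 0) F" and unc: "uncountable F"
    using assms(6) unfolding sigma_finite_algebra_def by blast
  have F_proj: "projection_op f" if "f \<in> F" for f using F that by (auto simp: projections_def)
  define G where "G = (\<Union>\<xi>\<in>\<Xi>. {f\<in>F. blinfun_apply f \<xi> \<noteq> 0})"
  have "countable G"
    unfolding G_def using \<Xi> countably_many_projections_not_annihilating[OF F_proj orth] by (rule countable_UN)
  with unc have "uncountable (F - G)" by (rule uncountable_minus_countable)
  then have "F - G \<noteq> {}" by (metis countable_empty)
  then obtain f where f: "f \<in> F" "f \<notin> G" by blast
  have f\<Xi>: "blinfun_apply f \<xi> = 0" if "\<xi> \<in> \<Xi>" for \<xi>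
    using f that unfolding G_def by blast
  have fM: "f \<in> projections M" "f \<noteq> 0" using f(1) F by auto
  obtain p where p: "p \<in> projections M" "op_graph p \<in> E" "f o\<^sub>L p \<noteq> 0"
    using carrier_meets_projection[OF M assms(9) fM] by blast
  obtain e where e: "e \<in> projections M" "\<And>\<xi>. blinfun_apply f \<xi> = 0 \<Longrightarrow> blinfun_apply e \<xi> = 0"
    "\<And>\<xi>. blinfun_apply e \<xi> = \<xi> \<Longrightarrow> blinfun_apply p \<xi> = 0 \<Longrightarrow> \<xi> = 0"
    "\<And>\<xi>. blinfun_apply e (blinfun_apply f (blinfun_apply p \<xi>)) = blinfun_apply f (blinfun_apply p \<xi>)"
    using range_projection[OF M fM(1) p(1)] by blast
  have eE: "op_graph e \<in> E" by (rule projection_in_symmetric_space[OF M \<tau> E p(1,2) e(1,3)])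
  have "e \<noteq> 0"
  proof
    assume "e = 0"
    then have "f o\<^sub>L p = 0" using e(4) by (simp add: blinfun_eq_iff)
    with p(3) show False by simp
  qed
  then obtain \<xi> where "e \<xi> \<noteq> 0" by (auto simp: blinfun_eq_iff)
  then have "op_graph e \<noteq> op_graph 0" by (auto simp: op_graph_def set_eq_iff)
  then have Ne: "N (op_graph e) > 0" using eE norm unfolding norm_on_ops_def by (metis less_eq_real_def)
  define V where "V = scalar_op (complex_of_real (1 / N (op_graph e))) o\<^sub>L e"
  have v: "op_graph V = strong_scale (complex_of_real (1 / N (op_graph e))) (op_graph e)"
    unfolding V_def by (rule strong_scale_op_graph[symmetric])
  have vE: "op_graph V \<in> E" unfolding v using eE by (rule E_scale)
  have "N (op_graph V) = 1" unfolding v N_scale[OF eE] norm_of_real using Ne by simp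
  then obtain c where c: "c \<in> C" "N (strong_minus (op_graph V) c) < N c" using vE cover by blast
  have V_zero: "\<forall>\<eta>\<in>cyclic_space M (X c). V \<eta> = 0"
  proof
    fix \<eta> assume "\<eta> \<in> cyclic_space M (X c)"
    moreover have "f \<xi> = 0" if "\<xi> \<in> X c" for \<xi>
      using f\<Xi>[of \<xi>] that c(1) unfolding \<Xi>_def by blast
    moreover have "f \<in> M" using fM(1) by (simp add: projections_def)
    ultimately have "f \<eta> = 0" using cyclic_space_minimal[OF M] by blast
    then show "V \<eta> = 0" using e(2) by (simp add: V_def linear_0[OF bounded_linear.linear[OF bounded_linear_scaleC]])
  qed
  have cE: "c \<in> E" using c(1) C(2) by blast
  have "N c \<le> N (strong_minus (op_graph V) c)"
    using E_minus[OF vE cE] cE E_meas X_sv[OF c(1) V_zero] by (intro symm) auto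
  with c(2) show False by simp
qed

end
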